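(* If $P$ is analytic, then $S$ restricts to a bounded analytic $C_0$-semigroup $S_H$ on $H$; that is, there exists a bounded analytic $C_0$-semigroup $S_H$ on $H$ such that $S(t)\circ i=i\circ S_H(t)$ for all $t\ge0$.
   Context: Setting. $E$ is a real Banach space, $A$ is the generator of a $C_0$-semigroup $S=(S(t))_{t\ge0}$ on $E$, and $H$ is a real Hilbert space continuously embedded in $E$ with inclusion map $i:H\hookrightarrow E$. Standing assumption: the operator $I_\infty:L^2(0,\infty;H)\to E$, $I_\infty g:=\int_0^\infty S(t)i g(t)\,dt$, is $\gamma$-radonifying; equivalently, $Q_\infty:=I_\infty I_\infty^*$ is the covariance operator of a centred Gaussian Radon measure $\mu_\infty$ on $E$. Then for each $t\ge0$ the operator $I_t:L^2(0,t;H)\to E$, $I_tg:=\int_0^tS(s)ig(s)\,ds$, is also $\gamma$-radonifying, and $I_tI_t^*$ is the covariance operator of a centred Gaussian Radon measure $\mu_t$ on $E$ (the distribution at time $t$ of the solution of $dU=AU\,dt+dW_H$, $U(0)=0$, with $W_H$ an $H$-cylindrical Brownian motion). The reproducing kernel Hilbert space of $\mu_\infty$ is denoted $H_\infty$, with inclusion $i_\infty:H_\infty\hookrightarrow E$, so $Q_\infty=i_\infty i_\infty^*$. It is known that $S$ restricts to a $C_0$-contraction semigroup $S_\infty$ on $H_\infty$. The Ornstein-Uhlenbeck semigroup $P=(P(t))_{t\ge0}$ is defined for bounded continuous $f:E\to\mathbb{R}$ by $P(t)f(x)=\int_Ef(S(t)x+y)\,d\mu_t(y)$; it extends uniquely to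 a $C_0$-contraction semigroup, again denoted $P$, on $L^p(E,\mu_\infty)$ for $1\le p<\infty$. "$P$ is analytic" means that for some (and hence for all) $1<p<\infty$ the following conditions, known to be equivalent, hold: (1) $P$ is an analytic $C_0$-semigroup on $L^p(E,\mu_\infty)$; (2) $P$ is an analytic $C_0$-contraction semigroup on $L^p(E,\mu_\infty)$; (3) $S_\infty$ is an analytic $C_0$-contraction semigroup on $H_\infty$; (4) there is a bounded operator $B:H\to H$ such that $iBi^*x^*=Q_\infty A^*x^*$ for all $x^*\in\mathsf{D}(A^* )$. Here an analytic $C_0$-contraction semigroup is required to be contractive on an open sector containing the positive real axis; a bounded analytic semigroup is one whose analytic extension is uniformly bounded on some open sector containing the positive real axis. Analyticity of semigroups on real spaces is understood after complexification. *)

theory Defs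
  imports "HOL-Probability.Probability" "HOL-Library.Function_Algebras"
begin

text \<open>A semigroup is indexed by \<^typ>\<open>real\<close>; its values at negative times are irrelevant.\<close>

definition c0_semigroup :: "(real \<Rightarrow> 'a::banach \<Rightarrow>\<^sub>L 'a) \<Rightarrow> bool" where
  "c0_semigroup S \<longleftrightarrow>
     S 0 = id_blinfun \<and>
     (\<forall>s\<ge>0. \<forall>t\<ge>0. S (s + t) = S s o\<^sub>L S t) \<and>
     (\<forall>x. ((\<lambda>t. S t x) \<longlongrightarrow> x) (at_right 0))"

text \<open>Unbounded operators are represented by their graphs.\<close>

definition generator :: "(real \<Rightarrow> 'a::banach \<Rightarrow>\<^sub>L 'a) \<Rightarrow> ('a \<times> 'a) set" where
  "generator S = {(x, y). ((\<lambda>t. (1 / t) *\<^sub>R (S t x - x)) \<longlongrightarrow> y) (at_right 0)}"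

definition dual_graph ::
    "('a::banach \<times> 'a) set \<Rightarrow> (('a \<Rightarrow>\<^sub>L real) \<times> ('a \<Rightarrow>\<^sub>L real)) set" where
  "dual_graph A = {(xs, ys). \<forall>(x, y)\<in>A. blinfun_apply xs y = blinfun_apply ys x}"

text \<open>The complex spaces that occur are complexifications of real Hilbert spaces and complex
  \<open>L\<^sup>p\<close>-spaces. The latter consist of functions, not of classes of functions, so they carry only a
  seminorm; accordingly \<open>x = y\<close> in the space is expressed as \<open>snorm X (x - y) = 0\<close>.\<close>

record 'v cspace =
  carr :: "'v set"
  scale :: "complex \<Rightarrow> 'v \<Rightarrow> 'v"
  snorm :: "'v \<Rightarrow> real"

definition bounded_op_by :: "'v::ab_group_add cspace \<Rightarrow> real \<Rightarrow> ('v \<Rightarrow> 'v) \<Rightarrow> bool" where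
  "bounded_op_by X C T \<longleftrightarrow>
     (\<forall>x\<in>carr X. T x \<in> carr X) \<and>
     (\<forall>x\<in>carr X. \<forall>y\<in>carr X. snorm X (T (x + y) - (T x + T y)) = 0) \<and>
     (\<forall>c. \<forall>x\<in>carr X. snorm X (T (scale X c x) - scale X c (T x)) = 0) \<and>
     (\<forall>x\<in>carr X. snorm X (T x) \<le> C * snorm X x)"

definition bounded_op :: "'v::ab_group_add cspace \<Rightarrow> ('v \<Rightarrow> 'v) \<Rightarrow> bool" where
  "bounded_op X T \<longleftrightarrow> (\<exists>C. bounded_op_by X C T)"

definition c0_semigroup_on :: "'v::ab_group_add cspace \<Rightarrow> (real \<Rightarrow> 'v \<Rightarrow> 'v) \<Rightarrow> bool" where
  "c0_semigroup_on X T \<longleftrightarrow>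
     (\<forall>t\<ge>0. bounded_op X (T t)) \<and>
     (\<forall>x\<in>carr X. snorm X (T 0 x - x) = 0) \<and>
     (\<forall>s\<ge>0. \<forall>t\<ge>0. \<forall>x\<in>carr X. snorm X (T (s + t) x - T s (T t x)) = 0) \<and>
     (\<forall>x\<in>carr X. ((\<lambda>t. snorm X (T t x - x)) \<longlongrightarrow> 0) (at_right 0))"

definition holomorphic_into :: "'v::ab_group_add cspace \<Rightarrow> (complex \<Rightarrow> 'v) \<Rightarrow> complex set \<Rightarrow> bool" where
  "holomorphic_into X F U \<longleftrightarrow>
     (\<forall>z\<in>U. \<exists>d\<in>carr X.
        ((\<lambda>w. snorm X (scale X (1 / (w - z)) (F w - F z) - d)) \<longlongrightarrow> 0) (at z))"

definition sector :: "real \<Rightarrow> complex set" where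
  "sector \<delta> = {z. z \<noteq> 0 \<and> \<bar>Arg z\<bar> < \<delta>}"

text \<open>\<open>G\<close> is an analytic extension of \<open>T\<close> to the sector of half-angle \<open>\<delta>\<close>; the bound \<open>\<delta> \<le> pi / 2\<close>
  makes the sector closed under addition.\<close>

definition analytic_extension ::
    "'v::ab_group_add cspace \<Rightarrow> (real \<Rightarrow> 'v \<Rightarrow> 'v) \<Rightarrow> real \<Rightarrow> (complex \<Rightarrow> 'v \<Rightarrow> 'v) \<Rightarrow> bool" where
  "analytic_extension X T \<delta> G \<longleftrightarrow>
     0 < \<delta> \<and> \<delta> \<le> pi / 2 \<and>
     (\<forall>t\<ge>0. \<forall>x\<in>carr X. snorm X (G (complex_of_real t) x - T t x) = 0) \<and>
     (\<forall>z\<in>insert 0 (sector \<delta>). bounded_op X (G z)) \<and>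
     (\<forall>z\<in>insert 0 (sector \<delta>). \<forall>w\<in>insert 0 (sector \<delta>). \<forall>x\<in>carr X.
        snorm X (G (z + w) x - G z (G w x)) = 0) \<and>
     (\<forall>x\<in>carr X. holomorphic_into X (\<lambda>z. G z x) (sector \<delta>)) \<and>
     (\<forall>x\<in>carr X. ((\<lambda>z. snorm X (G z x - x)) \<longlongrightarrow> 0) (at 0 within sector \<delta>))"

definition analytic_semigroup :: "'v::ab_group_add cspace \<Rightarrow> (real \<Rightarrow> 'v \<Rightarrow> 'v) \<Rightarrow> bool" where
  "analytic_semigroup X T \<longleftrightarrow> c0_semigroup_on X T \<and> (\<exists>\<delta> G. analytic_extension X T \<delta> G)"

definition bounded_analytic_semigroup :: "'v::ab_group_add cspace \<Rightarrow> (real \<Rightarrow> 'v \<Rightarrow> 'v) \<Rightarrow> bool" where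
  "bounded_analytic_semigroup X T \<longleftrightarrow> c0_semigroup_on X T \<and>
     (\<exists>\<delta> G. analytic_extension X T \<delta> G \<and> (\<exists>C. \<forall>z\<in>sector \<delta>. bounded_op_by X C (G z)))"

definition analytic_contraction_semigroup :: "'v::ab_group_add cspace \<Rightarrow> (real \<Rightarrow> 'v \<Rightarrow> 'v) \<Rightarrow> bool" where
  "analytic_contraction_semigroup X T \<longleftrightarrow> c0_semigroup_on X T \<and>
     (\<exists>\<delta> G. analytic_extension X T \<delta> G \<and> (\<forall>z\<in>sector \<delta>. bounded_op_by X 1 (G z)))"

text \<open>Complexification of a real Hilbert space: \<open>(x, y)\<close> stands for \<open>x + \<i> y\<close>. The norm of the
  product type, \<open>sqrt ((norm x)\<^sup>2 + (norm y)\<^sup>2)\<close>, is the Hilbert norm of the complexification.\<close>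

definition complexify :: "('h::{real_inner,banach} \<times> 'h) cspace" where
  "complexify = \<lparr> carr = UNIV,
     scale = (\<lambda>c (x, y). (Re c *\<^sub>R x - Im c *\<^sub>R y, Re c *\<^sub>R y + Im c *\<^sub>R x)),
     snorm = norm \<rparr>"

definition complexify_semigroup ::
    "(real \<Rightarrow> 'h::{real_inner,banach} \<Rightarrow>\<^sub>L 'h) \<Rightarrow> real \<Rightarrow> 'h \<times> 'h \<Rightarrow> 'h \<times> 'h" where
  "complexify_semigroup T t = map_prod (T t) (T t)"

definition Lp :: "real \<Rightarrow> 'a measure \<Rightarrow> ('a \<Rightarrow> complex) cspace" where
  "Lp p M = \<lparr> carr = {f \<in> borel_measurable M. integrable M (\<lambda>x. cmod (f x) powr p)},
     scale = (\<lambda>c f x. c * f x),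
     snorm = (\<lambda>f. (LINT x|M. cmod (f x) powr p) powr (1 / p)) \<rparr>"

text \<open>The adjoint \<open>i\<^sup>*\<close> of an operator from a Hilbert space, with \<open>H\<^sup>* = H\<close> by Riesz.\<close>

definition hadj :: "('h::{real_inner,banach} \<Rightarrow>\<^sub>L 'e::banach) \<Rightarrow> ('e \<Rightarrow>\<^sub>L real) \<Rightarrow> 'h" where
  "hadj i xs = (THE u. \<forall>h. blinfun_apply xs (i h) = h \<bullet> u)"

text \<open>Functions representing the elements of \<open>L\<^sup>2(J;H)\<close>. As \<open>H\<close> is not assumed separable, strong
  measurability is Borel measurability together with an essentially separable range.\<close>

definition L2 :: "real set \<Rightarrow> (real \<Rightarrow> 'h::{real_inner,banach}) set" where
  "L2 J = {g \<in> borel_measurable (lebesgue_on J).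
     (\<exists>D. countable D \<and> (AE t in lebesgue_on J. g t \<in> closure D)) \<and>
     integrable (lebesgue_on J) (\<lambda>t. (norm (g t))\<^sup>2)}"

text \<open>\<open>J = {0..t}\<close> gives \<open>I\<^sub>t\<close> and \<open>J = {0..}\<close> gives \<open>I\<^sub>\<infinity>\<close>. The Bochner integral of HOL-Analysis is
  restricted to second countable spaces, so the integral is the one of Henstock and Kurzweil; on bounded
  intervals it extends the Bochner integral, and on \<open>{0..}\<close> it includes improper integrals.\<close>

definition conv_op ::
    "(real \<Rightarrow> 'e::banach \<Rightarrow>\<^sub>L 'e) \<Rightarrow> ('h::{real_inner,banach} \<Rightarrow>\<^sub>L 'e) \<Rightarrow> real set \<Rightarrow> (real \<Rightarrow> 'h) \<Rightarrow> 'e" where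
  "conv_op S i J g = integral J (\<lambda>t. S t (i (g t)))"

definition conv_op_bounded ::
    "(real \<Rightarrow> 'e::banach \<Rightarrow>\<^sub>L 'e) \<Rightarrow> ('h::{real_inner,banach} \<Rightarrow>\<^sub>L 'e) \<Rightarrow> real set \<Rightarrow> bool" where
  "conv_op_bounded S i J \<longleftrightarrow>
     (\<forall>g\<in>L2 J. (\<lambda>t. S t (i (g t))) integrable_on J) \<and>
     (\<exists>C. \<forall>g\<in>L2 J. norm (conv_op S i J g) \<le> C * sqrt (LINT t|lebesgue_on J. (norm (g t))\<^sup>2))"

text \<open>\<open>Q = I I\<^sup>*\<close> for \<open>I = conv_op S i J\<close>; the function \<open>u\<close> below is \<open>I\<^sup>* xs\<close>.\<close>

definition conv_cov ::
    "(real \<Rightarrow> 'e::banach \<Rightarrow>\<^sub>L 'e) \<Rightarrow> ('h::{real_inner,banach} \<Rightarrow>\<^sub>L 'e) \<Rightarrow> real set \<Rightarrow>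
     (('e \<Rightarrow>\<^sub>L real) \<Rightarrow> 'e) \<Rightarrow> bool" where
  "conv_cov S i J Q \<longleftrightarrow>
     (\<forall>xs. \<exists>u\<in>L2 J.
        (\<forall>g\<in>L2 J. blinfun_apply xs (conv_op S i J g) = (LINT t|lebesgue_on J. g t \<bullet> u t)) \<and>
        Q xs = conv_op S i J u)"

definition radon_prob :: "'e::banach measure \<Rightarrow> bool" where
  "radon_prob M \<longleftrightarrow> prob_space M \<and> sets M = sets borel \<and>
     (\<forall>B\<in>sets borel. emeasure M B = (SUP K\<in>{K. compact K \<and> K \<subseteq> B}. emeasure M K))"

definition centred_gaussian_radon :: "'e::banach measure \<Rightarrow> bool" where
  "centred_gaussian_radon M \<longleftrightarrow> radon_prob M \<and>
     (\<forall>xs :: 'e \<Rightarrow>\<^sub>L real.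
        distr M borel xs = return borel 0 \<or>
        (\<exists>\<sigma>>0. distr M borel xs = density lborel (normal_density 0 \<sigma>)))"

definition covariance_op :: "'e::banach measure \<Rightarrow> (('e \<Rightarrow>\<^sub>L real) \<Rightarrow> 'e) \<Rightarrow> bool" where
  "covariance_op M Q \<longleftrightarrow>
     (\<forall>xs ys. blinfun_apply ys (Q xs) = (LINT x|M. blinfun_apply xs x * blinfun_apply ys x))"

text \<open>\<open>I\<close> is a well-defined \<open>\<gamma>\<close>-radonifying operator, that is, \<open>Q = I I\<^sup>*\<close> is the covariance
  operator of the centred Gaussian Radon measure \<open>M\<close>.\<close>

definition ou_law ::
    "(real \<Rightarrow> 'e::banach \<Rightarrow>\<^sub>L 'e) \<Rightarrow> ('h::{real_inner,banach} \<Rightarrow>\<^sub>L 'e) \<Rightarrow> real set \<Rightarrow>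
     (('e \<Rightarrow>\<^sub>L real) \<Rightarrow> 'e) \<Rightarrow> 'e measure \<Rightarrow> bool" where
  "ou_law S i J Q M \<longleftrightarrow>
     conv_op_bounded S i J \<and> conv_cov S i J Q \<and> centred_gaussian_radon M \<and> covariance_op M Q"

text \<open>The reproducing kernel Hilbert space of \<open>Q\<close> with its inclusion \<open>j\<close>. Injectivity and
  \<open>Q = j j\<^sup>*\<close> determine the pair up to an isometric isomorphism.\<close>

definition rkhs_inclusion ::
    "(('e::banach \<Rightarrow>\<^sub>L real) \<Rightarrow> 'e) \<Rightarrow> ('k::{real_inner,banach} \<Rightarrow>\<^sub>L 'e) \<Rightarrow> bool" where
  "rkhs_inclusion Q j \<longleftrightarrow> inj (blinfun_apply j) \<and> (\<forall>xs. Q xs = j (hadj j xs))"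

definition ou_measure ::
    "(real \<Rightarrow> 'e::banach \<Rightarrow>\<^sub>L 'e) \<Rightarrow> ('h::{real_inner,banach} \<Rightarrow>\<^sub>L 'e) \<Rightarrow> real \<Rightarrow> 'e measure" where
  "ou_measure S i t = (THE M. \<exists>Q. ou_law S i {0..t} Q M)"

definition ou_op ::
    "(real \<Rightarrow> 'e::banach \<Rightarrow>\<^sub>L 'e) \<Rightarrow> ('h::{real_inner,banach} \<Rightarrow>\<^sub>L 'e) \<Rightarrow> real \<Rightarrow>
     ('e \<Rightarrow> real) \<Rightarrow> 'e \<Rightarrow> real" where
  "ou_op S i t f x = (LINT y|ou_measure S i t. f (S t x + y))"

text \<open>\<open>P\<close> is the complexification of the extension of the Ornstein--Uhlenbeck semigroup to
  \<open>L\<^sup>p\<close>. It is unique up to equality almost everywhere, because bounded continuous functions are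
  dense and \<open>P t\<close> is bounded and complex linear.\<close>

definition ou_extension ::
    "(real \<Rightarrow> 'e::banach \<Rightarrow>\<^sub>L 'e) \<Rightarrow> ('h::{real_inner,banach} \<Rightarrow>\<^sub>L 'e) \<Rightarrow> 'e measure \<Rightarrow> real \<Rightarrow>
     (real \<Rightarrow> ('e \<Rightarrow> complex) \<Rightarrow> 'e \<Rightarrow> complex) \<Rightarrow> bool" where
  "ou_extension S i M p P \<longleftrightarrow>
     (\<forall>t\<ge>0. bounded_op (Lp p M) (P t) \<and>
        (\<forall>f. continuous_on UNIV f \<and> bounded (range f) \<longrightarrow>
           (AE x in M. P t (\<lambda>x. complex_of_real (f x)) x = complex_of_real (ou_op S i t f x))))"

text \<open>The four conditions on the Ornstein--Uhlenbeck semigroup are known to be equivalent, also for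
  different \<open>p\<close>. \<open>Sinf\<close> and, up to equality almost everywhere, \<open>P\<close> are unique, so the existential
  quantifiers only name them. \<open>(xs, ys) \<in> dual_graph A\<close> says that \<open>xs\<close> is in the domain of \<open>A\<^sup>*\<close> and
  \<open>ys = A\<^sup>* xs\<close>.\<close>

definition ou_analytic ::
    "(real \<Rightarrow> 'e::banach \<Rightarrow>\<^sub>L 'e) \<Rightarrow> ('e \<times> 'e) set \<Rightarrow> ('h::{real_inner,banach} \<Rightarrow>\<^sub>L 'e) \<Rightarrow>
     (('e \<Rightarrow>\<^sub>L real) \<Rightarrow> 'e) \<Rightarrow> 'e measure \<Rightarrow> ('k::{real_inner,banach} \<Rightarrow>\<^sub>L 'e) \<Rightarrow> bool" where
  "ou_analytic S A i Q M j \<longleftrightarrow>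
     (\<exists>p>1.
        (\<exists>P. ou_extension S i M p P \<and> analytic_semigroup (Lp p M) P) \<and>
        (\<exists>P. ou_extension S i M p P \<and> analytic_contraction_semigroup (Lp p M) P) \<and>
        (\<exists>Sinf. (\<forall>t\<ge>0. S t o\<^sub>L j = j o\<^sub>L Sinf t) \<and>
           analytic_contraction_semigroup complexify (complexify_semigroup Sinf)) \<and>
        (\<exists>B :: 'h \<Rightarrow>\<^sub>L 'h. \<forall>(xs, ys)\<in>dual_graph A. i (B (hadj i xs)) = Q ys))"

end

theory Submission
  imports Defs "HOL-Complex_Analysis.Complex_Analysis"
begin

text \<open>
Write \<open>K\<close> for the reproducing kernel space \<open>H\<^sub>\<infinity>\<close>, \<open>j\<close> for its inclusion into \<open>E\<close>, \<open>A\<close> for the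
generator of \<open>S\<close>, and let \<open>V\<close> be the operator from \<open>K\<close> to \<open>H\<close> with \<open>V (j\<^sup>* x\<^sup>*) = i\<^sup>* x\<^sup>*\<close> for \<open>x\<^sup>*\<close> in
the domain of \<open>A\<^sup>*\<close>. Its domain is dense in \<open>K\<close>, its range is dense in \<open>H\<close>, and \<open>V\<^sup>*\<close> is the
inclusion of \<open>H \<inter> K\<close> into \<open>K\<close>. The relation \<open>i B i\<^sup>* x\<^sup>* = Q\<^sub>\<infinity> A\<^sup>* x\<^sup>*\<close> says that the adjoint semigroup
\<open>T = S\<^sub>\<infinity>\<^sup>*\<close> on \<open>K\<close> is generated by \<open>V\<^sup>* B V\<close>, in the weak sense

  \<open>d/dt \<langle>T(t) k, k'\<rangle> = \<langle>B V T(t) k, V k'\<rangle>\<close>,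

and since \<open>t \<mapsto> |i\<^sup>* S(t)\<^sup>* x\<^sup>*|\<^sup>2\<close> integrates to \<open>|j\<^sup>* x\<^sup>*|\<^sup>2\<close>, comparison of two derivatives at \<open>t = 0\<close> gives
the Lyapunov identity \<open>\<langle>B h, h\<rangle> = - |h|\<^sup>2 / 2\<close>. The adjoint of the semigroup wanted on \<open>H\<close> must send
\<open>V k\<close> to \<open>V T(t) k\<close>. Everything therefore rests on the estimate

  \<open>|V T(z) k| \<le> C |V k|\<close>  for \<open>z\<close> in some sector,

that is, on boundedness of \<open>T\<close> in the form norm instead of the norm of \<open>K\<close>. This does not follow
by interpolation, since \<open>B\<close> need not be symmetric, but it does follow from resolvent estimates: if
\<open>x\<close> solves \<open>(\<mu> - V\<^sup>* B V) x = k\<close> and \<open>y = V\<^sup>* B V x = \<mu> x - k\<close>, then pairing \<open>y\<close> with \<open>\<mu> x = y + k\<close> gives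

  \<open>cnj \<mu> \<langle>B V x, V x\<rangle> = |y|\<^sup>2 + \<langle>B V x, V k\<rangle>\<close>,

and as the numerical range of \<open>- B\<close> lies in a sector strictly inside the right half-plane, this forces
\<open>|\<mu>| |V x| \<le> M |V k|\<close> for \<open>Re \<mu> > 0\<close> (\<open>resolvent_bound\<close>). Two applications bound the Laplace transform
of \<open>t \<mapsto> t V T(t) k\<close> by \<open>M\<^sup>2 |V k| / |\<mu>|\<^sup>2\<close>, which is integrable on the line \<open>Re \<mu> = 1 / \<tau>\<close> with integral
proportional to \<open>\<tau>\<close>; Fourier inversion at the point \<open>\<tau>\<close> then bounds \<open>\<tau> |V T(\<tau>) k|\<close> by a multiple of
\<open>\<tau> |V k|\<close> (\<open>laplace_controls_value\<close>, \<open>VT_bounded_by_V\<close>). The numerical range condition survives a small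
rotation, so the same argument works on rays near the positive axis.

The locale \<open>form_semigroup\<close> isolates this argument. It takes a contractive holomorphic semigroup \<open>T\<close>
on a complex Hilbert space, together with \<open>V\<close> and \<open>B\<close>, and produces a bounded holomorphic semigroup
\<open>Hsg\<close> with \<open>\<langle>Hsg(z) h, V k\<rangle> = \<langle>h, V T(cnj z) k\<rangle>\<close>. Tested against the functionals in the domain of \<open>A\<^sup>*\<close>,
which separate the points of \<open>E\<close>, this identity says that \<open>i\<close> intertwines \<open>Hsg(t)\<close> and \<open>S(t)\<close>.

The Laplace transform of a function with values in a possibly non-separable Hilbert space is obtained
from Riesz representation, as the vector whose inner products are the scalar Laplace transforms.
\<close>

section \<open>Riesz representation, adjoints and extension by density\<close>

text \<open>The functional \<open>x \<mapsto> |V x|\<^sup>2 / 2 - f x\<close> is bounded below; along a minimizing sequence \<open>V x\<^sub>n\<close> is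
Cauchy by the parallelogram law, and the vanishing of the first variation identifies the limit as
the representing vector. With \<open>V\<close> the identity of the whole space this is Riesz' theorem; with the
identity of a subspace it is the projection theorem; and with a general \<open>V\<close> it represents
functionals that are only bounded in the seminorm \<open>|V x|\<close>.\<close>

lemma riesz_via_minimization:
  fixes V :: "'d::real_vector \<Rightarrow> 'h::{real_inner,banach}" and f :: "'d \<Rightarrow> real"
  assumes D: "subspace D"
    and V_add: "\<And>x y. x \<in> D \<Longrightarrow> y \<in> D \<Longrightarrow> V (x + y) = V x + V y"
    and V_scale: "\<And>c x. x \<in> D \<Longrightarrow> V (c *\<^sub>R x) = c *\<^sub>R V x"
    and f_add: "\<And>x y. x \<in> D \<Longrightarrow> y \<in> D \<Longrightarrow> f (x + y) = f x + f y"
    and f_scale: "\<And>c x. x \<in> D \<Longrightarrow> f (c *\<^sub>R x) = c * f x"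
    and bound: "\<And>x. x \<in> D \<Longrightarrow> f x \<le> C * norm (V x)"
  shows "\<exists>u\<in>closure (V ` D). \<forall>x\<in>D. f x = u \<bullet> V x"
proof -
  define \<phi> where "\<phi> x = (norm (V x))\<^sup>2 / 2 - f x" for x
  have lower: "\<phi> x \<ge> - C\<^sup>2 / 2" if "x \<in> D" for x
  proof -
    have "0 \<le> (norm (V x) - C)\<^sup>2" by simp
    then show ?thesis
      using bound[OF that] by (simp add: \<phi>_def power2_eq_square algebra_simps)
  qed
  define m where "m = Inf (\<phi> ` D)"
  have bdd: "bdd_below (\<phi> ` D)" using lower by (auto intro!: bdd_belowI2)
  have ne: "\<phi> ` D \<noteq> {}" using subspace_0[OF D] by auto
  have m_le: "m \<le> \<phi> x" if "x \<in> D" for x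
    unfolding m_def using bdd that by (auto intro: cInf_lower)
  have "\<exists>x\<in>D. \<phi> x < m + 1 / real (Suc n)" for n
  proof -
    have "Inf (\<phi> ` D) < m + 1 / real (Suc n)" by (simp add: m_def)
    from cInf_lessD[OF ne this] show ?thesis by auto
  qed
  then obtain x where xD: "\<And>n. x n \<in> D" and x: "\<And>n. \<phi> (x n) < m + 1 / real (Suc n)"
    by metis
  have para: "(norm (V a - V b))\<^sup>2 \<le> 4 * (\<phi> a - m) + 4 * (\<phi> b - m)" if a: "a \<in> D" and b: "b \<in> D" for a b
  proof -
    have ab: "a + b \<in> D" using D a b by (simp add: subspace_add)
    then have mid: "(1/2) *\<^sub>R (a + b) \<in> D" using D by (simp add: subspace_scale)
    have "m \<le> \<phi> ((1/2) *\<^sub>R (a + b))" by (rule m_le[OF mid])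
    also have "\<dots> = (norm ((1/2) *\<^sub>R (V a + V b)))\<^sup>2 / 2 - (f a + f b) / 2"
      using a b ab by (simp add: \<phi>_def V_add V_scale f_add f_scale)
    also have "(norm ((1/2) *\<^sub>R (V a + V b)))\<^sup>2 = ((norm (V a))\<^sup>2 + (norm (V b))\<^sup>2) / 2 - (norm (V a - V b))\<^sup>2 / 4"
      by (simp add: power_divide power2_norm_eq_inner inner_add inner_diff inner_commute field_simps)
    finally show ?thesis by (simp add: \<phi>_def field_simps)
  qed
  have "Cauchy (\<lambda>n. V (x n))"
  proof (rule CauchyI)
    fix e :: real assume e: "e > 0"
    obtain N where N: "8 / e\<^sup>2 < real (Suc N)"
      using reals_Archimedean2 less_trans of_nat_less_iff lessI by metis
    show "\<exists>M. \<forall>m\<ge>M. \<forall>n\<ge>M. norm (V (x m) - V (x n)) < e"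
    proof (intro exI allI impI)
      fix p q assume pq: "N \<le> p" "N \<le> q"
      have "1 / real (Suc p) \<le> 1 / real (Suc N)" "1 / real (Suc q) \<le> 1 / real (Suc N)"
        using pq by (auto intro!: divide_left_mono)
      then have "(norm (V (x p) - V (x q)))\<^sup>2 < 8 / real (Suc N)"
        using para[OF xD xD, of p q] x[of p] x[of q] by simp
      also have "\<dots> < e\<^sup>2" using N e by (simp add: field_simps)
      finally show "norm (V (x p) - V (x q)) < e" using e by (simp add: power_less_imp_less_base)
    qed
  qed
  then obtain u where u: "(\<lambda>n. V (x n)) \<longlonglongrightarrow> u"
    using Cauchy_convergent convergent_def by blast
  have ucl: "u \<in> closure (V ` D)"
    unfolding closure_sequential using u xD by (intro exI[where x = "\<lambda>n. V (x n)"]) auto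
  have lim0: "(\<lambda>n. m + 1 / real (Suc n)) \<longlonglongrightarrow> m"
    using tendsto_add[OF tendsto_const[of m] LIMSEQ_inverse_real_of_nat] by (simp add: inverse_eq_divide)
  have "f y = u \<bullet> V y" if y: "y \<in> D" for y
  proof -
    have key: "0 \<le> t * (u \<bullet> V y - f y) + t\<^sup>2 / 2 * (norm (V y))\<^sup>2" for t
    proof -
      have "m + 1 / real (Suc n) + t * (V (x n) \<bullet> V y - f y) + t\<^sup>2 / 2 * (norm (V y))\<^sup>2 \<ge> m" for n
      proof -
        have ty: "t *\<^sub>R y \<in> D" using D y by (simp add: subspace_scale)
        have "m \<le> \<phi> (x n + t *\<^sub>R y)" using D xD ty by (intro m_le) (simp add: subspace_add)
        also have "\<dots> = \<phi> (x n) + t * (V (x n) \<bullet> V y - f y) + t\<^sup>2 / 2 * (norm (V y))\<^sup>2"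
          using xD y ty
          by (simp add: \<phi>_def V_add V_scale f_add f_scale power2_norm_eq_inner inner_add inner_commute
              power2_eq_square[of t] field_simps)
        finally show ?thesis using x[of n] by linarith
      qed
      moreover have "(\<lambda>n. m + 1 / real (Suc n) + t * (V (x n) \<bullet> V y - f y) + t\<^sup>2 / 2 * (norm (V y))\<^sup>2)
          \<longlonglongrightarrow> m + t * (u \<bullet> V y - f y) + t\<^sup>2 / 2 * (norm (V y))\<^sup>2"
        by (intro tendsto_intros u lim0)
      ultimately have "m \<le> m + t * (u \<bullet> V y - f y) + t\<^sup>2 / 2 * (norm (V y))\<^sup>2"
        by (intro LIMSEQ_le_const[where X = "\<lambda>n. m + 1 / real (Suc n) + t * (V (x n) \<bullet> V y - f y) + t\<^sup>2 / 2 * (norm (V y))\<^sup>2"]) auto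
      then show ?thesis by simp
    qed
    show ?thesis
    proof (rule ccontr)
      assume ne: "f y \<noteq> u \<bullet> V y"
      define d where "d = u \<bullet> V y - f y"
      define s where "s = (norm (V y))\<^sup>2 + 1"
      have s: "s > 0" by (simp add: s_def add_nonneg_pos)
      have d: "d \<noteq> 0" using ne by (simp add: d_def)
      \<comment> \<open>Inserting the step \<open>t = - d / s\<close> makes the quadratic expression in \<open>key\<close> negative.\<close>
      have "0 \<le> (- d / s) * d + (- d / s)\<^sup>2 / 2 * (norm (V y))\<^sup>2"
        using key[of "- d / s"] by (simp add: d_def)
      also have "\<dots> \<le> (- d / s) * d + (- d / s)\<^sup>2 / 2 * s"
        by (intro add_left_mono mult_left_mono) (auto simp: s_def)
      also have "\<dots> = - (d\<^sup>2 / s) / 2"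
        using s by (simp add: field_simps power2_eq_square)
      also have "\<dots> < 0" using s d by simp
      finally show False by simp
    qed
  qed
  with ucl show ?thesis by blast
qed

lemma inner_eq_on_dense:
  fixes x y :: "'h::real_inner"
  assumes "closure D = UNIV" "\<And>d. d \<in> D \<Longrightarrow> x \<bullet> d = y \<bullet> d"
  shows "x = y"
proof -
  have "closed {d. x \<bullet> d = y \<bullet> d}" by (intro closed_Collect_eq continuous_intros)
  moreover have "D \<subseteq> {d. x \<bullet> d = y \<bullet> d}" using assms(2) by auto
  ultimately have "closure D \<subseteq> {d. x \<bullet> d = y \<bullet> d}" by (rule closure_minimal[rotated])
  then have "x \<bullet> (x - y) = y \<bullet> (x - y)" using assms(1) by auto
  then have "(x - y) \<bullet> (x - y) = 0" by (simp add: inner_diff_left)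
  then show ?thesis by simp
qed

lemma riesz_representation:
  fixes f :: "'h::{real_inner,banach} \<Rightarrow> real"
  assumes "bounded_linear f"
  obtains u where "\<And>x. f x = u \<bullet> x"
proof -
  interpret bounded_linear f by fact
  obtain C where "\<And>x. norm (f x) \<le> norm x * C" using bounded by blast
  then have "\<And>x. f x \<le> C * norm (id x)" by (simp add: mult.commute) (meson abs_le_D1)
  then have "\<exists>u\<in>closure (id ` UNIV). \<forall>x\<in>UNIV. f x = u \<bullet> id x"
    by (intro riesz_via_minimization) (auto simp: add scale)
  then show thesis using that by auto
qed

text \<open>Representing \<open>x \<bullet> _\<close> on \<open>D\<close> by an element \<open>u\<close> of the closure makes \<open>x - u\<close> orthogonal to \<open>D\<close>.\<close>

lemma dense_if_orthogonal_trivial: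
  fixes D :: "'h::{real_inner,banach} set"
  assumes D: "subspace D" and triv: "\<And>h. (\<And>d. d \<in> D \<Longrightarrow> h \<bullet> d = 0) \<Longrightarrow> h = 0"
  shows "closure D = UNIV"
proof -
  have "x \<in> closure D" for x
  proof -
    have "\<exists>u\<in>closure (id ` D). \<forall>d\<in>D. x \<bullet> d = u \<bullet> id d"
      by (rule riesz_via_minimization[OF D, where C = "norm x"])
        (auto simp: inner_add norm_cauchy_schwarz)
    then obtain u where u: "u \<in> closure D" "\<And>d. d \<in> D \<Longrightarrow> x \<bullet> d = u \<bullet> d" by auto
    have "x - u = 0" by (rule triv) (simp add: u inner_diff_left)
    with u show ?thesis by simp
  qed
  then show ?thesis by auto
qed

lemma adjoint_hilbert:
  fixes f :: "'a::{real_inner,banach} \<Rightarrow> 'b::real_inner"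
  assumes "bounded_linear f"
  shows "f x \<bullet> y = x \<bullet> adjoint f y"
proof -
  have "\<exists>u. \<forall>x. f x \<bullet> y = x \<bullet> u" for y
  proof -
    have "bounded_linear (\<lambda>x. f x \<bullet> y)"
      by (rule bounded_linear_compose[OF bounded_linear_inner_left assms])
    then obtain u where "\<And>x. f x \<bullet> y = u \<bullet> x" using riesz_representation by blast
    then show ?thesis by (auto simp: inner_commute)
  qed
  then have "\<exists>g. \<forall>x y. f x \<bullet> y = x \<bullet> g y" by metis
  then show ?thesis unfolding adjoint_def by (rule someI2_ex) auto
qed

lemma norm_le_if_inner_le:
  fixes u :: "'a::real_inner"
  assumes "u \<bullet> u \<le> C * norm u" "C \<ge> 0"
  shows "norm u \<le> C"
  using assms by (cases "u = 0") (auto simp: power2_norm_eq_inner[symmetric] power2_eq_square)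

lemma norm_adjoint_le:
  fixes f :: "'a::{real_inner,banach} \<Rightarrow> 'b::real_inner"
  assumes "bounded_linear f" "\<And>x. norm (f x) \<le> C * norm x" "C \<ge> 0"
  shows "norm (adjoint f y) \<le> C * norm y"
proof (rule norm_le_if_inner_le)
  have "adjoint f y \<bullet> adjoint f y = f (adjoint f y) \<bullet> y" by (simp add: adjoint_hilbert assms(1))
  also have "\<dots> \<le> norm (f (adjoint f y)) * norm y" by (rule norm_cauchy_schwarz)
  also have "\<dots> \<le> (C * norm (adjoint f y)) * norm y" by (intro mult_right_mono assms) auto
  finally show "adjoint f y \<bullet> adjoint f y \<le> C * norm y * norm (adjoint f y)" by (simp add: ac_simps)
qed (use assms in auto)

lemma bounded_linear_adjoint:
  fixes f :: "'a::{real_inner,banach} \<Rightarrow> 'b::real_inner"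
  assumes "bounded_linear f"
  shows "bounded_linear (adjoint f)"
proof -
  obtain C where C: "\<And>x. norm (f x) \<le> norm x * C" "C > 0" using bounded_linear.pos_bounded[OF assms] by blast
  show ?thesis
  proof (rule bounded_linear_intro)
    show "adjoint f (x + y) = adjoint f x + adjoint f y" for x y
      by (rule inner_eq_on_dense[where D = UNIV])
        (simp_all add: inner_commute[of _ d for d] inner_add adjoint_hilbert[OF assms, symmetric])
    show "adjoint f (c *\<^sub>R x) = c *\<^sub>R adjoint f x" for c x
      by (rule inner_eq_on_dense[where D = UNIV])
        (simp_all add: inner_commute[of _ d for d] adjoint_hilbert[OF assms, symmetric])
    show "norm (adjoint f x) \<le> norm x * C" for x
      using norm_adjoint_le[OF assms, of C] C by (simp add: mult.commute)
  qed
qed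

text \<open>The adjoint of \<open>V\<close> is defined everywhere by Riesz representation; the adjoint of that adjoint is the
extension.\<close>

lemma extend_bounded_linear:
  fixes V :: "'k::{real_inner,banach} \<Rightarrow> 'h::{real_inner,banach}"
  assumes D: "subspace D" "closure D = UNIV"
    and V_add: "\<And>x y. x \<in> D \<Longrightarrow> y \<in> D \<Longrightarrow> V (x + y) = V x + V y"
    and V_scale: "\<And>c x. x \<in> D \<Longrightarrow> V (c *\<^sub>R x) = c *\<^sub>R V x"
    and bound: "\<And>x. x \<in> D \<Longrightarrow> norm (V x) \<le> C * norm x"
  obtains N where "bounded_linear N" "\<And>x. x \<in> D \<Longrightarrow> N x = V x"
proof -
  have "\<exists>u. \<forall>x\<in>D. h \<bullet> V x = u \<bullet> x" for h
  proof -
    have "\<exists>u\<in>closure (id ` D). \<forall>d\<in>D. h \<bullet> V d = u \<bullet> id d"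
    proof (rule riesz_via_minimization[OF D(1), where C = "norm h * C"])
      show "h \<bullet> V x \<le> norm h * C * norm (id x)" if "x \<in> D" for x
      proof -
        have "h \<bullet> V x \<le> norm h * norm (V x)" by (rule norm_cauchy_schwarz)
        also have "\<dots> \<le> norm h * (C * norm x)" by (intro mult_left_mono bound that) auto
        finally show ?thesis by simp
      qed
    qed (auto simp: inner_add V_add V_scale)
    then show ?thesis by auto
  qed
  then obtain M where M: "\<And>h x. x \<in> D \<Longrightarrow> h \<bullet> V x = M h \<bullet> x" by metis
  have bM: "bounded_linear M"
  proof (rule bounded_linear_intro)
    show "M (x + y) = M x + M y" for x y
      by (rule inner_eq_on_dense[OF D(2)]) (simp add: inner_add M[symmetric])
    show "M (c *\<^sub>R x) = c *\<^sub>R M x" for c x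
      by (rule inner_eq_on_dense[OF D(2)]) (simp add: M[symmetric])
    show "norm (M h) \<le> norm h * \<bar>C\<bar>" for h
    proof (rule norm_le_if_inner_le)
      have "closed {x. M h \<bullet> x \<le> norm h * \<bar>C\<bar> * norm x}" by (intro closed_Collect_le continuous_intros)
      moreover have "D \<subseteq> {x. M h \<bullet> x \<le> norm h * \<bar>C\<bar> * norm x}"
      proof safe
        fix x assume x: "x \<in> D"
        have "M h \<bullet> x = h \<bullet> V x" using M x by simp
        also have "\<dots> \<le> norm h * norm (V x)" by (rule norm_cauchy_schwarz)
        also have "norm (V x) \<le> \<bar>C\<bar> * norm x"
          using bound[OF x] by (rule order_trans) (auto intro: mult_right_mono)
        finally show "M h \<bullet> x \<le> norm h * \<bar>C\<bar> * norm x" by (simp add: mult_left_mono mult.assoc)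
      qed
      ultimately have "closure D \<subseteq> {x. M h \<bullet> x \<le> norm h * \<bar>C\<bar> * norm x}" by (rule closure_minimal[rotated])
      then show "M h \<bullet> M h \<le> norm h * \<bar>C\<bar> * norm (M h)" using D(2) by auto
    qed simp
  qed
  show thesis
  proof (rule that)
    show "bounded_linear (adjoint M)" by (rule bounded_linear_adjoint[OF bM])
    show "adjoint M x = V x" if "x \<in> D" for x
    proof (rule inner_eq_on_dense[where D = UNIV])
      fix h show "adjoint M x \<bullet> h = V x \<bullet> h"
        using adjoint_hilbert[OF bM, of h x] M[OF that, of h] by (simp add: inner_commute)
    qed simp
  qed
qed

section \<open>Separation of points and uniform boundedness\<close>

text \<open>The Hahn--Banach theorem for the norm. Linear functionals dominated by the norm are represented by
their graphs, which are subspaces of the product space; domination already makes such a subspace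
single-valued, because \<open>(0, a)\<close> and \<open>(0, - a)\<close> belong to it together.\<close>

lemma functionals_separate_points:
  fixes x0 :: "'e::real_normed_vector"
  assumes "x0 \<noteq> 0"
  shows "\<exists>f :: 'e \<Rightarrow>\<^sub>L real. f x0 \<noteq> 0"
proof -
  define \<A> where "\<A> = {G :: ('e \<times> real) set. subspace G \<and> (x0, norm x0) \<in> G \<and> (\<forall>p\<in>G. snd p \<le> norm (fst p))}"
  have start: "span {(x0, norm x0)} \<in> \<A>"
  proof -
    have "snd p \<le> norm (fst p)" if "p \<in> span {(x0, norm x0)}" for p
      using that by (auto simp: span_singleton intro!: mult_right_mono)
    then show ?thesis by (simp add: \<A>_def span_base)
  qed
  have chain: "\<Union>\<C> \<in> \<A>" if ne: "\<C> \<noteq> {}" and ch: "subset.chain \<A> \<C>" for \<C>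
  proof -
    have sub: "\<And>G. G \<in> \<C> \<Longrightarrow> G \<in> \<A>" and tot: "\<And>G H. G \<in> \<C> \<Longrightarrow> H \<in> \<C> \<Longrightarrow> G \<subseteq> H \<or> H \<subseteq> G"
      using ch by (auto simp: subset.chain_def)
    have "subspace (\<Union>\<C>)"
    proof (rule subspaceI)
      obtain G where "G \<in> \<C>" using ne by auto
      then show "0 \<in> \<Union>\<C>" using sub[of G] subspace_0[of G] by (auto simp: \<A>_def)
    next
      fix p q assume "p \<in> \<Union>\<C>" "q \<in> \<Union>\<C>"
      then obtain G H where GH: "G \<in> \<C>" "H \<in> \<C>" "p \<in> G" "q \<in> H" by auto
      define L where "L = (if G \<subseteq> H then H else G)"
      have L: "L \<in> \<C>" "p \<in> L" "q \<in> L" using GH tot[of G H] by (auto simp: L_def)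
      then have "p + q \<in> L" using sub[of L] subspace_add[of L p q] by (simp add: \<A>_def)
      then show "p + q \<in> \<Union>\<C>" using L by auto
    next
      fix c :: real and p assume "p \<in> \<Union>\<C>"
      then obtain G where G: "G \<in> \<C>" "p \<in> G" by auto
      then have "c *\<^sub>R p \<in> G" using sub[of G] subspace_scale[of G p c] by (simp add: \<A>_def)
      then show "c *\<^sub>R p \<in> \<Union>\<C>" using G by auto
    qed
    moreover have "(x0, norm x0) \<in> \<Union>\<C>" using ne sub by (auto simp: \<A>_def)
    moreover have "\<forall>p\<in>\<Union>\<C>. snd p \<le> norm (fst p)" using sub unfolding \<A>_def by blast
    ultimately show ?thesis by (simp add: \<A>_def)
  qed
  have "\<A> \<noteq> {}" using start by auto
  from subset_Zorn_nonempty[OF this chain]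
  obtain M where M: "M \<in> \<A>" and max: "\<And>X. X \<in> \<A> \<Longrightarrow> M \<subseteq> X \<Longrightarrow> X = M" by blast
  have sM: "subspace M" and x0M: "(x0, norm x0) \<in> M" and dom: "\<And>v a. (v, a) \<in> M \<Longrightarrow> a \<le> norm v"
    using M by (auto simp: \<A>_def)
  have total: "\<exists>a. (v, a) \<in> M" for v
  proof -
    \<comment> \<open>A value at \<open>v\<close> is admissible if it lies between all \<open>b - norm (w - v)\<close> and all \<open>norm (u + v) - a\<close>;
      the least such number is taken.\<close>
    define \<alpha> where "\<alpha> = (SUP (w, b)\<in>M. b - norm (w - v))"
    have le: "b - norm (w - v) \<le> norm (u + v) - a" if "(w, b) \<in> M" "(u, a) \<in> M" for w b u a
    proof -
      have "(w + u, b + a) \<in> M" using subspace_add[OF sM that] by simp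
      then have "b + a \<le> norm (w + u)" by (rule dom)
      also have "\<dots> \<le> norm (w - v) + norm (u + v)" using norm_triangle_ineq[of "w - v" "u + v"] by simp
      finally show ?thesis by simp
    qed
    have \<alpha>_ge: "b - norm (w - v) \<le> \<alpha>" if "(w, b) \<in> M" for w b
      unfolding \<alpha>_def
      by (rule cSUP_upper2[OF _ that]) (use le x0M in \<open>auto intro!: bdd_aboveI2[where M = "norm (x0 + v) - norm x0"]\<close>)
    have \<alpha>_le: "\<alpha> \<le> norm (u + v) - a" if "(u, a) \<in> M" for u a
      unfolding \<alpha>_def by (rule cSUP_least) (use le that x0M in auto)
    define X where "X = {p + t *\<^sub>R (v, \<alpha>) |p t. p \<in> M}"
    have "X = {x + y |x y. x \<in> M \<and> y \<in> span {(v, \<alpha>)}}"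
      unfolding X_def span_singleton by blast
    then have sX: "subspace X" using subspace_sums[OF sM subspace_span] by simp
    have MX: "M \<subseteq> X"
    proof
      fix p assume "p \<in> M"
      then have "p = p + 0 *\<^sub>R (v, \<alpha>) \<and> p \<in> M" by (simp add: zero_prod_def[symmetric])
      then show "p \<in> X" unfolding X_def by blast
    qed
    have bd: "a + t * \<alpha> \<le> norm (u + t *\<^sub>R v)" if ua: "(u, a) \<in> M" for u a t
    proof -
      consider "t = 0" | "t > 0" | "t < 0" by linarith
      then show ?thesis
      proof cases
        case 1 then show ?thesis using dom[OF ua] by simp
      next
        case 2
        have d2: "t * (a / t) = a" using 2 by simp
        have "(u /\<^sub>R t, a / t) \<in> M" using subspace_scale[OF sM ua, of "1 / t"] by (simp add: divide_inverse mult.commute)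
        from \<alpha>_le[OF this] have "\<alpha> + a / t \<le> norm (u /\<^sub>R t + v)" by simp
        then have "t * (\<alpha> + a / t) \<le> t * norm (u /\<^sub>R t + v)" using 2 by (simp only: mult_le_cancel_left_pos)
        moreover have "t * norm (u /\<^sub>R t + v) = norm (t *\<^sub>R (u /\<^sub>R t + v))" using 2 by simp
        moreover have "t *\<^sub>R (u /\<^sub>R t + v) = u + t *\<^sub>R v" using 2 by (simp add: scaleR_add_right)
        ultimately show ?thesis using d2 by (simp only: distrib_left add.commute)
      next
        case 3
        define s where "s = - t"
        have s: "s > 0" using 3 by (simp add: s_def)
        have d2: "s * (a / s) = a" using s by simp
        have "(u /\<^sub>R s, a / s) \<in> M" using subspace_scale[OF sM ua, of "1 / s"] by (simp add: divide_inverse mult.commute)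
        from \<alpha>_ge[OF this] have "a / s - \<alpha> \<le> norm (u /\<^sub>R s - v)" by simp
        then have "s * (a / s - \<alpha>) \<le> s * norm (u /\<^sub>R s - v)" using s by (simp only: mult_le_cancel_left_pos)
        moreover have "s * norm (u /\<^sub>R s - v) = norm (s *\<^sub>R (u /\<^sub>R s - v))" using s by simp
        moreover have "s *\<^sub>R (u /\<^sub>R s - v) = u - s *\<^sub>R v" using s by (simp add: scaleR_diff_right)
        ultimately have "a - s * \<alpha> \<le> norm (u - s *\<^sub>R v)" using d2 by (simp only: right_diff_distrib)
        then show ?thesis by (simp add: s_def)
      qed
    qed
    from bd have "\<forall>p\<in>X. snd p \<le> norm (fst p)" by (auto simp: X_def)
    then have "X \<in> \<A>" using x0M sX MX by (auto simp: \<A>_def)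
    then have "X = M" using max MX by simp
    moreover have "(v, \<alpha>) \<in> X"
    proof -
      have "(v, \<alpha>) = 0 + 1 *\<^sub>R (v, \<alpha>) \<and> 0 \<in> M" using subspace_0[OF sM] by simp
      then show ?thesis unfolding X_def by blast
    qed
    ultimately show ?thesis by auto
  qed
  then obtain f where f: "\<And>v. (v, f v) \<in> M" by metis
  have uniq: "a = b" if "(v, a) \<in> M" "(v, b) \<in> M" for v a b
    using dom[OF subspace_diff[OF sM that, simplified]] dom[OF subspace_diff[OF sM that(2) that(1), simplified]] by simp
  have "bounded_linear f"
  proof (rule bounded_linear_intro)
    show "f (v + w) = f v + f w" for v w using uniq[OF f] subspace_add[OF sM f f, of v w] by simp
    show "f (c *\<^sub>R v) = c *\<^sub>R f v" for c v using uniq[OF f] subspace_scale[OF sM f, of c v] by simp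
    show "norm (f v) \<le> norm v * 1" for v
    proof -
      have "- f v \<le> norm v" using dom[of "- v" "- f v"] subspace_scale[OF sM f, of "-1" v] by simp
      then show ?thesis using dom[OF f, of v] by simp
    qed
  qed
  moreover have "f x0 = norm x0" using uniq[OF f x0M] .
  ultimately show ?thesis using assms by (intro exI[where x = "Blinfun f"]) (simp add: bounded_linear_Blinfun_apply)
qed

lemma uniform_boundedness_principle:
  fixes f :: "nat \<Rightarrow> 'a::banach \<Rightarrow>\<^sub>L 'b::real_normed_vector"
  assumes "\<And>x. \<exists>C. \<forall>n. norm (f n x) \<le> C"
  shows "\<exists>C. \<forall>n. norm (f n) \<le> C"
proof -
  define F where "F m = {x. \<forall>n. norm (f n x) \<le> real m}" for m :: nat
  have closedF: "closed (F m)" for m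
    unfolding F_def by (intro closed_Collect_all closed_Collect_le continuous_intros)
  have "\<exists>m. interior (F m) \<noteq> {}"
  proof (rule ccontr)
    assume "\<not> ?thesis"
    then have "euclidean interior_of \<Union>(range F) = ({} :: 'a set)"
      by (intro Baire_category_alt) (auto simp: completely_metrizable_space_euclidean closedF)
    moreover have "\<Union>(range F) = UNIV"
    proof -
      have "\<exists>m. x \<in> F m" for x
      proof -
        obtain C where C: "\<And>n. norm (f n x) \<le> C" using assms by blast
        obtain m :: nat where "C \<le> real m" using real_arch_simple by blast
        then show ?thesis using C by (auto simp: F_def intro: order_trans)
      qed
      then show ?thesis by auto
    qed
    ultimately show False by simp
  qed
  then obtain m x where "x \<in> interior (F m)" by auto
  then obtain r where r: "r > 0" "cball x r \<subseteq> F m"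
    by (meson interior_subset open_contains_cball open_interior order_trans)
  have "norm (f n) \<le> 2 * real m / r" for n
  proof (rule norm_blinfun_bound)
    fix y show "norm (f n y) \<le> 2 * real m / r * norm y"
    proof (cases "y = 0")
      case False
      define c where "c = r / norm y"
      have c: "c > 0" using False r by (simp add: c_def)
      have "x + c *\<^sub>R y \<in> F m" "x \<in> F m" using r False by (auto simp: c_def dist_norm intro!: subsetD[OF r(2)])
      then have "norm (f n (x + c *\<^sub>R y)) \<le> m" "norm (f n x) \<le> m" by (auto simp: F_def)
      moreover have "c * norm (f n y) = norm (f n (x + c *\<^sub>R y) - f n x)"
        using c by (simp add: blinfun.add_right blinfun.scaleR_right)
      ultimately have "c * norm (f n y) \<le> 2 * real m"
        using norm_triangle_ineq4[of "f n (x + c *\<^sub>R y)" "f n x"] by linarith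
      then show ?thesis using False r by (simp add: c_def field_simps)
    qed simp
  qed (use r in auto)
  then show ?thesis by blast
qed

text \<open>Near \<open>0\<close> the bound comes from uniform boundedness, applied to a sequence of times that would
violate it; the semigroup law extends it to bounded intervals.\<close>

lemma c0_semigroup_locally_bounded:
  fixes S :: "real \<Rightarrow> 'a::banach \<Rightarrow>\<^sub>L 'a"
  assumes S: "c0_semigroup S"
  shows "\<exists>C. \<forall>t\<in>{0..a}. norm (S t) \<le> C"
proof -
  have S0: "S 0 = id_blinfun" and Sadd: "\<And>s t. s \<ge> 0 \<Longrightarrow> t \<ge> 0 \<Longrightarrow> S (s + t) = S s o\<^sub>L S t"
    and Slim: "\<And>x. ((\<lambda>t. S t x) \<longlongrightarrow> x) (at_right 0)"
    using S by (auto simp: c0_semigroup_def)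
  have "\<exists>\<delta>>0. \<exists>C. \<forall>t\<in>{0..\<delta>}. norm (S t) \<le> C"
  proof (rule ccontr)
    assume contra: "\<not> ?thesis"
    have "\<exists>t\<in>{0..1 / real (Suc n)}. norm (S t) > real n + 1" for n
    proof -
      have "1 / real (Suc n) > 0" by simp
      then show ?thesis using contra by (meson not_le)
    qed
    then obtain t where t: "\<And>n. t n \<in> {0..1 / real (Suc n)}" "\<And>n. norm (S (t n)) > real n + 1" by metis
    have tpos: "t n > 0" for n
    proof (rule ccontr)
      assume "\<not> 0 < t n"
      then have "t n = 0" using t(1)[of n] by auto
      then have "norm (S (t n)) \<le> 1" using S0 norm_blinfun_id_le by simp
      then show False using t(2)[of n] by simp
    qed
    have "t \<longlonglongrightarrow> 0"
      by (rule tendsto_sandwich[OF _ _ tendsto_const LIMSEQ_inverse_real_of_nat])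
        (use t(1) in \<open>auto simp: inverse_eq_divide\<close>)
    then have tlim: "filterlim t (at_right 0) sequentially"
      using tpos by (auto simp: filterlim_at less_imp_neq[symmetric] intro!: always_eventually)
    have "\<exists>C. \<forall>n. norm (S (t n) x) \<le> C" for x
    proof -
      have "(\<lambda>n. S (t n) x) \<longlonglongrightarrow> x" by (rule filterlim_compose[OF Slim tlim])
      then have "Bseq (\<lambda>n. S (t n) x)" by (intro convergent_imp_Bseq) (auto simp: convergent_def)
      then show ?thesis by (auto simp: Bseq_def)
    qed
    then obtain C where C: "\<And>n. norm (S (t n)) \<le> C" using uniform_boundedness_principle[of "\<lambda>n. S (t n)"] by auto
    obtain n :: nat where "C \<le> real n" using real_arch_simple by blast
    then show False using C[of n] t(2)[of n] by simp
  qed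
  then obtain \<delta> C where \<delta>: "\<delta> > 0" and C: "\<And>t. t \<in> {0..\<delta>} \<Longrightarrow> norm (S t) \<le> C" by blast
  have C0: "C \<ge> 0" using order_trans[OF norm_ge_zero C[of 0]] \<delta> by simp
  have pow: "norm (S t) \<le> C ^ Suc n" if "t \<in> {0..real (Suc n) * \<delta>}" for t n
    using that
  proof (induction n arbitrary: t)
    case 0 then show ?case using C by auto
  next
    case (Suc n)
    define r where "r = t * (1 / real (Suc (Suc n)))"
    have r: "r \<in> {0..\<delta>}" using Suc.prems \<delta> by (auto simp: r_def field_simps)
    have tr: "t - r \<in> {0..real (Suc n) * \<delta>}"
    proof -
      have "t - r = t * (real (Suc n) / real (Suc (Suc n)))" by (simp add: r_def field_simps)
      moreover have "\<dots> \<le> (real (Suc (Suc n)) * \<delta>) * (real (Suc n) / real (Suc (Suc n)))"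
        using Suc.prems by (intro mult_right_mono) auto
      moreover have "\<dots> = real (Suc n) * \<delta>" by simp
      moreover have "0 \<le> t * (real (Suc n) / real (Suc (Suc n)))" using Suc.prems by simp
      ultimately show ?thesis by (metis atLeastAtMost_iff)
    qed
    have "S t = S r o\<^sub>L S (t - r)" using Sadd[of r "t - r"] r tr by auto
    then have "norm (S t) \<le> norm (S r) * norm (S (t - r))" by (simp add: norm_blinfun_compose)
    also have "\<dots> \<le> C * C ^ Suc n" using C[OF r] Suc.IH[OF tr] C0 by (intro mult_mono) auto
    finally show ?case by simp
  qed
  obtain n :: nat where n: "a / \<delta> \<le> real n" using real_arch_simple by blast
  have "a \<le> real (Suc n) * \<delta>" using n \<delta> by (simp add: field_simps)
  then show ?thesis using pow[of _ n] by (intro exI[where x = "C ^ Suc n"]) auto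
qed

lemma c0_semigroup_continuous:
  fixes S :: "real \<Rightarrow> 'a::banach \<Rightarrow>\<^sub>L 'a"
  assumes S: "c0_semigroup S"
  shows "continuous_on {0..} (\<lambda>t. S t x)"
proof -
  have Sadd: "\<And>s t. s \<ge> 0 \<Longrightarrow> t \<ge> 0 \<Longrightarrow> S (s + t) = S s o\<^sub>L S t"
    and Slim: "\<And>x. ((\<lambda>t. S t x) \<longlongrightarrow> x) (at_right 0)"
    using S by (auto simp: c0_semigroup_def)
  show ?thesis unfolding continuous_on_iff
  proof (intro ballI allI impI)
    fix t e :: real assume t: "t \<in> {0..}" and e: "e > 0"
    obtain C where C: "\<And>r. r \<in> {0..t + 1} \<Longrightarrow> norm (S r) \<le> C" using c0_semigroup_locally_bounded[OF S] by blast
    have C0: "C \<ge> 0" using order_trans[OF norm_ge_zero C[of t]] t by simp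
    have "eventually (\<lambda>r. dist (S r x) x < e / (C + 1)) (at_right 0)"
      using Slim[of x] e C0 by (intro tendstoD) auto
    then obtain d where d: "d > 0" "\<And>r. 0 < r \<Longrightarrow> r < d \<Longrightarrow> dist (S r x) x < e / (C + 1)"
      by (auto simp: eventually_at_right_field)
    have step: "dist (S (p + r) x) (S p x) < e" if "p \<in> {0..t + 1}" "0 < r" "r < d" for p r
    proof -
      have "S (p + r) x - S p x = S p (S r x - x)" using Sadd[of p r] that by (simp add: blinfun.diff_right)
      then have "dist (S (p + r) x) (S p x) \<le> norm (S p) * dist (S r x) x" by (simp add: dist_norm norm_blinfun)
      also have "\<dots> \<le> C * dist (S r x) x" using C[OF that(1)] by (intro mult_right_mono) auto
      also have "\<dots> \<le> C * (e / (C + 1))" using d(2)[OF that(2,3)] C0 by (intro mult_left_mono) auto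
      also have "\<dots> < e" using C0 e by (simp add: field_simps)
      finally show ?thesis .
    qed
    show "\<exists>d>0. \<forall>s\<in>{0..}. dist s t < d \<longrightarrow> dist (S s x) (S t x) < e"
    proof (intro exI conjI ballI impI)
      show "min d 1 > 0" using d by simp
      fix s assume s: "s \<in> {0..}" "dist s t < min d 1"
      consider "s = t" | "s > t" | "s < t" by linarith
      then show "dist (S s x) (S t x) < e"
      proof cases
        case 1 then show ?thesis using e by simp
      next
        case 2 then show ?thesis using step[of t "s - t"] s t by (simp add: dist_norm)
      next
        case 3 then show ?thesis using step[of s "t - s"] s t by (simp add: dist_norm dist_commute norm_minus_commute)
      qed
    qed
  qed
qed

section \<open>The domain of the adjoint of the generator\<close>

definition semigroup_integral :: "(real \<Rightarrow> 'a::banach \<Rightarrow>\<^sub>L 'a) \<Rightarrow> real \<Rightarrow> 'a \<Rightarrow> 'a" where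
  "semigroup_integral S s x = integral {0..s} (\<lambda>r. S r x)"

context
  fixes S :: "real \<Rightarrow> 'a::banach \<Rightarrow>\<^sub>L 'a"
  assumes S: "c0_semigroup S"
begin

lemma orbit_integrable: "(\<lambda>r. S r x) integrable_on {a..b}" if "a \<ge> 0"
  by (intro integrable_continuous_real continuous_on_subset[OF c0_semigroup_continuous[OF S]]) (use that in auto)

lemma semigroup_integral_bounded_linear: "bounded_linear (semigroup_integral S s)"
proof -
  obtain C where C: "\<And>t. t \<in> {0..s} \<Longrightarrow> norm (S t) \<le> C" using c0_semigroup_locally_bounded[OF S] by blast
  show ?thesis
  proof (rule bounded_linear_intro)
    show "semigroup_integral S s (x + y) = semigroup_integral S s x + semigroup_integral S s y" for x y
      by (simp add: semigroup_integral_def blinfun.add_right integral_add orbit_integrable)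
    show "semigroup_integral S s (c *\<^sub>R x) = c *\<^sub>R semigroup_integral S s x" for c x
      by (simp add: semigroup_integral_def blinfun.scaleR_right)
    show "norm (semigroup_integral S s x) \<le> norm x * (\<bar>C\<bar> * \<bar>s\<bar>)" for x
    proof (cases "s \<ge> 0")
      case True
      have "norm (semigroup_integral S s x) \<le> (\<bar>C\<bar> * norm x) * (s - 0)"
        unfolding semigroup_integral_def
      proof (rule integral_bound)
        show "continuous_on {0..s} (\<lambda>r. S r x)"
          by (rule continuous_on_subset[OF c0_semigroup_continuous[OF S]]) auto
        fix t assume "t \<in> {0..s}"
        then have "norm (S t) * norm x \<le> \<bar>C\<bar> * norm x" using C[of t] by (intro mult_right_mono) auto
        then show "norm (S t x) \<le> \<bar>C\<bar> * norm x" using norm_blinfun[of "S t" x] by linarith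
      qed (use True in auto)
      then show ?thesis using True by (simp add: ac_simps)
    next
      case False
      then have "semigroup_integral S s x = 0" by (simp add: semigroup_integral_def)
      then show ?thesis by (simp add: mult_nonneg_nonneg)
    qed
  qed
qed

lemma semigroup_integral_has_derivative:
  assumes "t \<ge> 0"
  shows "((\<lambda>h. (1 / h) *\<^sub>R (semigroup_integral S (t + h) x - semigroup_integral S t x)) \<longlongrightarrow> S t x) (at_right 0)"
proof -
  have "((\<lambda>u. integral {0..u} (\<lambda>r. S r x)) has_vector_derivative S t x) (at t within {0..t + 1})"
    by (intro integral_has_vector_derivative continuous_on_subset[OF c0_semigroup_continuous[OF S]]) (use assms in auto)
  then have "((\<lambda>u. integral {0..u} (\<lambda>r. S r x)) has_vector_derivative S t x) (at t within {t..t + 1})"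
    by (rule has_vector_derivative_within_subset) (use assms in auto)
  then have "((\<lambda>u. (1 / norm (u - t)) *\<^sub>R (semigroup_integral S u x - (semigroup_integral S t x + (u - t) *\<^sub>R S t x))) \<longlongrightarrow> 0) (at_right t)"
    by (simp add: at_within_Icc_at_right has_vector_derivative_def has_derivative_within semigroup_integral_def)
  then have "((\<lambda>u. (1 / norm (u - t)) *\<^sub>R (semigroup_integral S u x - (semigroup_integral S t x + (u - t) *\<^sub>R S t x)) + S t x) \<longlongrightarrow> 0 + S t x) (at_right t)"
    by (intro tendsto_intros)
  then have "((\<lambda>u. (1 / (u - t)) *\<^sub>R (semigroup_integral S u x - semigroup_integral S t x)) \<longlongrightarrow> 0 + S t x) (at_right t)"
    by (rule Lim_transform_eventually)
      (use eventually_at_right_less[of t] in \<open>eventually_elim, simp add: scaleR_diff_right scaleR_add_right\<close>)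
  then have "((\<lambda>h. (1 / (h + t - t)) *\<^sub>R (semigroup_integral S (h + t) x - semigroup_integral S t x)) \<longlongrightarrow> S t x) (at_right 0)"
    unfolding filterlim_at_right_to_0[of _ _ t] by (simp only: add_0_left)
  then show ?thesis by (simp only: add.commute[of t] add_diff_cancel_right')
qed

lemma semigroup_commutes_integral:
  assumes "h \<ge> 0" "s \<ge> 0"
  shows "S h (semigroup_integral S s x) = semigroup_integral S s (S h x)"
    and "semigroup_integral S s (S h x) = semigroup_integral S (s + h) x - semigroup_integral S h x"
proof -
  have Sadd: "\<And>s t. s \<ge> 0 \<Longrightarrow> t \<ge> 0 \<Longrightarrow> S (s + t) = S s o\<^sub>L S t"
    using S by (auto simp: c0_semigroup_def)
  have "S h (semigroup_integral S s x) = integral {0..s} (blinfun_apply (S h) \<circ> (\<lambda>r. S r x))"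
    unfolding semigroup_integral_def by (rule integral_linear[symmetric]) (auto intro: orbit_integrable blinfun.bounded_linear_right)
  also have "\<dots> = integral {0..s} (\<lambda>r. S r (S h x))"
    proof (rule integral_cong)
    fix r assume "r \<in> {0..s}"
    then have "S h o\<^sub>L S r = S r o\<^sub>L S h" using Sadd[of h r] Sadd[of r h] assms by (simp add: add.commute)
    then show "(blinfun_apply (S h) \<circ> (\<lambda>r. S r x)) r = S r (S h x)"
      by (metis blinfun_apply_blinfun_compose o_apply)
  qed
  finally show "S h (semigroup_integral S s x) = semigroup_integral S s (S h x)" by (simp add: semigroup_integral_def)
  have "integral {0..s} (\<lambda>r. S r (S h x)) = integral {0..s} (\<lambda>r. S (r + h) x)"
    by (rule integral_cong) (use Sadd assms in auto)
  also have "\<dots> = integral {h..s + h} (\<lambda>r. S r x)"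
    using integral_shift_Icc_real[of 0 s "\<lambda>r. S r x" h] by (simp add: o_def add.commute)
  also have "\<dots> = semigroup_integral S (s + h) x - semigroup_integral S h x"
    using Henstock_Kurzweil_Integration.integral_combine[of 0 h "s + h" "\<lambda>r. S r x"] assms
    by (simp add: semigroup_integral_def orbit_integrable eq_diff_eq add.commute)
  finally show "semigroup_integral S s (S h x) = semigroup_integral S (s + h) x - semigroup_integral S h x"
    by (simp add: semigroup_integral_def)
qed

text \<open>Both halves of the relation between the semigroup integral and the generator are limits of this one
quotient: the operator \<open>semigroup_integral S s\<close> commutes with \<open>S h\<close> and is continuous.\<close>

lemma difference_quotient_of_semigroup_integral:
  assumes s: "s \<ge> 0"
  shows "((\<lambda>h. semigroup_integral S s ((1 / h) *\<^sub>R (S h x - x))) \<longlongrightarrow> S s x - x) (at_right 0)"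
proof (rule Lim_transform_eventually)
  show "((\<lambda>h. (1 / h) *\<^sub>R (semigroup_integral S (s + h) x - semigroup_integral S s x) -
           (1 / h) *\<^sub>R (semigroup_integral S (0 + h) x - semigroup_integral S 0 x)) \<longlongrightarrow> S s x - x) (at_right 0)"
  proof -
    have "S 0 x = x" using S by (simp add: c0_semigroup_def)
    then show ?thesis using tendsto_diff[OF semigroup_integral_has_derivative[OF s, of x] semigroup_integral_has_derivative[OF order_refl, of x]]
      by simp
  qed
  interpret J: bounded_linear "semigroup_integral S s" by (rule semigroup_integral_bounded_linear)
  show "\<forall>\<^sub>F h in at_right 0. (1 / h) *\<^sub>R (semigroup_integral S (s + h) x - semigroup_integral S s x) -
           (1 / h) *\<^sub>R (semigroup_integral S (0 + h) x - semigroup_integral S 0 x)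
         = semigroup_integral S s ((1 / h) *\<^sub>R (S h x - x))"
    using eventually_at_right_less[of 0]
  proof eventually_elim
    case (elim h)
    then show ?case
      by (simp add: J.scaleR J.diff semigroup_commutes_integral(2) s scaleR_diff_right[symmetric])
        (simp add: semigroup_integral_def scaleR_diff_right algebra_simps)
  qed
qed

lemma semigroup_integral_in_generator:
  assumes s: "s \<ge> 0"
  shows "(semigroup_integral S s x, S s x - x) \<in> generator S"
proof -
  interpret J: bounded_linear "semigroup_integral S s" by (rule semigroup_integral_bounded_linear)
  have "((\<lambda>h. (1 / h) *\<^sub>R (S h (semigroup_integral S s x) - semigroup_integral S s x)) \<longlongrightarrow> S s x - x) (at_right 0)"
  proof (rule Lim_transform_eventually[OF difference_quotient_of_semigroup_integral[OF s]])
    show "\<forall>\<^sub>F h in at_right 0. semigroup_integral S s ((1 / h) *\<^sub>R (S h x - x)) =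
       (1 / h) *\<^sub>R (S h (semigroup_integral S s x) - semigroup_integral S s x)"
      using eventually_at_right_less[of 0]
      by eventually_elim (simp add: J.scaleR J.diff semigroup_commutes_integral(1) s)
  qed
  then show ?thesis by (simp add: generator_def)
qed

lemma semigroup_integral_of_generator:
  assumes s: "s \<ge> 0" and xy: "(x, y) \<in> generator S"
  shows "semigroup_integral S s y = S s x - x"
proof -
  have "((\<lambda>h. (1 / h) *\<^sub>R (S h x - x)) \<longlongrightarrow> y) (at_right 0)" using xy by (simp add: generator_def)
  then have "((\<lambda>h. semigroup_integral S s ((1 / h) *\<^sub>R (S h x - x))) \<longlongrightarrow> semigroup_integral S s y) (at_right 0)"
    by (rule bounded_linear.tendsto[OF semigroup_integral_bounded_linear])
  then show ?thesis
    using difference_quotient_of_semigroup_integral[OF s] by (intro tendsto_unique) auto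
qed

text \<open>Functionals in the domain of the adjoint generator turn every orbit, also those that start outside
the domain of the generator, into a scalar \<open>C\<^sup>1\<close> function.\<close>

lemma dual_generator_FTC:
  assumes d: "(xs, ys) \<in> dual_graph (generator S)" and s: "s \<ge> 0"
  shows "blinfun_apply xs (S s e) - blinfun_apply xs e = integral {0..s} (\<lambda>r. blinfun_apply ys (S r e))"
proof -
  have "blinfun_apply xs (S s e - e) = blinfun_apply ys (semigroup_integral S s e)"
    using d semigroup_integral_in_generator[OF s, of e] by (auto simp: dual_graph_def)
  also have "\<dots> = integral {0..s} (blinfun_apply ys \<circ> (\<lambda>r. S r e))"
    unfolding semigroup_integral_def by (rule integral_linear[symmetric]) (auto intro: orbit_integrable blinfun.bounded_linear_right)
  finally show ?thesis by (simp add: blinfun.diff_right o_def)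
qed

lemma dual_generator_invariant:
  assumes d: "(xs, ys) \<in> dual_graph (generator S)" and t: "t \<ge> 0"
  shows "(xs o\<^sub>L S t, ys o\<^sub>L S t) \<in> dual_graph (generator S)"
proof -
  have "(S t x, S t y) \<in> generator S" if "(x, y) \<in> generator S" for x y
  proof -
    have Sadd: "\<And>s t. s \<ge> 0 \<Longrightarrow> t \<ge> 0 \<Longrightarrow> S (s + t) = S s o\<^sub>L S t"
      using S by (auto simp: c0_semigroup_def)
    have "((\<lambda>h. S t ((1 / h) *\<^sub>R (S h x - x))) \<longlongrightarrow> S t y) (at_right 0)"
      using that by (intro tendsto_intros) (simp add: generator_def)
    then have "((\<lambda>h. (1 / h) *\<^sub>R (S h (S t x) - S t x)) \<longlongrightarrow> S t y) (at_right 0)"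
    proof (rule Lim_transform_eventually)
      show "\<forall>\<^sub>F h in at_right 0. S t ((1 / h) *\<^sub>R (S h x - x)) = (1 / h) *\<^sub>R (S h (S t x) - S t x)"
        using eventually_at_right_less[of 0]
      proof eventually_elim
        case (elim h)
        have "S h (S t x) = S t (S h x)" using Sadd[of h t] Sadd[of t h] elim t
          by (metis add.commute blinfun_apply_blinfun_compose less_imp_le)
        then show ?case by (simp add: blinfun.scaleR_right blinfun.diff_right)
      qed
    qed
    then show ?thesis by (simp add: generator_def)
  qed
  then show ?thesis using d unfolding dual_graph_def by fastforce
qed

text \<open>The domain of the adjoint generator is in general not norm dense, but it contains the averages
\<open>f \<circ> semigroup_integral S h\<close> of all functionals \<open>f\<close>, and \<open>semigroup_integral S h e / h\<close> tends to \<open>e\<close>.\<close>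

lemma dual_generator_separates_points:
  assumes "e \<noteq> 0"
  shows "\<exists>(xs, ys)\<in>dual_graph (generator S). blinfun_apply xs e \<noteq> 0"
proof -
  obtain f :: "'a \<Rightarrow>\<^sub>L real" where f: "f e \<noteq> 0" using functionals_separate_points[OF assms] by blast
  have "((\<lambda>h. (1 / h) *\<^sub>R (semigroup_integral S (0 + h) e - semigroup_integral S 0 e)) \<longlongrightarrow> S 0 e) (at_right 0)"
    by (rule semigroup_integral_has_derivative) simp
  then have "((\<lambda>h. f ((1 / h) *\<^sub>R semigroup_integral S h e)) \<longlongrightarrow> f e) (at_right 0)"
    using S by (intro tendsto_intros) (simp add: c0_semigroup_def semigroup_integral_def)
  then have "\<forall>\<^sub>F h in at_right 0. f ((1 / h) *\<^sub>R semigroup_integral S h e) \<noteq> 0"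
    using f by (rule tendsto_imp_eventually_ne)
  then have "\<forall>\<^sub>F h in at_right 0. h > 0 \<and> f ((1 / h) *\<^sub>R semigroup_integral S h e) \<noteq> 0"
    using eventually_at_right_less[of 0] by eventually_elim auto
  then obtain h :: real where h: "h > 0" "f ((1 / h) *\<^sub>R semigroup_integral S h e) \<noteq> 0"
    using eventually_happens'[OF trivial_limit_at_right_real] by (metis (mono_tags, lifting))
  define xs where "xs = f o\<^sub>L Blinfun (semigroup_integral S h)"
  have xs: "blinfun_apply xs x = f (semigroup_integral S h x)" for x
    by (simp add: xs_def bounded_linear_Blinfun_apply semigroup_integral_bounded_linear)
  have "(xs, (f o\<^sub>L S h) - f) \<in> dual_graph (generator S)"
    using h by (auto simp: dual_graph_def xs semigroup_integral_of_generator blinfun.diff_right blinfun.diff_left)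
  moreover have "blinfun_apply xs e \<noteq> 0" using h by (auto simp: xs blinfun.scaleR_right)
  ultimately show ?thesis by blast
qed

end

section \<open>Pointwise bounds from Laplace transforms\<close>

lemma std_normal_fourier:
  "(LINT y|lborel. of_real (std_normal_density y) * iexp (r * y)) = complex_of_real (exp (- (r\<^sup>2) / 2))"
proof -
  have "char std_normal_distribution r = (LINT y|lborel. std_normal_density y *\<^sub>R iexp (r * y))"
    unfolding char_def by (subst integral_density) (auto simp: normal_density_nonneg)
  then show ?thesis by (simp add: char_std_normal_distribution scaleR_conv_of_real)
qed

text \<open>Fourier inversion, regularized by a Gaussian so that Fubini's theorem applies: the Gaussian density is,
up to a factor, its own Fourier transform, so the average of \<open>g\<close> around \<open>\<tau>\<close> at scale \<open>\<epsilon>\<close> is an average of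
the Fourier transform of \<open>g\<close>. The bound does not depend on \<open>\<epsilon>\<close>.\<close>

lemma gaussian_average_bound:
  fixes g :: "real \<Rightarrow> complex"
  assumes g: "integrable lborel g" and F: "integrable lborel F"
    and bound: "\<And>\<eta>. cmod (LINT t|lborel. g t * iexp (- \<eta> * t)) \<le> F \<eta>"
    and \<epsilon>: "\<epsilon> > 0"
  shows "2 * pi * cmod (LINT r|lborel. g (\<tau> + \<epsilon> * r) * of_real (std_normal_density r)) \<le> (LINT \<eta>|lborel. F \<eta>)"
proof -
  let ?\<phi> = std_normal_density
  have gs: "integrable lborel (\<lambda>r. g (\<tau> + \<epsilon> * r))" using g \<epsilon> by (intro lborel_integrable_real_affine) auto
  have [measurable]: "g \<in> borel_measurable borel" using borel_measurable_integrable[OF g] by simp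
  have [measurable]: "F \<in> borel_measurable borel" using borel_measurable_integrable[OF F] by simp
  have \<phi>: "integrable lborel ?\<phi>" by (rule integrable_normal_density) simp
  define h where "h r y = g (\<tau> + \<epsilon> * r) * (of_real (?\<phi> y) * iexp (r * y))" for r y
  have int: "integrable (lborel \<Otimes>\<^sub>M lborel) (case_prod h)"
  proof (rule lborel_pair.Fubini_integrable)
    show "case_prod h \<in> borel_measurable (lborel \<Otimes>\<^sub>M lborel)"
      unfolding h_def by measurable
    have "(\<lambda>r. LINT y|lborel. norm (case_prod h (r, y))) = (\<lambda>r. norm (g (\<tau> + \<epsilon> * r)) * (LINT y|lborel. ?\<phi> y))"
      by (simp add: h_def norm_mult normal_density_nonneg)
    then show "integrable lborel (\<lambda>r. LINT y|lborel. norm (case_prod h (r, y)))"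
      using gs by (simp add: integrable_norm)
    have "integrable lborel (\<lambda>y. h r y)" for r
    proof (rule Bochner_Integration.integrable_bound)
      show "integrable lborel (\<lambda>y. norm (g (\<tau> + \<epsilon> * r)) * ?\<phi> y)" using \<phi> by simp
      show "(\<lambda>y. h r y) \<in> borel_measurable lborel" unfolding h_def by measurable
    qed (auto simp: h_def norm_mult normal_density_nonneg)
    then show "AE r in lborel. integrable lborel (\<lambda>y. case_prod h (r, y))" by simp
  qed
  have e1: "(LINT y|lborel. h r y) = of_real (sqrt (2 * pi)) * (g (\<tau> + \<epsilon> * r) * of_real (?\<phi> r))" for r
  proof -
    have "(LINT y|lborel. h r y) = g (\<tau> + \<epsilon> * r) * of_real (exp (- (r\<^sup>2) / 2))"
      unfolding h_def by (subst integral_mult_right_zero) (simp only: std_normal_fourier)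
    then show ?thesis by (simp add: normal_density_def std_normal_density_def)
  qed
  have e2: "cmod (LINT r|lborel. h r y) \<le> F (- y / \<epsilon>) / \<epsilon> / sqrt (2 * pi)" for y
  proof -
    have "(LINT t|lborel. g t * iexp (- (- y / \<epsilon>) * t)) =
        \<bar>\<epsilon>\<bar> *\<^sub>R (LINT r|lborel. g (\<tau> + \<epsilon> * r) * iexp (- (- y / \<epsilon>) * (\<tau> + \<epsilon> * r)))"
      using \<epsilon> by (intro lborel_integral_real_affine) auto
    also have "(\<lambda>r. g (\<tau> + \<epsilon> * r) * iexp (- (- y / \<epsilon>) * (\<tau> + \<epsilon> * r))) =
        (\<lambda>r. iexp (y * \<tau> / \<epsilon>) * (g (\<tau> + \<epsilon> * r) * iexp (r * y)))"
    proof
      fix r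
      have "- (- y / \<epsilon>) * (\<tau> + \<epsilon> * r) = y * \<tau> / \<epsilon> + r * y" using \<epsilon> by (simp add: field_simps)
      then have "iexp (- (- y / \<epsilon>) * (\<tau> + \<epsilon> * r)) = iexp (y * \<tau> / \<epsilon>) * iexp (r * y)"
        by (simp only: of_real_add distrib_left exp_add)
      then show "g (\<tau> + \<epsilon> * r) * iexp (- (- y / \<epsilon>) * (\<tau> + \<epsilon> * r)) = iexp (y * \<tau> / \<epsilon>) * (g (\<tau> + \<epsilon> * r) * iexp (r * y))"
        by (simp only: ac_simps)
    qed
    finally have "cmod (LINT t|lborel. g t * iexp (- (- y / \<epsilon>) * t)) =
        \<epsilon> * cmod (LINT r|lborel. g (\<tau> + \<epsilon> * r) * iexp (r * y))"
      using \<epsilon> by (simp add: norm_mult)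
    then have b: "\<epsilon> * cmod (LINT r|lborel. g (\<tau> + \<epsilon> * r) * iexp (r * y)) \<le> F (- y / \<epsilon>)"
      using bound[of "- y / \<epsilon>"] by simp
    have "(\<lambda>r. h r y) = (\<lambda>r. of_real (?\<phi> y) * (g (\<tau> + \<epsilon> * r) * iexp (r * y)))"
      by (simp add: h_def ac_simps)
    then have "cmod (LINT r|lborel. h r y) = ?\<phi> y * cmod (LINT r|lborel. g (\<tau> + \<epsilon> * r) * iexp (r * y))"
      by (simp add: norm_mult normal_density_nonneg)
    also have "\<dots> \<le> 1 / sqrt (2 * pi) * cmod (LINT r|lborel. g (\<tau> + \<epsilon> * r) * iexp (r * y))"
      by (intro mult_right_mono) (auto simp: normal_density_def divide_right_mono)
    also have "\<dots> \<le> 1 / sqrt (2 * pi) * (F (- y / \<epsilon>) / \<epsilon>)"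
      using b \<epsilon> by (intro mult_left_mono) (auto simp: field_simps)
    finally show ?thesis by (simp add: mult.commute)
  qed
  have Fs: "integrable lborel (\<lambda>y. F (- y / \<epsilon>) / \<epsilon> / sqrt (2 * pi))"
    using lborel_integrable_real_affine[OF F, of "- 1 / \<epsilon>" 0] \<epsilon> by simp
  have "of_real (sqrt (2 * pi)) * (LINT r|lborel. g (\<tau> + \<epsilon> * r) * of_real (?\<phi> r)) = (LINT r|lborel. LINT y|lborel. h r y)"
    by (simp add: e1)
  also have "\<dots> = (LINT y|lborel. LINT r|lborel. h r y)"
    by (rule lborel_pair.Fubini_integral[OF int, symmetric])
  finally have eq: "of_real (sqrt (2 * pi)) * (LINT r|lborel. g (\<tau> + \<epsilon> * r) * of_real (?\<phi> r)) = (LINT y|lborel. LINT r|lborel. h r y)" .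
  have "sqrt (2 * pi) * cmod (LINT r|lborel. g (\<tau> + \<epsilon> * r) * of_real (?\<phi> r)) = cmod (LINT y|lborel. LINT r|lborel. h r y)"
    unfolding eq[symmetric] norm_mult norm_of_real by simp
  also have "\<dots> \<le> (LINT y|lborel. F (- y / \<epsilon>) / \<epsilon> / sqrt (2 * pi))"
    using e2 by (intro Bochner_Integration.integral_norm_bound_integral lborel_pair.integrable_snd[OF int] Fs) auto
  also have "\<dots> = (LINT y|lborel. F y) / sqrt (2 * pi)"
    using lborel_integral_real_affine[of "- 1 / \<epsilon>" F 0] \<epsilon> by (simp add: field_simps)
  finally have "sqrt (2 * pi) * cmod (LINT r|lborel. g (\<tau> + \<epsilon> * r) * of_real (?\<phi> r)) * sqrt (2 * pi) \<le> (LINT y|lborel. F y)"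
    by (simp add: pos_le_divide_eq)
  then show ?thesis
  proof -
    assume *: "sqrt (2 * pi) * cmod (LINT r|lborel. g (\<tau> + \<epsilon> * r) * of_real (?\<phi> r)) * sqrt (2 * pi) \<le> (LINT y|lborel. F y)"
    have "sqrt (2 * pi) * x * sqrt (2 * pi) = 2 * pi * x" for x :: real
    proof -
      have "sqrt (2 * pi) * sqrt (2 * pi) = 2 * pi" by simp
      then show ?thesis by (metis mult.assoc mult.commute)
    qed
    with * show ?thesis by (simp only:)
  qed
qed

lemma fourier_transform_controls_value:
  fixes g :: "real \<Rightarrow> complex"
  assumes g: "integrable lborel g" and F: "integrable lborel F"
    and bound: "\<And>\<eta>. cmod (LINT t|lborel. g t * iexp (- \<eta> * t)) \<le> F \<eta>"
    and bdd: "\<And>t. cmod (g t) \<le> b" and cont: "isCont g \<tau>"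
  shows "2 * pi * cmod (g \<tau>) \<le> (LINT \<eta>|lborel. F \<eta>)"
proof -
  let ?\<phi> = std_normal_density
  have [measurable]: "g \<in> borel_measurable borel" using borel_measurable_integrable[OF g] by simp
  have "(\<lambda>n. LINT r|lborel. g (\<tau> + 1 / real (Suc n) * r) * of_real (?\<phi> r)) \<longlonglongrightarrow> (LINT r|lborel. g \<tau> * of_real (?\<phi> r))"
  proof (rule integral_dominated_convergence)
    show "integrable lborel (\<lambda>r. b * ?\<phi> r)" by simp
    show "AE r in lborel. (\<lambda>n. g (\<tau> + 1 / real (Suc n) * r) * of_real (?\<phi> r)) \<longlonglongrightarrow> g \<tau> * of_real (?\<phi> r)"
    proof (rule AE_I2)
      fix r :: real
      have "(\<lambda>n. \<tau> + 1 / real (Suc n) * r) \<longlonglongrightarrow> \<tau> + 0 * r"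
        using LIMSEQ_inverse_real_of_nat by (intro tendsto_intros) (simp add: inverse_eq_divide)
      then have "(\<lambda>n. g (\<tau> + 1 / real (Suc n) * r)) \<longlonglongrightarrow> g \<tau>"
        using cont by (intro isCont_tendsto_compose[of \<tau> g]) auto
      then show "(\<lambda>n. g (\<tau> + 1 / real (Suc n) * r) * of_real (?\<phi> r)) \<longlonglongrightarrow> g \<tau> * of_real (?\<phi> r)"
        by (intro tendsto_intros)
    qed
    show "AE r in lborel. norm (g (\<tau> + 1 / real (Suc n) * r) * of_real (?\<phi> r)) \<le> b * ?\<phi> r" for n
      by (auto simp: norm_mult normal_density_nonneg intro!: mult_right_mono bdd)
  qed measurable
  then have lim: "(\<lambda>n. 2 * pi * cmod (LINT r|lborel. g (\<tau> + 1 / real (Suc n) * r) * of_real (?\<phi> r)))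
      \<longlonglongrightarrow> 2 * pi * cmod (LINT r|lborel. g \<tau> * of_real (?\<phi> r))"
    by (intro tendsto_intros)
  have "2 * pi * cmod (LINT r|lborel. g (\<tau> + 1 / real (Suc n) * r) * of_real (?\<phi> r)) \<le> (LINT \<eta>|lborel. F \<eta>)" for n
    by (rule gaussian_average_bound[OF g F bound]) simp
  then have "2 * pi * cmod (LINT r|lborel. g \<tau> * of_real (?\<phi> r)) \<le> (LINT \<eta>|lborel. F \<eta>)"
    by (intro LIMSEQ_le_const2[OF lim]) blast
  then show ?thesis by simp
qed

lemma integral_lorentzian:
  fixes \<tau> :: real
  assumes "\<tau> > 0"
  shows "integrable lborel (\<lambda>\<eta>. 1 / ((1 / \<tau>)\<^sup>2 + \<eta>\<^sup>2))" (is ?I)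
    and "(LINT \<eta>|lborel. 1 / ((1 / \<tau>)\<^sup>2 + \<eta>\<^sup>2)) = pi * \<tau>" (is ?V)
proof -
  let ?f = "\<lambda>\<eta>. 1 / ((1 / \<tau>)\<^sup>2 + \<eta>\<^sup>2)" and ?F = "\<lambda>\<eta>. \<tau> * arctan (\<tau> * \<eta>)"
  have pos: "(1 / \<tau>)\<^sup>2 + \<eta>\<^sup>2 > 0" for \<eta> using assms by (simp add: add_pos_nonneg)
  have D: "DERIV ?F \<eta> :> ?f \<eta>" for \<eta>
    using assms pos[of \<eta>] by (auto intro!: derivative_eq_intros simp: field_simps power2_eq_square)
  have c: "isCont ?f \<eta>" for \<eta> using pos[of \<eta>] by (intro continuous_intros) auto
  have "filterlim (\<lambda>\<eta>. \<tau> * \<eta>) at_top at_top"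
    by (rule filterlim_tendsto_pos_mult_at_top[OF tendsto_const assms filterlim_ident])
  then have "(?F \<longlongrightarrow> \<tau> * (pi / 2)) at_top"
    by (intro tendsto_intros filterlim_compose[OF tendsto_arctan_at_top])
  then have top: "((?F \<circ> real_of_ereal) \<longlongrightarrow> \<tau> * (pi / 2)) (at_left \<infinity>)"
    by (simp only: ereal_tendsto_simps)
  have "filterlim (\<lambda>\<eta>. \<tau> * \<eta>) at_bot at_bot"
    by (rule filterlim_tendsto_pos_mult_at_bot[OF tendsto_const assms filterlim_ident])
  then have "(?F \<longlongrightarrow> \<tau> * (- (pi / 2))) at_bot"
    by (intro tendsto_intros filterlim_compose[OF tendsto_arctan_at_bot])
  then have bot: "((?F \<circ> real_of_ereal) \<longlongrightarrow> \<tau> * (- (pi / 2))) (at_right (- \<infinity>))"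
    by (simp only: ereal_tendsto_simps)
  have nn: "AE \<eta> in lborel. - \<infinity> < ereal \<eta> \<longrightarrow> ereal \<eta> < \<infinity> \<longrightarrow> 0 \<le> ?f \<eta>" using pos by (auto intro: less_imp_le)
  have "set_integrable lborel (einterval (- \<infinity>) \<infinity>) ?f"
    by (rule interval_integral_FTC_nonneg[OF _ D c nn bot top]) simp
  then show ?I by (simp add: set_integrable_def einterval_def)
  have "(LBINT x=-\<infinity>..\<infinity>. ?f x) = \<tau> * (pi / 2) - \<tau> * (- (pi / 2))"
    by (rule interval_integral_FTC_nonneg[OF _ D c nn bot top]) simp
  then show ?V by (simp add: interval_lebesgue_integral_def set_lebesgue_integral_def einterval_def)
qed

lemma exponential_integrable:
  assumes "c > 0"
  shows "set_integrable lborel {0<..} (\<lambda>t. exp (- c * t) :: real)"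
proof -
  have "set_integrable lborel (einterval 0 \<infinity>) (\<lambda>t. exp (- c * t) :: real)"
  proof (rule interval_integral_FTC_nonneg)
    show "DERIV (\<lambda>t. - exp (- c * t) / c) t :> exp (- c * t)" for t
      using assms by (auto intro!: derivative_eq_intros)
    show "(((\<lambda>t. - exp (- c * t) / c) \<circ> real_of_ereal) \<longlongrightarrow> - 1 / c) (at_right 0)"
      unfolding zero_ereal_def ereal_tendsto_simps
      using assms by (auto intro!: tendsto_eq_intros)
    have "filterlim (\<lambda>t. - c * t) at_bot at_top"
      using assms by (intro filterlim_tendsto_neg_mult_at_bot[OF tendsto_const]) (auto intro: filterlim_ident)
    then have "((\<lambda>t. - exp (- c * t) / c) \<longlongrightarrow> - 0 / c) at_top"
      by (intro tendsto_intros filterlim_compose[OF exp_at_bot]) (use assms in auto)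
    then show "(((\<lambda>t. - exp (- c * t) / c) \<circ> real_of_ereal) \<longlongrightarrow> 0) (at_left \<infinity>)"
      unfolding ereal_tendsto_simps by simp
  qed auto
  then show ?thesis by (simp add: zero_ereal_def)
qed

lemma exp_weight_integrable:
  fixes f :: "real \<Rightarrow> complex"
  assumes cont: "continuous_on {0<..} f" and bdd: "\<And>t. t > 0 \<Longrightarrow> cmod (f t) \<le> b" and \<mu>: "Re \<mu> > 0" and n: "n \<le> 1"
  shows "set_integrable lborel {0<..} (\<lambda>t. of_real t ^ n * exp (- \<mu> * of_real t) * f t)"
proof -
  define a where "a = Re \<mu> / 2"
  have a: "a > 0" using \<mu> by (simp add: a_def)
  have b0: "b \<ge> 0" using order_trans[OF norm_ge_zero bdd[of 1]] by simp
  have "set_integrable lborel {0<..} (\<lambda>t. (1 + 1 / a) * b * exp (- a * t))"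
    by (rule set_integrable_mult_right) (rule exponential_integrable[OF a])
  then show ?thesis
  proof (rule set_integrable_bound)
    show "set_borel_measurable lborel {0<..} (\<lambda>t. of_real t ^ n * exp (- \<mu> * of_real t) * f t)"
      unfolding set_borel_measurable_def
      by (simp only: measurable_lborel2) (intro borel_measurable_continuous_on_indicator continuous_intros cont; simp)
    show "AE t in lborel. t \<in> {0<..} \<longrightarrow>
        cmod (of_real t ^ n * exp (- \<mu> * of_real t) * f t) \<le> norm ((1 + 1 / a) * b * exp (- a * t))"
    proof (rule AE_I2, rule impI)
      fix t :: real assume "t \<in> {0<..}"
      then have t: "t > 0" by simp
      have e1: "1 \<le> exp (a * t)" using a t by simp
      have "a * t \<le> exp (a * t)" using exp_ge_add_one_self[of "a * t"] by linarith
      then have e2: "t \<le> 1 / a * exp (a * t)" using a by (simp add: field_simps)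
      have "t ^ n \<le> exp (a * t) + 1 / a * exp (a * t)"
        using n e1 e2 a by (cases n) (auto intro: add_increasing add_increasing2)
      then have tn: "t ^ n \<le> (1 + 1 / a) * exp (a * t)" by (simp only: distrib_right mult_1_left)
      have "cmod (of_real t ^ n * exp (- \<mu> * of_real t) * f t) = t ^ n * exp (- (2 * a * t)) * cmod (f t)"
        using t by (simp add: norm_mult norm_power a_def)
      also have "\<dots> \<le> ((1 + 1 / a) * exp (a * t)) * exp (- (2 * a * t)) * b"
        using tn t a b0 bdd[OF t] by (intro mult_mono) auto
      also have "\<dots> = (1 + 1 / a) * b * (exp (a * t) * exp (- (2 * a * t)))" by (simp only: ac_simps)
      also have "exp (a * t) * exp (- (2 * a * t)) = exp (- a * t)" by (simp add: exp_add[symmetric])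
      finally show "cmod (of_real t ^ n * exp (- \<mu> * of_real t) * f t) \<le> norm ((1 + 1 / a) * b * exp (- a * t))"
        using a b0 by simp
    qed
  qed
qed

text \<open>On the line \<open>Re \<mu> = 1 / \<tau>\<close> the Laplace transform of \<open>t f(t)\<close> is the Fourier transform of
\<open>g(t) = t exp (- t / \<tau>) f(t)\<close>. The hypothesis bounds it by \<open>M / (\<tau>\<^sup>-\<^sup>2 + \<eta>\<^sup>2)\<close>, whose integral is \<open>\<pi> M \<tau>\<close>;
this matches the factor \<open>\<tau>\<close> in \<open>g(\<tau>) = \<tau> f(\<tau>) / e\<close>, so that the resulting bound on \<open>f\<close> is uniform
in \<open>\<tau>\<close>. The weight \<open>t\<close> is what makes the transform decay integrably.\<close>

lemma laplace_controls_value: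
  fixes f :: "real \<Rightarrow> complex"
  assumes cont: "continuous_on {0<..} f" and bdd: "\<And>t. t > 0 \<Longrightarrow> cmod (f t) \<le> b" and \<tau>: "\<tau> > 0"
    and lap: "\<And>\<mu>. Re \<mu> > 0 \<Longrightarrow>
      (cmod \<mu>)\<^sup>2 * cmod (LINT t:{0<..}|lborel. of_real t * exp (- \<mu> * of_real t) * f t) \<le> M"
  shows "cmod (f \<tau>) \<le> exp 1 / 2 * M"
proof -
  define g where "g t = indicator {0<..} t *\<^sub>R (of_real t * exp (- of_real (1 / \<tau>) * of_real t) * f t)" for t :: real
  define F where "F \<eta> = M * (1 / ((1 / \<tau>)\<^sup>2 + \<eta>\<^sup>2))" for \<eta>
  have g: "integrable lborel g"
    using exp_weight_integrable[OF cont bdd, where n = 1 and \<mu> = "of_real (1 / \<tau>)"] \<tau>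
    by (simp add: g_def[abs_def] set_integrable_def)
  have F: "integrable lborel F" unfolding F_def[abs_def] by (rule integrable_mult_right[OF integral_lorentzian(1)[OF \<tau>]])
  have bound: "cmod (LINT t|lborel. g t * iexp (- \<eta> * t)) \<le> F \<eta>" for \<eta>
  proof -
    define \<mu> where "\<mu> = Complex (1 / \<tau>) \<eta>"
    have sq: "(cmod \<mu>)\<^sup>2 = (1 / \<tau>)\<^sup>2 + \<eta>\<^sup>2" by (simp add: \<mu>_def cmod_power2)
    have pos: "(cmod \<mu>)\<^sup>2 > 0" using \<tau> by (simp add: sq add_pos_nonneg)
    have "g t * iexp (- \<eta> * t) = indicator {0<..} t *\<^sub>R (of_real t * exp (- \<mu> * of_real t) * f t)" for t
    proof -
      have "exp (- \<mu> * of_real t) = exp (- of_real (1 / \<tau>) * of_real t) * iexp (- \<eta> * t)"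
      proof -
        have "- \<mu> * of_real t = - of_real (1 / \<tau>) * of_real t + \<i> * of_real (- \<eta> * t)"
          by (simp add: \<mu>_def Complex_eq algebra_simps)
        then show ?thesis by (simp only: exp_add)
      qed
      then show ?thesis by (simp add: g_def)
    qed
    then have "(LINT t|lborel. g t * iexp (- \<eta> * t)) = (LINT t:{0<..}|lborel. of_real t * exp (- \<mu> * of_real t) * f t)"
      by (simp add: set_lebesgue_integral_def)
    moreover have Fe: "F \<eta> = M / (cmod \<mu>)\<^sup>2" by (simp add: F_def sq)
    moreover have "(cmod \<mu>)\<^sup>2 * cmod (LINT t:{0<..}|lborel. of_real t * exp (- \<mu> * of_real t) * f t) \<le> M"
      using \<tau> by (intro lap) (simp add: \<mu>_def)
    ultimately show ?thesis using pos by (simp only: Fe pos_le_divide_eq mult.commute)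
  qed
  have b0: "b \<ge> 0" using order_trans[OF norm_ge_zero bdd[of 1]] by simp
  have gb: "cmod (g t) \<le> \<tau> * b" for t
  proof (cases "t > 0")
    case True
    have "t / \<tau> \<le> exp (t / \<tau>)" using exp_ge_add_one_self[of "t / \<tau>"] by linarith
    then have "t \<le> \<tau> * exp (t / \<tau>)" using \<tau> by (simp add: field_simps)
    then have "t * exp (- (t / \<tau>)) \<le> \<tau> * exp (t / \<tau>) * exp (- (t / \<tau>))" by (intro mult_right_mono) auto
    then have "t * exp (- (t / \<tau>)) \<le> \<tau>"
      using exp_minus_inverse[of "t / \<tau>"] by (simp only: mult.assoc mult_1_right)
    moreover have "cmod (g t) = t * exp (- (t / \<tau>)) * cmod (f t)"
      using True by (simp add: g_def norm_mult)
    ultimately show ?thesis using bdd[OF True] \<tau> by (auto intro!: mult_mono)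
  qed (use \<tau> b0 in \<open>simp add: g_def\<close>)
  have "isCont (\<lambda>t. of_real t * exp (- of_real (1 / \<tau>) * of_real t) * f t) \<tau>"
    using cont \<tau> by (intro continuous_intros) (auto simp: continuous_on_eq_continuous_at)
  then have "isCont g \<tau>"
    by (rule isCont_cong[THEN iffD1, rotated])
      (use \<tau> in \<open>auto simp: g_def intro!: eventually_mono[OF eventually_nhds_in_open[of "{0<..}" \<tau>]]\<close>)
  have "2 * pi * cmod (g \<tau>) \<le> (LINT \<eta>|lborel. F \<eta>)"
    by (rule fourier_transform_controls_value[OF g F bound gb \<open>isCont g \<tau>\<close>])
  also have "\<dots> = M * (pi * \<tau>)" unfolding F_def[abs_def] integral_mult_right_zero integral_lorentzian(2)[OF \<tau>] ..
  finally have "2 * pi * cmod (g \<tau>) \<le> M * (pi * \<tau>)" .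
  moreover have "cmod (g \<tau>) = \<tau> * exp (- 1) * cmod (f \<tau>)" using \<tau> by (simp add: g_def norm_mult exp_of_real[symmetric])
  ultimately have "\<tau> * pi * (2 * exp (- 1) * cmod (f \<tau>)) \<le> \<tau> * pi * M" by (simp add: ac_simps)
  then have "2 * exp (- 1) * cmod (f \<tau>) \<le> M" using \<tau> by (simp only: mult_le_cancel_left_pos mult_pos_pos pi_gt_zero)
  then show ?thesis by (simp add: exp_minus field_simps)
qed

section \<open>Complexified Hilbert spaces and weak holomorphy\<close>

text \<open>Multiplication by the imaginary unit on the complexification. Bounded complex-linear operators are
treated as bounded real-linear operators on the real Hilbert space \<open>'a \<times> 'a\<close> that commute with \<open>cJ\<close>, so that
the results on real Hilbert spaces apply to them.\<close>

definition cJ :: "'a::real_vector \<times> 'a \<Rightarrow> 'a \<times> 'a" where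
  "cJ x = (- snd x, fst x)"

definition cscale :: "complex \<Rightarrow> 'a::real_vector \<times> 'a \<Rightarrow> 'a \<times> 'a" where
  "cscale c x = Re c *\<^sub>R x + Im c *\<^sub>R cJ x"

text \<open>The complex inner product, linear in its first argument.\<close>

definition cinner :: "'a::real_inner \<times> 'a \<Rightarrow> 'a \<times> 'a \<Rightarrow> complex" where
  "cinner x y = Complex (x \<bullet> y) (x \<bullet> cJ y)"

lemma complexify_simps:
  "carr complexify = UNIV" "snorm complexify = norm" "scale complexify = cscale"
  by (auto simp: complexify_def cscale_def cJ_def fun_eq_iff)

lemma cJ_add: "cJ (x + y) = cJ x + cJ y" and cJ_diff: "cJ (x - y) = cJ x - cJ y"
  and cJ_scaleR: "cJ (r *\<^sub>R x) = r *\<^sub>R cJ x" and cJ_cJ: "cJ (cJ x) = - x"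
  by (auto simp: cJ_def prod_eq_iff)

lemma inner_cJ_right: "x \<bullet> cJ y = - (cJ x \<bullet> y)"
  by (simp add: cJ_def inner_prod_def)

lemma inner_cJ_cJ: "cJ x \<bullet> cJ y = x \<bullet> y"
  by (simp add: cJ_def inner_prod_def)

lemma inner_cJ_self: "x \<bullet> cJ x = 0"
  by (simp add: cJ_def inner_prod_def inner_commute)

lemma norm_cJ: "norm (cJ x) = norm (x :: 'a::real_inner \<times> 'a)"
  by (simp add: norm_eq_sqrt_inner inner_cJ_cJ)

lemma bounded_linear_cJ: "bounded_linear (cJ :: 'a::real_inner \<times> 'a \<Rightarrow> 'a \<times> 'a)"
  by (rule bounded_linear_intro[where K = 1]) (auto simp: cJ_add cJ_scaleR norm_cJ)

lemma Re_cinner: "Re (cinner x y) = x \<bullet> y" and Im_cinner: "Im (cinner x y) = x \<bullet> cJ y"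
  by (simp_all add: cinner_def)

lemma cinner_add_left: "cinner (x + y) z = cinner x z + cinner y z"
  and cinner_add_right: "cinner x (y + z) = cinner x y + cinner x z"
  and cinner_diff_left: "cinner (x - y) z = cinner x z - cinner y z"
  and cinner_diff_right: "cinner x (y - z) = cinner x y - cinner x z"
  and cinner_scaleR_left: "cinner (r *\<^sub>R x) y = of_real r * cinner x y"
  and cinner_scaleR_right: "cinner x (r *\<^sub>R y) = of_real r * cinner x y"
  and cinner_cJ_left: "cinner (cJ x) y = \<i> * cinner x y"
  and cinner_cJ_right: "cinner x (cJ y) = - \<i> * cinner x y"
  by (simp_all add: complex_eq_iff Re_cinner Im_cinner inner_add inner_diff cJ_add cJ_diff cJ_scaleR inner_cJ_right cJ_cJ)

lemma cinner_commute: "cinner y x = cnj (cinner x y)"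
proof -
  have "y \<bullet> cJ x = - (x \<bullet> cJ y)" using inner_cJ_right[of y x] inner_commute[of "cJ y" x] by simp
  then show ?thesis by (simp add: complex_eq_iff Re_cinner Im_cinner inner_commute[of y x])
qed

lemma cinner_cscale_left: "cinner (cscale c x) y = c * cinner x y"
  by (simp add: cscale_def cinner_add_left cinner_scaleR_left cinner_cJ_left complex_eq_iff)

lemma cinner_cscale_right: "cinner x (cscale c y) = cnj c * cinner x y"
  by (simp add: cscale_def cinner_add_right cinner_scaleR_right cinner_cJ_right complex_eq_iff)

lemma norm_cscale: "norm (cscale c x) = cmod c * norm (x :: 'a::real_inner \<times> 'a)"
proof -
  have "(norm (cscale c x))\<^sup>2 = ((Re c)\<^sup>2 + (Im c)\<^sup>2) * (norm x)\<^sup>2"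
    unfolding power2_norm_eq_inner
    by (simp add: cscale_def inner_add inner_cJ_self inner_cJ_cJ inner_commute[of "cJ x" x] power2_eq_square algebra_simps)
  then have "(norm (cscale c x))\<^sup>2 = (cmod c * norm x)\<^sup>2" by (simp add: power_mult_distrib cmod_power2)
  then show ?thesis by (simp add: power2_eq_iff_nonneg)
qed

lemma cmod_cinner_le: "cmod (cinner x y) \<le> norm x * norm y"
proof -
  define c where "c = cinner x y"
  have "(cmod c)\<^sup>2 = Re (cinner (cscale (cnj c) x) y)"
    unfolding cmod_power2 by (simp add: cinner_cscale_left c_def[symmetric] power2_eq_square)
  also have "\<dots> \<le> norm (cscale (cnj c) x) * norm y" by (simp add: Re_cinner norm_cauchy_schwarz)
  finally have "cmod c * cmod c \<le> cmod c * (norm x * norm y)" by (simp add: norm_cscale power2_eq_square)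
  then show ?thesis unfolding c_def[symmetric] by (cases "cmod c = 0") auto
qed

lemma cinner_self: "cinner x x = of_real ((norm x)\<^sup>2)"
  by (simp add: complex_eq_iff Re_cinner Im_cinner inner_cJ_self power2_norm_eq_inner)

lemma cinner_eq_on_dense:
  assumes "closure D = UNIV" "\<And>d. d \<in> D \<Longrightarrow> cinner x d = cinner y d"
  shows "x = y"
  by (rule inner_eq_on_dense[OF assms(1)]) (metis Re_cinner assms(2))

lemma bounded_linear_cinner_left: "bounded_linear (\<lambda>x. cinner x y)"
  by (rule bounded_linear_intro[where K = "norm y"])
    (auto simp: cinner_add_left cinner_scaleR_left cmod_cinner_le scaleR_conv_of_real)

lemma bounded_linear_cinner_right: "bounded_linear (\<lambda>y. cinner x y)"
  by (rule bounded_linear_intro[where K = "norm x"])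
    (auto simp: cinner_add_right cinner_scaleR_right scaleR_conv_of_real mult.commute[of _ "norm x"] cmod_cinner_le)

lemmas tendsto_cinner_left = bounded_linear.tendsto[OF bounded_linear_cinner_left]
lemmas tendsto_cinner_right = bounded_linear.tendsto[OF bounded_linear_cinner_right]

definition complex_linear :: "('a::real_normed_vector \<times> 'a \<Rightarrow> 'b::real_normed_vector \<times> 'b) \<Rightarrow> bool" where
  "complex_linear f \<longleftrightarrow> bounded_linear f \<and> (\<forall>x. f (cJ x) = cJ (f x))"

lemma complex_linearD:
  assumes "complex_linear f"
  shows "bounded_linear f" "f (cJ x) = cJ (f x)" "f (cscale c x) = cscale c (f x)"
    "f (x + y) = f x + f y" "f (x - y) = f x - f y" "f (r *\<^sub>R x) = r *\<^sub>R f x"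
proof -
  show bl: "bounded_linear f" and J: "f (cJ x) = cJ (f x)" for x using assms unfolding complex_linear_def by blast+
  interpret bounded_linear f by (rule bl)
  show "f (cscale c x) = cscale c (f x)" by (simp add: cscale_def add scale J)
  show "f (x + y) = f x + f y" "f (x - y) = f x - f y" "f (r *\<^sub>R x) = r *\<^sub>R f x" by (simp_all add: add diff scale)
qed

lemma complex_linear_compose:
  "complex_linear f \<Longrightarrow> complex_linear g \<Longrightarrow> complex_linear (\<lambda>x. f (g x))"
  unfolding complex_linear_def using bounded_linear_compose[of f g] by metis

lemma cinner_adjoint:
  fixes f :: "'a::{real_inner,banach} \<times> 'a \<Rightarrow> 'b::{real_inner,banach} \<times> 'b"
  assumes "complex_linear f"
  shows "cinner (f x) y = cinner x (adjoint f y)"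
proof -
  note bl = complex_linearD(1)[OF assms]
  have "f x \<bullet> cJ y = - (f (cJ x) \<bullet> y)" by (simp add: inner_cJ_right complex_linearD(2)[OF assms])
  also have "\<dots> = x \<bullet> cJ (adjoint f y)" by (simp add: adjoint_hilbert[OF bl] inner_cJ_right)
  finally show ?thesis by (simp add: complex_eq_iff Re_cinner Im_cinner adjoint_hilbert[OF bl])
qed

lemma complex_linear_adjoint:
  fixes f :: "'a::{real_inner,banach} \<times> 'a \<Rightarrow> 'b::{real_inner,banach} \<times> 'b"
  assumes "complex_linear f"
  shows "complex_linear (adjoint f)"
  unfolding complex_linear_def
proof (intro conjI allI)
  show "bounded_linear (adjoint f)" by (rule bounded_linear_adjoint[OF complex_linearD(1)[OF assms]])
  have *: "cinner (adjoint f v) d = cinner v (f d)" for v d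
    by (metis cinner_commute cinner_adjoint[OF assms])
  show "adjoint f (cJ y) = cJ (adjoint f y)" for y
    by (rule cinner_eq_on_dense[where D = UNIV]) (simp_all add: * cinner_cJ_left)
qed

lemma riesz_conjugate_linear:
  fixes \<phi> :: "'a::{real_inner,banach} \<times> 'a \<Rightarrow> complex"
  assumes add: "\<And>x y. \<phi> (x + y) = \<phi> x + \<phi> y" and scaleR: "\<And>r x. \<phi> (r *\<^sub>R x) = of_real r * \<phi> x"
    and J: "\<And>x. \<phi> (cJ x) = - \<i> * \<phi> x" and bound: "\<And>x. cmod (\<phi> x) \<le> C * norm x"
  obtains u where "\<And>x. cinner u x = \<phi> x"
proof -
  have "bounded_linear (\<lambda>x. Re (\<phi> x))"
    by (rule bounded_linear_intro[where K = C])
      (use bound abs_Re_le_cmod order_trans in \<open>auto simp: add scaleR mult.commute[of _ C] intro: order_trans\<close>)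
  then obtain u where u: "\<And>x. Re (\<phi> x) = u \<bullet> x" using riesz_representation by blast
  have "cinner u x = \<phi> x" for x
    by (simp add: complex_eq_iff Re_cinner Im_cinner u[symmetric] J)
  then show thesis by (rule that)
qed

lemma complex_riesz_on_dense:
  fixes \<phi> :: "'d::real_vector \<Rightarrow> complex" and V :: "'d \<Rightarrow> 'a::{real_inner,banach} \<times> 'a"
  assumes D: "subspace D"
    and V: "\<And>x y. x \<in> D \<Longrightarrow> y \<in> D \<Longrightarrow> V (x + y) = V x + V y" "\<And>c x. x \<in> D \<Longrightarrow> V (c *\<^sub>R x) = c *\<^sub>R V x"
    and I: "\<And>x. x \<in> D \<Longrightarrow> I x \<in> D" "\<And>x. x \<in> D \<Longrightarrow> V (I x) = cJ (V x)"
    and add: "\<And>x y. x \<in> D \<Longrightarrow> y \<in> D \<Longrightarrow> \<phi> (x + y) = \<phi> x + \<phi> y"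
    and scaleR: "\<And>r x. x \<in> D \<Longrightarrow> \<phi> (r *\<^sub>R x) = of_real r * \<phi> x"
    and J: "\<And>x. x \<in> D \<Longrightarrow> \<phi> (I x) = - \<i> * \<phi> x" and bound: "\<And>x. x \<in> D \<Longrightarrow> cmod (\<phi> x) \<le> C * norm (V x)"
  obtains u where "\<And>x. x \<in> D \<Longrightarrow> cinner u (V x) = \<phi> x"
proof -
  have "\<exists>u\<in>closure (V ` D). \<forall>x\<in>D. Re (\<phi> x) = u \<bullet> V x"
  proof (rule riesz_via_minimization[OF D V, where C = C])
    show "Re (\<phi> x) \<le> C * norm (V x)" if "x \<in> D" for x
      using bound[OF that] abs_Re_le_cmod[of "\<phi> x"] by linarith
  qed (auto simp: add scaleR)
  then obtain u where u: "\<And>x. x \<in> D \<Longrightarrow> Re (\<phi> x) = u \<bullet> V x" by blast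
  have "cinner u (V x) = \<phi> x" if x: "x \<in> D" for x
    using u[OF x] u[OF I(1)[OF x]] I(2)[OF x] J[OF x] by (simp add: complex_eq_iff Re_cinner Im_cinner)
  then show thesis by (rule that)
qed

text \<open>A sector of half-angle \<open>arctan m\<close>, described by linear inequalities.\<close>

definition slope_cone :: "real \<Rightarrow> complex set" where
  "slope_cone m = {z. \<bar>Im z\<bar> < m * Re z}"

lemma open_cone: "open (slope_cone m)"
  unfolding slope_cone_def by (intro open_Collect_less continuous_intros)

lemma cone_add: "z \<in> slope_cone m \<Longrightarrow> w \<in> slope_cone m \<Longrightarrow> z + w \<in> slope_cone m"
  by (auto simp: slope_cone_def distrib_left)

lemma cone_Re_pos: "m > 0 \<Longrightarrow> z \<in> slope_cone m \<Longrightarrow> Re z > 0"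
  by (auto simp: slope_cone_def zero_less_mult_iff dest: order.strict_trans1[OF abs_ge_zero])

lemma cone_cnj [simp]: "cnj z \<in> slope_cone m \<longleftrightarrow> z \<in> slope_cone m"
  by (simp add: slope_cone_def)

lemma cone_of_real: "m > 0 \<Longrightarrow> complex_of_real t \<in> slope_cone m \<longleftrightarrow> t > 0"
  by (simp add: slope_cone_def zero_less_mult_iff)

lemma cone_scale: "t > 0 \<Longrightarrow> of_real t * z \<in> slope_cone m \<longleftrightarrow> z \<in> slope_cone m"
  by (simp add: slope_cone_def abs_mult)

lemma cone_mono: "m \<le> m' \<Longrightarrow> m > 0 \<Longrightarrow> z \<in> slope_cone m \<Longrightarrow> z \<in> slope_cone m'"
  using cone_Re_pos[of m z] by (auto simp: slope_cone_def intro: order.strict_trans2[OF _ mult_right_mono])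

lemma sector_eq_cone:
  assumes "0 < \<delta>" "\<delta> < pi / 2"
  shows "sector \<delta> = slope_cone (tan \<delta>)"
proof (intro set_eqI iffI)
  have tan: "tan \<delta> > 0" using assms by (simp add: tan_gt_zero)
  have key: "\<bar>Arg z\<bar> < \<delta> \<longleftrightarrow> \<bar>Im z\<bar> < tan \<delta> * Re z" if "Re z > 0" for z
  proof -
    have "\<bar>Arg z\<bar> = arctan \<bar>Im z / Re z\<bar>"
      using that by (simp add: arg_conv_arctan abs_if arctan_minus[symmetric])
    then have "\<bar>Arg z\<bar> < \<delta> \<longleftrightarrow> arctan \<bar>Im z / Re z\<bar> < arctan (tan \<delta>)" using assms by (simp add: arctan_tan)
    also have "\<dots> \<longleftrightarrow> \<bar>Im z / Re z\<bar> < tan \<delta>" by (simp only: arctan_less_iff)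
    also have "\<dots> \<longleftrightarrow> \<bar>Im z\<bar> < tan \<delta> * Re z" using that by (simp add: abs_divide pos_divide_less_eq)
    finally show ?thesis .
  qed
  fix z
  show "z \<in> slope_cone (tan \<delta>)" if "z \<in> sector \<delta>"
  proof -
    have "z \<noteq> 0" "\<bar>Arg z\<bar> < \<delta>" using that by (auto simp: sector_def)
    then have "Re z > 0" using Arg_Re_pos[of z] assms by auto
    then show ?thesis using key \<open>\<bar>Arg z\<bar> < \<delta>\<close> by (simp add: slope_cone_def)
  qed
  show "z \<in> sector \<delta>" if "z \<in> slope_cone (tan \<delta>)"
  proof -
    have "Re z > 0" by (rule cone_Re_pos[OF tan that])
    then show ?thesis using key[of z] that by (auto simp: slope_cone_def sector_def)
  qed
qed

text \<open>Cauchy's estimates for the scalar functions \<open>z \<mapsto> \<langle>F z, y\<rangle>\<close> are uniform for \<open>y\<close> in the unit ball. Hence the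
scalar derivatives are represented by a vector \<open>d\<close>, and the second order Taylor remainder, tested
against the difference \<open>q\<close> of difference quotient and \<open>d\<close> itself, shows that \<open>|q| = O(|w - z|)\<close>.\<close>

lemma weakly_holomorphic_imp_holomorphic_into:
  fixes F :: "complex \<Rightarrow> 'a::{real_inner,banach} \<times> 'a"
  assumes U: "open U" and hol: "\<And>y. (\<lambda>z. cinner (F z) y) holomorphic_on U"
    and bdd: "\<And>z. z \<in> U \<Longrightarrow> norm (F z) \<le> C"
  shows "holomorphic_into complexify F U"
  unfolding holomorphic_into_def complexify_simps
proof
  fix z assume z: "z \<in> U"
  obtain r where r: "r > 0" "cball z (2 * r) \<subseteq> U"
  proof -
    obtain e where "e > 0" "cball z e \<subseteq> U" using U z open_contains_cball by blast
    then show thesis using that[of "e / 2"] by simp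
  qed
  have C0: "C \<ge> 0" using order_trans[OF norm_ge_zero bdd[OF z]] .
  define f where "f y w = cinner (F w) y" for y w
  have hf: "f y holomorphic_on U" for y unfolding f_def by (rule hol)
  have fb: "cmod (f y w) \<le> C * norm y" if "w \<in> U" for y w
    unfolding f_def using cmod_cinner_le[of "F w" y] mult_right_mono[OF bdd[OF that] norm_ge_zero[of y]] by linarith
  have cauchy: "cmod ((deriv ^^ n) (f y) w) \<le> fact n * (C * norm y) / r ^ n" if w: "w \<in> cball z r" for y w n
  proof (rule Cauchy_inequality)
    have sub: "cball w r \<subseteq> U"
    proof
      fix v assume "v \<in> cball w r"
      then have "dist z v \<le> 2 * r" using w dist_triangle[of z v w] by (simp add: dist_commute)
      then show "v \<in> U" using r by auto
    qed
    show "f y holomorphic_on ball w r" by (rule holomorphic_on_subset[OF hf]) (use sub in auto)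
    show "continuous_on (cball w r) (f y)"
      by (rule holomorphic_on_imp_continuous_on[OF holomorphic_on_subset[OF hf sub]])
    show "0 < r" by (rule r)
    show "cmod (f y x) \<le> C * norm y" if "cmod (w - x) = r" for x
      using sub that by (intro fb) (auto simp: dist_norm)
  qed
  have zU: "ball z r \<subseteq> U" using r by (force simp: subset_iff)
  have der: "(f y has_field_derivative deriv (f y) w) (at w)" if "w \<in> U" for y w
    by (rule holomorphic_derivI[OF hf U that])
  have rem: "cmod (f y w - f y z - deriv (f y) z * (w - z)) \<le> 2 * C / r\<^sup>2 * norm y * (cmod (w - z))\<^sup>2"
    if w: "w \<in> ball z r" for y w
  proof -
    have "cmod ((deriv ^^ 0) (f y) w - (\<Sum>i\<le>1. (deriv ^^ i) (f y) z * (w - z) ^ i / (fact i)))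
      \<le> 2 * C / r\<^sup>2 * norm y * cmod (w - z) ^ Suc 1 / fact 1"
    proof (rule complex_Taylor[where S = "ball z r" and f = "\<lambda>i. (deriv ^^ i) (f y)" and n = 1])
      show "((deriv ^^ i) (f y) has_field_derivative (deriv ^^ Suc i) (f y) x) (at x within ball z r)"
        if "x \<in> ball z r" for i x
      proof -
        have "(deriv ^^ i) (f y) holomorphic_on U" by (rule holomorphic_higher_deriv[OF hf U])
        from holomorphic_derivI[OF this U, of x] that zU
        show ?thesis by (auto intro: has_field_derivative_at_within)
      qed
      show "cmod ((deriv ^^ Suc 1) (f y) x) \<le> 2 * C / r\<^sup>2 * norm y" if "x \<in> ball z r" for x
        using cauchy[of x "Suc 1" y] that by (simp add: power2_eq_square numeral_2_eq_2 dist_commute)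
    qed (use w r in auto)
    then show ?thesis by (simp add: power2_eq_square algebra_simps)
  qed
  have fadd: "f (x + y) = (\<lambda>w. f x w + f y w)" for x y by (simp add: f_def cinner_add_right fun_eq_iff)
  have fscale: "f (a *\<^sub>R y) = (\<lambda>w. of_real a * f y w)" for a y by (simp add: f_def cinner_scaleR_right fun_eq_iff)
  have fJ: "f (cJ y) = (\<lambda>w. - \<i> * f y w)" for y by (simp add: f_def cinner_cJ_right fun_eq_iff)
  obtain d where d: "\<And>y. cinner d y = deriv (f y) z"
  proof (rule riesz_conjugate_linear[where \<phi> = "\<lambda>y. deriv (f y) z" and C = "C / r"])
    show "deriv (f (x + y)) z = deriv (f x) z + deriv (f y) z" for x y
      unfolding fadd by (intro DERIV_imp_deriv DERIV_add der z)
    show "deriv (f (a *\<^sub>R y)) z = of_real a * deriv (f y) z" for a y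
      unfolding fscale by (intro DERIV_imp_deriv DERIV_cmult der z)
    show "deriv (f (cJ y)) z = - \<i> * deriv (f y) z" for y
      unfolding fJ by (intro DERIV_imp_deriv DERIV_cmult der z)
    show "cmod (deriv (f y) z) \<le> C / r * norm y" for y using cauchy[of z 1 y] r by simp
  qed blast
  have est: "norm (cscale (1 / (w - z)) (F w - F z) - d) \<le> 2 * C / r\<^sup>2 * cmod (w - z)"
    if w: "w \<in> ball z r" "w \<noteq> z" for w
  proof (rule norm_le_if_inner_le)
    define q where "q = cscale (1 / (w - z)) (F w - F z) - d"
    have "q \<bullet> q = Re (cinner q q)" by (simp add: Re_cinner)
    also have "cinner q q = (f q w - f q z - deriv (f q) z * (w - z)) / (w - z)"
      using w by (subst (1) q_def) (simp add: cinner_diff_left cinner_cscale_left d f_def field_simps)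
    also have "Re \<dots> \<le> cmod \<dots>" by (rule complex_Re_le_cmod)
    also have "\<dots> \<le> 2 * C / r\<^sup>2 * norm q * (cmod (w - z))\<^sup>2 / cmod (w - z)"
      unfolding norm_divide using rem[OF w(1)] by (rule divide_right_mono) simp
    also have "\<dots> = 2 * C / r\<^sup>2 * cmod (w - z) * norm q" using w by (simp add: power2_eq_square)
    finally show "(cscale (1 / (w - z)) (F w - F z) - d) \<bullet> (cscale (1 / (w - z)) (F w - F z) - d)
      \<le> 2 * C / r\<^sup>2 * cmod (w - z) * norm (cscale (1 / (w - z)) (F w - F z) - d)"
      unfolding q_def .
  qed (use C0 in auto)
  have "((\<lambda>w. norm (cscale (1 / (w - z)) (F w - F z) - d)) \<longlongrightarrow> 0) (at z)"
  proof (rule tendsto_sandwich[OF _ _ tendsto_const])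
    show "\<forall>\<^sub>F w in at z. norm (cscale (1 / (w - z)) (F w - F z) - d) \<le> 2 * C / r\<^sup>2 * cmod (w - z)"
      using est r(1) by (auto simp: eventually_at dist_commute intro!: exI[where x = r])
    have "((\<lambda>w. 2 * C / r\<^sup>2 * cmod (w - z)) \<longlongrightarrow> 2 * C / r\<^sup>2 * cmod (z - z)) (at z)"
      by (intro tendsto_intros)
    then show "((\<lambda>w. 2 * C / r\<^sup>2 * cmod (w - z)) \<longlongrightarrow> 0) (at z)" by simp
  qed auto
  then show "\<exists>d\<in>UNIV. ((\<lambda>w. norm (cscale (1 / (w - z)) (F w - F z) - d)) \<longlongrightarrow> 0) (at z)" by blast
qed

lemma holomorphic_into_imp_weakly:
  fixes F :: "complex \<Rightarrow> 'a::{real_inner,banach} \<times> 'a"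
  assumes "holomorphic_into complexify F U" "open U"
  shows "(\<lambda>z. cinner (F z) y) holomorphic_on U"
proof -
  have "(\<lambda>z. cinner (F z) y) field_differentiable (at z)" if z: "z \<in> U" for z
  proof -
    obtain d where "((\<lambda>w. norm (cscale (1 / (w - z)) (F w - F z) - d)) \<longlongrightarrow> 0) (at z)"
      using assms z by (auto simp: holomorphic_into_def complexify_simps)
    then have "((\<lambda>w. cscale (1 / (w - z)) (F w - F z)) \<longlongrightarrow> d) (at z)"
      by (simp add: tendsto_norm_zero_iff LIM_zero_iff)
    then have "((\<lambda>w. cinner (cscale (1 / (w - z)) (F w - F z)) y) \<longlongrightarrow> cinner d y) (at z)"
      by (rule tendsto_cinner_left)
    then have "((\<lambda>w. (cinner (F w) y - cinner (F z) y) / (w - z)) \<longlongrightarrow> cinner d y) (at z)"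
      by (simp add: cinner_cscale_left cinner_diff_left)
    then show ?thesis by (auto simp: field_differentiable_def has_field_derivative_iff)
  qed
  then show ?thesis by (auto simp: holomorphic_on_def intro: field_differentiable_at_within)
qed

lemma holomorphic_into_imp_isCont:
  fixes F :: "complex \<Rightarrow> 'a::{real_inner,banach} \<times> 'a"
  assumes "holomorphic_into complexify F U" "z \<in> U"
  shows "isCont F z"
proof -
  obtain d where "((\<lambda>w. norm (cscale (1 / (w - z)) (F w - F z) - d)) \<longlongrightarrow> 0) (at z)"
    using assms by (auto simp: holomorphic_into_def complexify_simps)
  then have "((\<lambda>w. cscale (1 / (w - z)) (F w - F z)) \<longlongrightarrow> d) (at z)"
    by (simp add: tendsto_norm_zero_iff LIM_zero_iff)
  then have "((\<lambda>w. cmod (w - z) * norm (cscale (1 / (w - z)) (F w - F z))) \<longlongrightarrow> cmod (z - z) * norm d) (at z)"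
    by (intro tendsto_intros)
  then have "((\<lambda>w. norm (F w - F z)) \<longlongrightarrow> 0) (at z)"
    by (simp only: norm_cscale diff_self norm_zero mult_zero_left)
      (erule Lim_transform_eventually, auto simp: norm_divide eventually_at intro!: exI[where x = 1])
  then show ?thesis by (simp add: isCont_def tendsto_norm_zero_iff LIM_zero_iff)
qed

lemma bounded_linear_eq_on_dense:
  assumes "bounded_linear f" "bounded_linear g" "closure D = UNIV" "\<And>x. x \<in> D \<Longrightarrow> f x = g x"
  shows "f x = g x"
proof -
  have "closed {x. f x = g x}"
    by (intro closed_Collect_eq linear_continuous_on assms bounded_linear.continuous_on[OF _ continuous_on_id])
  then have "closure D \<subseteq> {x. f x = g x}" by (rule closure_minimal[rotated]) (use assms(4) in auto)
  then show ?thesis using assms(3) by auto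
qed

lemma norm_le_on_dense:
  fixes u :: "'a::real_inner"
  assumes "closure D = UNIV" "\<And>d. d \<in> D \<Longrightarrow> u \<bullet> d \<le> c * norm d" "c \<ge> 0"
  shows "norm u \<le> c"
proof (rule norm_le_if_inner_le)
  have "closed {d. u \<bullet> d \<le> c * norm d}" by (intro closed_Collect_le continuous_intros)
  then have "closure D \<subseteq> {d. u \<bullet> d \<le> c * norm d}" by (rule closure_minimal[rotated]) (use assms(2) in auto)
  then show "u \<bullet> u \<le> c * norm u" using assms(1) by auto
qed (rule assms)

section \<open>Semigroups generated by a sectorial form\<close>

text \<open>A contractive holomorphic semigroup \<open>T\<close> on a cone, generated by \<open>V\<^sup>* B V\<close> in the weak sense
\<open>form\<close>. The operator \<open>V\<close> is given on a dense subspace \<open>D\<close> that is invariant under \<open>T(t)\<close> for real \<open>t\<close>. The identity \<open>dissipative\<close> makes \<open>- B\<close> coercive.\<close>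

locale form_semigroup =
  fixes T :: "complex \<Rightarrow> 'k::{real_inner,banach} \<times> 'k \<Rightarrow> 'k \<times> 'k" and m :: real
    and D :: "('k \<times> 'k) set" and V :: "'k \<times> 'k \<Rightarrow> 'h::{real_inner,banach} \<times> 'h"
    and B :: "'h \<times> 'h \<Rightarrow> 'h \<times> 'h"
  assumes m: "m > 0"
    and T_linear: "\<And>z. z \<in> slope_cone m \<Longrightarrow> complex_linear (T z)"
    and T_contraction: "\<And>z x. z \<in> slope_cone m \<Longrightarrow> norm (T z x) \<le> norm x"
    and T_add: "\<And>z w x. z \<in> slope_cone m \<Longrightarrow> w \<in> slope_cone m \<Longrightarrow> T (z + w) x = T z (T w x)"
    and T_holomorphic: "\<And>x y. (\<lambda>z. cinner (T z x) y) holomorphic_on slope_cone m"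
    and T_at_0: "\<And>x y. ((\<lambda>z. cinner (T z x) y) \<longlongrightarrow> cinner x y) (at 0 within slope_cone m)"
    and D_subspace: "subspace D" and D_dense: "closure D = UNIV" and D_cJ: "\<And>x. x \<in> D \<Longrightarrow> cJ x \<in> D"
    and V_add: "\<And>x y. x \<in> D \<Longrightarrow> y \<in> D \<Longrightarrow> V (x + y) = V x + V y"
    and V_scaleR: "\<And>c x. x \<in> D \<Longrightarrow> V (c *\<^sub>R x) = c *\<^sub>R V x"
    and V_cJ: "\<And>x. x \<in> D \<Longrightarrow> V (cJ x) = cJ (V x)"
    and V_dense: "closure (V ` D) = UNIV"
    and T_D: "\<And>t x. t > 0 \<Longrightarrow> x \<in> D \<Longrightarrow> T (of_real t) x \<in> D"
    and V_at_0: "\<And>x. x \<in> D \<Longrightarrow> ((\<lambda>t. V (T (of_real t) x)) \<longlongrightarrow> V x) (at_right 0)"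
    and T_Lipschitz: "\<And>x. x \<in> D \<Longrightarrow> \<exists>c. \<forall>t>0. norm (T (of_real t) x - x) \<le> c * t"
    and B_linear: "complex_linear B"
    and form: "\<And>x y t. x \<in> D \<Longrightarrow> y \<in> D \<Longrightarrow> t > 0 \<Longrightarrow>
      ((\<lambda>t. cinner (T (of_real t) x) y) has_vector_derivative cinner (B (V (T (of_real t) x))) (V y)) (at t)"
    and dissipative: "\<And>h. B h \<bullet> h = - (norm h)\<^sup>2 / 2"
begin

text \<open>The sesquilinear form \<open>\<langle>T'(z) x, y\<rangle>\<close>, that is, \<open>\<langle>B V T(z) x, V y\<rangle>\<close> for suitable \<open>x\<close> and \<open>y\<close>.\<close>

definition dT :: "complex \<Rightarrow> 'k \<times> 'k \<Rightarrow> 'k \<times> 'k \<Rightarrow> complex" where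
  "dT z x y = deriv (\<lambda>z. cinner (T z x) y) z"

lemma cone_real: "t > 0 \<Longrightarrow> complex_of_real t \<in> slope_cone m"
  using cone_of_real[OF m] by simp

lemma dT_derivative:
  "z \<in> slope_cone m \<Longrightarrow> ((\<lambda>z. cinner (T z x) y) has_field_derivative dT z x y) (at z)"
  unfolding dT_def by (rule holomorphic_derivI[OF T_holomorphic open_cone])

lemma dT_unique:
  assumes "z \<in> slope_cone m" "(f has_field_derivative c) (at z)" "\<And>z. z \<in> slope_cone m \<Longrightarrow> f z = cinner (T z x) y"
  shows "dT z x y = c"
  by (rule DERIV_unique[OF dT_derivative[OF assms(1)] has_field_derivative_transform_within_open[OF assms(2) open_cone assms(1,3)]])

lemma dT_add_left: "z \<in> slope_cone m \<Longrightarrow> dT z (x + y) u = dT z x u + dT z y u"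
  by (rule dT_unique[OF _ DERIV_add[OF dT_derivative dT_derivative]])
    (auto simp: complex_linearD[OF T_linear] cinner_add_left)

lemma dT_scaleR_left: "z \<in> slope_cone m \<Longrightarrow> dT z (r *\<^sub>R x) u = r *\<^sub>R dT z x u"
  unfolding scaleR_conv_of_real
  by (rule dT_unique[OF _ DERIV_cmult[OF dT_derivative]])
    (auto simp: complex_linearD[OF T_linear] cinner_scaleR_left)

lemma dT_add_right: "z \<in> slope_cone m \<Longrightarrow> dT z u (x + y) = dT z u x + dT z u y"
  by (rule dT_unique[OF _ DERIV_add[OF dT_derivative dT_derivative]]) (auto simp: cinner_add_right)

lemma dT_scaleR_right: "z \<in> slope_cone m \<Longrightarrow> dT z u (r *\<^sub>R x) = r *\<^sub>R dT z u x"
  unfolding scaleR_conv_of_real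
  by (rule dT_unique[OF _ DERIV_cmult[OF dT_derivative]]) (auto simp: cinner_scaleR_right)

lemma dT_shift:
  assumes z: "z \<in> slope_cone m" and w: "w \<in> slope_cone m"
  shows "dT z (T w x) y = dT (z + w) x y"
proof (rule dT_unique[OF z])
  show "((\<lambda>z. cinner (T (z + w) x) y) has_field_derivative dT (z + w) x y) (at z)"
    using dT_derivative[OF cone_add[OF z w], of x y] by (simp add: DERIV_shift)
qed (simp add: T_add w)

lemma cmod_cinner_T_le: "z \<in> slope_cone m \<Longrightarrow> cmod (cinner (T z x) y) \<le> norm x * norm y"
  using cmod_cinner_le[of "T z x" y] mult_right_mono[OF T_contraction[of z x] norm_ge_zero[of y]] by linarith

lemma dT_bounded:
  assumes z: "z \<in> slope_cone m"
  shows "\<exists>C\<ge>0. \<forall>x y. cmod (dT z x y) \<le> C * norm x * norm y"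
proof -
  obtain r where r: "r > 0" "cball z r \<subseteq> slope_cone m" using open_cone z open_contains_cball by blast
  have "cmod (dT z x y) \<le> 1 / r * norm x * norm y" for x y
  proof -
    have "cmod ((deriv ^^ 1) (\<lambda>z. cinner (T z x) y) z) \<le> fact 1 * (norm x * norm y) / r ^ 1"
    proof (rule Cauchy_inequality)
      show "(\<lambda>z. cinner (T z x) y) holomorphic_on ball z r"
        by (rule holomorphic_on_subset[OF T_holomorphic]) (use r in auto)
      show "continuous_on (cball z r) (\<lambda>z. cinner (T z x) y)"
        by (rule holomorphic_on_imp_continuous_on[OF holomorphic_on_subset[OF T_holomorphic r(2)]])
      show "cmod (cinner (T w x) y) \<le> norm x * norm y" if "cmod (z - w) = r" for w
        using r that by (intro cmod_cinner_T_le) (auto simp: dist_norm)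
    qed (rule r)
    then show ?thesis by (simp add: dT_def)
  qed
  then show ?thesis using r by (intro exI[where x = "1 / r"]) simp
qed

lemma bounded_linear_dT:
  assumes z: "z \<in> slope_cone m"
  shows bounded_linear_dT_left: "bounded_linear (\<lambda>x. dT z x y)"
    and bounded_linear_dT_right: "bounded_linear (\<lambda>y. dT z x y)"
proof -
  obtain C where C: "\<And>x y. cmod (dT z x y) \<le> C * norm x * norm y" using dT_bounded[OF z] by blast
  have "norm (dT z u y) \<le> norm u * (C * norm y)" "norm (dT z x u) \<le> norm u * (C * norm x)" for u
    using C[of u y] C[of x u] by (simp_all add: ac_simps)
  note b = this
  show "bounded_linear (\<lambda>x. dT z x y)"
    by (rule bounded_linear_intro[OF _ _ b(1)]) (simp_all add: dT_add_left[OF z] dT_scaleR_left[OF z])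
  show "bounded_linear (\<lambda>y. dT z x y)"
    by (rule bounded_linear_intro[OF _ _ b(2)]) (simp_all add: dT_add_right[OF z] dT_scaleR_right[OF z])
qed

lemma dT_form:
  assumes "t > 0" "x \<in> D" "y \<in> D"
  shows "cinner (B (V (T (of_real t) x))) (V y) = dT (of_real t) x y"
proof -
  have "((\<lambda>t. cinner (T (of_real t) x) y) has_vector_derivative dT (of_real t) x y) (at t)"
    by (rule has_vector_derivative_real_field[OF dT_derivative[OF cone_real[OF assms(1)]]])
  then show ?thesis using form[OF assms(2,3,1)] vector_derivative_unique_at by blast
qed

lemma norm_sq_via_form: "(norm h)\<^sup>2 = - 2 * Re (cinner (B h) h)"
  using dissipative[of h] by (simp add: Re_cinner)

text \<open>The smoothing effect of an analytic semigroup: \<open>|V T(t) x|\<^sup>2\<close> is, up to sign and a factor \<open>2\<close>, the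
real part of \<open>\<langle>T'(t) x, T(t) x\<rangle>\<close>, and \<open>T'(t)\<close> is bounded.\<close>

lemma V_T_bounded:
  assumes t: "t > 0"
  shows "\<exists>C. \<forall>x\<in>D. norm (V (T (of_real t) x)) \<le> C * norm x"
proof -
  obtain C where C: "C \<ge> 0" "\<And>x y. cmod (dT (of_real t) x y) \<le> C * norm x * norm y"
    using dT_bounded[OF cone_real[OF t]] by blast
  have "norm (V (T (of_real t) x)) \<le> sqrt (2 * C) * norm x" if x: "x \<in> D" for x
  proof -
    have "(norm (V (T (of_real t) x)))\<^sup>2 = - 2 * Re (dT (of_real t) x (T (of_real t) x))"
      by (simp add: norm_sq_via_form dT_form[OF t x T_D[OF t x]])
    also have "\<dots> \<le> 2 * cmod (dT (of_real t) x (T (of_real t) x))"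
      using abs_Re_le_cmod[of "dT (of_real t) x (T (of_real t) x)"] by linarith
    also have "\<dots> \<le> 2 * (C * norm x * norm (T (of_real t) x))" using C(2) by simp
    also have "\<dots> \<le> 2 * (C * norm x * norm x)"
      using C(1) T_contraction[OF cone_real[OF t]] by (intro mult_left_mono) auto
    also have "\<dots> = (sqrt (2 * C) * norm x)\<^sup>2" using C(1) by (simp add: power_mult_distrib power2_eq_square[of "norm x"])
    finally show ?thesis by (rule power2_le_imp_le) (use C in simp)
  qed
  then show ?thesis by blast
qed

text \<open>The bounded extension of \<open>V \<circ> T t\<close> from \<open>D\<close> to the whole space, for real \<open>t\<close>.\<close>

definition VT0 :: "real \<Rightarrow> 'k \<times> 'k \<Rightarrow> 'h \<times> 'h" where
  "VT0 t = (SOME VT. complex_linear VT \<and> (\<forall>x\<in>D. VT x = V (T (of_real t) x)))"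

lemma VT0:
  assumes t: "t > 0"
  shows VT0_linear: "complex_linear (VT0 t)" and VT0_D: "x \<in> D \<Longrightarrow> VT0 t x = V (T (of_real t) x)"
proof -
  note lin = complex_linearD[OF T_linear[OF cone_real[OF t]]]
  obtain C where C: "\<And>x. x \<in> D \<Longrightarrow> norm (V (T (of_real t) x)) \<le> C * norm x" using V_T_bounded[OF t] by blast
  obtain VT where VT: "bounded_linear VT" "\<And>x. x \<in> D \<Longrightarrow> VT x = V (T (of_real t) x)"
    by (rule extend_bounded_linear[OF D_subspace D_dense, where V = "\<lambda>x. V (T (of_real t) x)" and C = C])
      (auto simp: lin V_add V_scaleR T_D[OF t] C)
  have "VT (cJ x) = cJ (VT x)" for x
    by (rule bounded_linear_eq_on_dense[OF bounded_linear_compose[OF VT(1) bounded_linear_cJ]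
          bounded_linear_compose[OF bounded_linear_cJ VT(1)] D_dense])
      (simp add: VT(2) D_cJ lin V_cJ T_D[OF t])
  then have "complex_linear VT \<and> (\<forall>x\<in>D. VT x = V (T (of_real t) x))"
    using VT unfolding complex_linear_def by blast
  then have "complex_linear (VT0 t) \<and> (\<forall>x\<in>D. VT0 t x = V (T (of_real t) x))"
    unfolding VT0_def
    by (rule someI[where P = "\<lambda>VT. complex_linear VT \<and> (\<forall>x\<in>D. VT x = V (T (of_real t) x))"])
  then show "complex_linear (VT0 t)" and "x \<in> D \<Longrightarrow> VT0 t x = V (T (of_real t) x)" by simp_all
qed

lemma VT0_add:
  assumes t: "t > 0" and s: "s > 0"
  shows "VT0 (t + s) x = VT0 t (T (of_real s) x)"
proof (rule bounded_linear_eq_on_dense[OF _ _ D_dense, where f = "VT0 (t + s)"])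
  show "bounded_linear (VT0 (t + s))" using t s by (intro complex_linearD(1) VT0_linear) simp
  show "bounded_linear (\<lambda>x. VT0 t (T (of_real s) x))"
    by (rule bounded_linear_compose[OF complex_linearD(1)[OF VT0_linear[OF t]] complex_linearD(1)[OF T_linear[OF cone_real[OF s]]]])
  show "VT0 (t + s) x = VT0 t (T (of_real s) x)" if "x \<in> D" for x
    using that t s T_add[OF cone_real[OF t] cone_real[OF s], of x] by (simp add: VT0_D T_D)
qed

lemma cone_minus_real:
  assumes "z \<in> slope_cone m"
  shows "\<exists>s>0. z - of_real s \<in> slope_cone m"
proof -
  define s where "s = (m * Re z - \<bar>Im z\<bar>) / (2 * m)"
  have "m * Re z - \<bar>Im z\<bar> > 0" using assms by (simp add: slope_cone_def)
  then have "s > 0" "m * (Re z - s) > \<bar>Im z\<bar>" using m by (simp_all add: s_def field_simps)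
  then show ?thesis by (auto simp: slope_cone_def)
qed

text \<open>The operator \<open>V \<circ> T z\<close> for complex \<open>z\<close>. As \<open>T z\<close> need not map \<open>D\<close> into \<open>D\<close>, a real time \<open>s\<close> is split
off first; the result does not depend on \<open>s\<close> (\<open>VT_eq\<close>).\<close>

definition VT :: "complex \<Rightarrow> 'k \<times> 'k \<Rightarrow> 'h \<times> 'h" where
  "VT z x = (let s = SOME s. s > 0 \<and> z - of_real s \<in> slope_cone m in VT0 s (T (z - of_real s) x))"

lemma VT_eq:
  assumes s: "s > 0" and zs: "z - of_real s \<in> slope_cone m"
  shows "VT z x = VT0 s (T (z - of_real s) x)"
proof -
  have *: "VT0 r' (T (z - of_real r') x) = VT0 r (T (z - of_real r) x)"
    if r: "r > 0" "r < r'" "z - of_real r' \<in> slope_cone m" for r r'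
  proof -
    have "VT0 r' (T (z - of_real r') x) = VT0 (r + (r' - r)) (T (z - of_real r') x)" by simp
    also have "\<dots> = VT0 r (T (of_real (r' - r)) (T (z - of_real r') x))" using r by (intro VT0_add) auto
    also have "T (of_real (r' - r)) (T (z - of_real r') x) = T (of_real (r' - r) + (z - of_real r')) x"
      using r cone_real[of "r' - r"] by (intro T_add[symmetric]) auto
    also have "of_real (r' - r) + (z - of_real r') = z - of_real r" by simp
    finally show ?thesis .
  qed
  define r where "r = (SOME s. s > 0 \<and> z - of_real s \<in> slope_cone m)"
  have r: "r > 0 \<and> z - of_real r \<in> slope_cone m" unfolding r_def by (rule someI[of _ s]) (use s zs in auto)
  have "VT z x = VT0 r (T (z - of_real r) x)" by (simp add: VT_def Let_def r_def)
  then show ?thesis using *[of r s] *[of s r] r s zs by (cases r s rule: linorder_cases) auto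
qed

lemma VT_add:
  assumes z: "z \<in> slope_cone m" and w: "w \<in> slope_cone m"
  shows "VT (z + w) x = VT z (T w x)"
proof -
  obtain s where s: "s > 0" "z - of_real s \<in> slope_cone m" using cone_minus_real[OF z] by blast
  have sw: "z + w - of_real s \<in> slope_cone m" using cone_add[OF s(2) w] by (simp add: algebra_simps)
  have "T (z + w - of_real s) x = T ((z - of_real s) + w) x" by (simp add: algebra_simps)
  then show ?thesis using VT_eq[OF s] VT_eq[OF s(1) sw] T_add[OF s(2) w] by simp
qed

lemma VT_real:
  assumes t: "t > 0" and x: "x \<in> D"
  shows "VT (of_real t) x = V (T (of_real t) x)"
proof -
  have t2: "t / 2 > 0" using t by simp
  have c: "of_real t - of_real (t / 2) = complex_of_real (t / 2)" by simp
  have "VT (of_real t) x = VT0 (t / 2) (T (of_real (t / 2)) x)"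
    using VT_eq[OF t2, of "of_real t" x] cone_real[OF t2] unfolding c by simp
  also have "\<dots> = V (T (of_real (t / 2)) (T (of_real (t / 2)) x))" using t2 x by (intro VT0_D T_D)
  also have "\<dots> = V (T (of_real (t / 2) + of_real (t / 2)) x)" 
    using T_add[OF cone_real[OF t2] cone_real[OF t2], of x] by (simp only:)
  finally show ?thesis by (simp only: of_real_add[symmetric] field_sum_of_halves)
qed

lemma VT_linear:
  assumes z: "z \<in> slope_cone m"
  shows "complex_linear (VT z)"
proof -
  obtain s where s: "s > 0" "z - of_real s \<in> slope_cone m" using cone_minus_real[OF z] by blast
  have "VT z = (\<lambda>x. VT0 s (T (z - of_real s) x))" using VT_eq[OF s] by blast
  then show ?thesis using complex_linear_compose[OF VT0_linear[OF s(1)] T_linear[OF s(2)]] by simp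
qed

lemma bounded_linear_B: "bounded_linear B" by (rule complex_linearD(1)[OF B_linear])

text \<open>The hypothesis \<open>form\<close> extends from \<open>D\<close> and real times to the whole space and the cone by continuity in
\<open>x\<close> and the semigroup law; the second argument may stay at time \<open>0\<close>.\<close>

lemma form_VT_V:
  assumes z: "z \<in> slope_cone m" and y: "y \<in> D"
  shows "cinner (B (VT z x)) (V y) = dT z x y"
proof -
  obtain s where s: "s > 0" "z - of_real s \<in> slope_cone m" using cone_minus_real[OF z] by blast
  have "cinner (B (VT0 s x)) (V y) = dT (of_real s) x y" for x
  proof (rule bounded_linear_eq_on_dense[OF _ bounded_linear_dT_left[OF cone_real[OF s(1)]] D_dense])
    show "bounded_linear (\<lambda>x. cinner (B (VT0 s x)) (V y))"
      by (intro bounded_linear_compose[OF bounded_linear_cinner_left] bounded_linear_compose[OF bounded_linear_B]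
          complex_linearD(1) VT0_linear s)
    show "cinner (B (VT0 s x)) (V y) = dT (of_real s) x y" if "x \<in> D" for x
      using dT_form[OF s(1) that y] by (simp add: VT0_D[OF s(1) that])
  qed
  then show ?thesis using dT_shift[OF cone_real[OF s(1)] s(2), of x y] by (simp add: VT_eq[OF s])
qed

lemma form_VT_VT:
  assumes z: "z \<in> slope_cone m" and w: "w \<in> slope_cone m"
  shows "cinner (B (VT z x)) (VT w y) = dT z x (T w y)"
proof -
  obtain s where s: "s > 0" "w - of_real s \<in> slope_cone m" using cone_minus_real[OF w] by blast
  have "cinner (B (VT z x)) (VT0 s y) = dT z x (T (of_real s) y)" for y
  proof (rule bounded_linear_eq_on_dense[OF _ _ D_dense, where f = "\<lambda>y. cinner (B (VT z x)) (VT0 s y)"])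
    show "bounded_linear (\<lambda>y. cinner (B (VT z x)) (VT0 s y))"
      by (intro bounded_linear_compose[OF bounded_linear_cinner_right] complex_linearD(1) VT0_linear s)
    show "bounded_linear (\<lambda>y. dT z x (T (of_real s) y))"
      by (intro bounded_linear_compose[OF bounded_linear_dT_right[OF z]] complex_linearD(1) T_linear cone_real s)
    show "cinner (B (VT z x)) (VT0 s y) = dT z x (T (of_real s) y)" if "y \<in> D" for y
      using form_VT_V[OF z T_D[OF s(1) that]] by (simp add: VT0_D[OF s(1) that])
  qed
  then have "cinner (B (VT z x)) (VT w y) = dT z x (T (of_real s) (T (w - of_real s) y))" by (simp add: VT_eq[OF s])
  also have "T (of_real s) (T (w - of_real s) y) = T (of_real s + (w - of_real s)) y"
    by (rule T_add[OF cone_real[OF s(1)] s(2), symmetric])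
  finally show ?thesis by simp
qed

lemma dT_bounded_on_D:
  assumes x: "x \<in> D"
  shows "\<exists>c. \<forall>z\<in>slope_cone m. \<forall>y. cmod (dT z x y) \<le> c * norm y"
proof -
  obtain c where c: "\<And>t. t > 0 \<Longrightarrow> norm (T (of_real t) x - x) \<le> c * t" using T_Lipschitz[OF x] by blast
  have "cmod (dT z x y) \<le> c * norm y" if z: "z \<in> slope_cone m" for z y
  proof -
    have d: "((\<lambda>w. (cinner (T w x) y - cinner (T z x) y) / (w - z)) \<longlongrightarrow> dT z x y) (at z)"
      using dT_derivative[OF z, of x y] by (simp add: has_field_derivative_iff)
    \<comment> \<open>It is enough to bound the difference quotients along the real direction.\<close>
    have "filterlim (\<lambda>t. z + complex_of_real t) (at z) (at_right 0)"
      unfolding filterlim_at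
    proof
      show "((\<lambda>t. z + complex_of_real t) \<longlongrightarrow> z) (at_right 0)"
        by (rule tendsto_eq_intros refl tendsto_of_real tendsto_ident_at)+ simp
    qed (auto simp: eventually_at_filter)
    from filterlim_compose[OF d this]
    have lim: "((\<lambda>t. cmod ((cinner (T (z + of_real t) x) y - cinner (T z x) y) / of_real t)) \<longlongrightarrow> cmod (dT z x y)) (at_right 0)"
      by (intro tendsto_norm) simp
    have "\<forall>\<^sub>F t in at_right 0. cmod ((cinner (T (z + of_real t) x) y - cinner (T z x) y) / of_real t) \<le> c * norm y"
      using eventually_at_right_less[of 0]
    proof eventually_elim
      case (elim t)
      have "cinner (T (z + of_real t) x) y - cinner (T z x) y = cinner (T z (T (of_real t) x - x)) y"
        using T_add[OF z cone_real[OF elim], of x] by (simp add: complex_linearD[OF T_linear[OF z]] cinner_diff_left)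
      also have "cmod \<dots> \<le> norm (T (of_real t) x - x) * norm y" by (rule cmod_cinner_T_le[OF z])
      also have "\<dots> \<le> (c * t) * norm y" by (intro mult_right_mono c elim) auto
      finally show ?case using elim by (simp add: norm_divide field_simps)
    qed
    then show ?thesis by (rule tendsto_upperbound[OF lim]) simp
  qed
  then show ?thesis by blast
qed

text \<open>For \<open>x\<close> in \<open>D\<close> there is no blow-up at \<open>z = 0\<close>, since orbits of \<open>D\<close> are Lipschitz. The bound depends
on \<open>x\<close> in an uncontrolled way and serves only to make the Laplace integrals converge.\<close>

lemma VT_bounded_on_D:
  assumes x: "x \<in> D"
  shows "\<exists>c. \<forall>z\<in>slope_cone m. norm (VT z x) \<le> c"
proof -
  obtain c where c: "\<And>z y. z \<in> slope_cone m \<Longrightarrow> cmod (dT z x y) \<le> c * norm y" using dT_bounded_on_D[OF x] by blast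
  have "norm (VT z x) \<le> sqrt (2 * (\<bar>c\<bar> * norm x))" if z: "z \<in> slope_cone m" for z
  proof -
    have "(norm (VT z x))\<^sup>2 = - 2 * Re (dT z x (T z x))" by (simp add: norm_sq_via_form form_VT_VT[OF z z])
    also have "\<dots> \<le> 2 * cmod (dT z x (T z x))" using abs_Re_le_cmod[of "dT z x (T z x)"] by linarith
    also have "\<dots> \<le> 2 * (\<bar>c\<bar> * norm (T z x))"
      using order_trans[OF c[OF z] mult_right_mono[OF abs_ge_self norm_ge_zero]] by simp
    also have "\<dots> \<le> 2 * (\<bar>c\<bar> * norm x)" using T_contraction[OF z] by (intro mult_left_mono) auto
    finally show ?thesis by (rule real_le_rsqrt)
  qed
  then show ?thesis by blast
qed

lemma VT_holomorphic: "(\<lambda>z. cinner (VT z x) h) holomorphic_on slope_cone m"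
proof -
  have "(\<lambda>z. cinner (VT z x) h) field_differentiable (at z)" if z: "z \<in> slope_cone m" for z
  proof -
    obtain s where s: "s > 0" "z - of_real s \<in> slope_cone m" using cone_minus_real[OF z] by blast
    let ?f = "\<lambda>z. cinner (T (z - of_real s) x) (adjoint (VT0 s) h)"
    have "(?f has_field_derivative dT (z - of_real s) x (adjoint (VT0 s) h)) (at z)"
      using dT_derivative[OF s(2), of x "adjoint (VT0 s) h"]
        DERIV_shift[of "\<lambda>z. cinner (T z x) (adjoint (VT0 s) h)" _ z "- of_real s"] by simp
    then have "((\<lambda>z. cinner (VT z x) h) has_field_derivative dT (z - of_real s) x (adjoint (VT0 s) h)) (at z)"
    proof (rule has_field_derivative_transform_within_open[where S = "(\<lambda>z. z - of_real s) -` slope_cone m"])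
      show "open ((\<lambda>z. z - of_real s) -` slope_cone m)" by (intro open_vimage open_cone continuous_intros)
      show "?f w = cinner (VT w x) h" if "w \<in> (\<lambda>z. z - of_real s) -` slope_cone m" for w
        using that by (simp add: VT_eq[OF s(1)] cinner_adjoint[OF VT0_linear[OF s(1)]])
    qed (use s in auto)
    then show ?thesis unfolding field_differentiable_def by blast
  qed
  then show ?thesis by (auto simp: holomorphic_on_def intro: field_differentiable_at_within)
qed

end

section \<open>Boundedness in the form norm\<close>

text \<open>Up to the sign \<open>(- 1)\<^sup>n\<close>, the \<open>n\<close>-th derivative of the Laplace transform. Only \<open>n = 0\<close> and \<open>n = 1\<close> occur;
they correspond to the resolvent and its square.\<close>

definition laplace :: "nat \<Rightarrow> complex \<Rightarrow> (real \<Rightarrow> complex) \<Rightarrow> complex" where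
  "laplace n \<mu> f = (LINT t:{0<..}|lborel. of_real t ^ n * exp (- \<mu> * of_real t) * f t)"

lemma laplace_add:
  assumes "continuous_on {0<..} f" "\<And>t. t > 0 \<Longrightarrow> cmod (f t) \<le> b"
    and "continuous_on {0<..} g" "\<And>t. t > 0 \<Longrightarrow> cmod (g t) \<le> c" and "Re \<mu> > 0" "n \<le> 1"
  shows "laplace n \<mu> (\<lambda>t. f t + g t) = laplace n \<mu> f + laplace n \<mu> g"
  unfolding laplace_def distrib_left
  by (rule set_integral_add(2)[OF exp_weight_integrable exp_weight_integrable]) (use assms in auto)

lemma laplace_cmult: "laplace n \<mu> (\<lambda>t. c * f t) = c * laplace n \<mu> f"
proof -
  have "(\<lambda>t. of_real t ^ n * exp (- \<mu> * of_real t) * (c * f t)) = (\<lambda>t. c * (of_real t ^ n * exp (- \<mu> * of_real t) * f t))"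
    by (simp add: ac_simps fun_eq_iff)
  then show ?thesis unfolding laplace_def by (simp only: set_integral_mult_right)
qed

lemma laplace_cong: "(\<And>t. t > 0 \<Longrightarrow> f t = g t) \<Longrightarrow> laplace n \<mu> f = laplace n \<mu> g"
  unfolding laplace_def by (rule set_lebesgue_integral_cong) auto

lemma laplace_bound:
  assumes \<mu>: "Re \<mu> > 0" and n: "n \<le> 1"
  shows "\<exists>K\<ge>0. \<forall>f b. continuous_on {0<..} f \<longrightarrow> (\<forall>t>0. cmod (f t) \<le> b) \<longrightarrow> cmod (laplace n \<mu> f) \<le> K * b"
proof -
  define K where "K = (LINT t:{0<..}|lborel. cmod (of_real t ^ n * exp (- \<mu> * of_real t) * 1))"
  have int: "set_integrable lborel {0<..} (\<lambda>t. cmod (of_real t ^ n * exp (- \<mu> * of_real t) * 1))"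
    by (rule set_integrable_norm) (rule exp_weight_integrable[where b = 1], use \<mu> n in auto)
  have "K \<ge> 0" unfolding K_def set_lebesgue_integral_def by (intro integral_nonneg_AE) auto
  moreover have "cmod (laplace n \<mu> f) \<le> K * b" if cont: "continuous_on {0<..} f" and b: "\<forall>t>0. cmod (f t) \<le> b" for f b
  proof -
    have fint: "set_integrable lborel {0<..} (\<lambda>t. of_real t ^ n * exp (- \<mu> * of_real t) * f t)"
      by (rule exp_weight_integrable[OF cont _ \<mu> n]) (use b in auto)
    have "cmod (laplace n \<mu> f) \<le> (LINT t:{0<..}|lborel. cmod (of_real t ^ n * exp (- \<mu> * of_real t) * f t))"
      unfolding laplace_def by (rule set_integral_norm_bound[OF fint])
    also have "\<dots> \<le> (LINT t:{0<..}|lborel. b * cmod (of_real t ^ n * exp (- \<mu> * of_real t) * 1))"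
    proof (rule set_integral_mono[OF set_integrable_norm[OF fint] set_integrable_mult_right[OF int]])
      fix t :: real assume "t \<in> {0<..}"
      then have "cmod (f t) \<le> b" using b by simp
      then have "cmod (of_real t ^ n * exp (- \<mu> * of_real t)) * cmod (f t) \<le> cmod (of_real t ^ n * exp (- \<mu> * of_real t)) * b"
        by (intro mult_left_mono) auto
      then show "cmod (of_real t ^ n * exp (- \<mu> * of_real t) * f t) \<le> b * cmod (of_real t ^ n * exp (- \<mu> * of_real t) * 1)"
        by (simp only: norm_mult norm_one mult_1_right mult.commute)
    qed
    also have "\<dots> = K * b" unfolding K_def by (simp only: set_integral_mult_right mult.commute)
    finally show ?thesis .
  qed
  ultimately show ?thesis by blast
qed

lemma FTC_half_line:
  fixes F F' :: "real \<Rightarrow> complex"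
  assumes "\<And>t. t > 0 \<Longrightarrow> (F has_vector_derivative F' t) (at t)" "continuous_on {0<..} F'"
    and "set_integrable lborel {0<..} F'" "(F \<longlongrightarrow> a) (at_right 0)" "(F \<longlongrightarrow> b) at_top"
  shows "(LINT t:{0<..}|lborel. F' t) = b - a"
proof -
  have "(LBINT t=0..\<infinity>. F' t) = b - a"
  proof (rule interval_integral_FTC_integrable[where F = F])
    show "isCont F' x" if "0 < ereal x" for x
      using assms(2) that by (auto simp: continuous_on_eq_continuous_at zero_ereal_def)
    show "set_integrable lborel (einterval 0 \<infinity>) F'" using assms(3) by (simp add: zero_ereal_def)
    show "((F \<circ> real_of_ereal) \<longlongrightarrow> a) (at_right 0)"
      unfolding zero_ereal_def ereal_tendsto_simps by (rule assms)
    show "((F \<circ> real_of_ereal) \<longlongrightarrow> b) (at_left \<infinity>)"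
      unfolding ereal_tendsto_simps by (rule assms)
  qed (use assms(1) in auto)
  then show ?thesis by (simp add: interval_lebesgue_integral_def zero_ereal_def)
qed

lemma laplace_derivative:
  fixes \<phi> \<phi>' :: "real \<Rightarrow> complex"
  assumes der: "\<And>t. t > 0 \<Longrightarrow> (\<phi> has_vector_derivative \<phi>' t) (at t)" and cont': "continuous_on {0<..} \<phi>'"
    and b: "\<And>t. t > 0 \<Longrightarrow> cmod (\<phi> t) \<le> b" and b': "\<And>t. t > 0 \<Longrightarrow> cmod (\<phi>' t) \<le> b'"
    and lim: "(\<phi> \<longlongrightarrow> \<phi>0) (at_right 0)" and \<mu>: "Re \<mu> > 0"
  shows "laplace 0 \<mu> \<phi>' = \<mu> * laplace 0 \<mu> \<phi> - \<phi>0"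
    and "laplace 1 \<mu> \<phi>' = \<mu> * laplace 1 \<mu> \<phi> - laplace 0 \<mu> \<phi>"
proof -
  have cont: "continuous_on {0<..} \<phi>"
    using der by (intro continuous_at_imp_continuous_on ballI has_vector_derivative_continuous) auto
  have i0: "set_integrable lborel {0<..} (\<lambda>t. exp (- \<mu> * of_real t) * \<phi> t)"
    and i1: "set_integrable lborel {0<..} (\<lambda>t. of_real t * exp (- \<mu> * of_real t) * \<phi> t)"
    and i0': "set_integrable lborel {0<..} (\<lambda>t. exp (- \<mu> * of_real t) * \<phi>' t)"
    and i1': "set_integrable lborel {0<..} (\<lambda>t. of_real t * exp (- \<mu> * of_real t) * \<phi>' t)"
    using exp_weight_integrable[OF cont b \<mu>, of 0] exp_weight_integrable[OF cont b \<mu>, of 1]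
      exp_weight_integrable[OF cont' b' \<mu>, of 0] exp_weight_integrable[OF cont' b' \<mu>, of 1] by simp_all
  have E: "((\<lambda>t. exp (- \<mu> * of_real t)) has_vector_derivative - \<mu> * exp (- \<mu> * of_real t)) (at t)" for t
    by (rule has_vector_derivative_real_field) (auto intro!: derivative_eq_intros)
  have E0: "((\<lambda>t. exp (- \<mu> * complex_of_real t)) \<longlongrightarrow> exp (- \<mu> * complex_of_real 0)) (at_right 0)"
    by (intro tendsto_intros)
  have decay: "((\<lambda>t. of_real t ^ n * exp (- \<mu> * of_real t) * \<phi> t) \<longlongrightarrow> 0) at_top" for n
  proof (rule Lim_null_comparison)
    show "\<forall>\<^sub>F t in at_top. cmod (of_real t ^ n * exp (- \<mu> * of_real t) * \<phi> t) \<le> t ^ n / exp (Re \<mu> * t) * b"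
      using eventually_gt_at_top[of 0]
    proof eventually_elim
      case (elim t)
      have "cmod (of_real t ^ n * exp (- \<mu> * of_real t) * \<phi> t) = t ^ n / exp (Re \<mu> * t) * cmod (\<phi> t)"
        unfolding norm_mult norm_power norm_exp_eq_Re using elim by (simp add: exp_minus divide_inverse)
      also have "\<dots> \<le> t ^ n / exp (Re \<mu> * t) * b" using elim b by (intro mult_left_mono) auto
      finally show ?case .
    qed
    have "((\<lambda>t. t ^ n / exp (Re \<mu> * t)) \<longlongrightarrow> 0) at_top" using \<mu> by real_asymp
    then show "((\<lambda>t. t ^ n / exp (Re \<mu> * t) * b) \<longlongrightarrow> 0) at_top" by (rule tendsto_mult_left_zero)
  qed
  show "laplace 0 \<mu> \<phi>' = \<mu> * laplace 0 \<mu> \<phi> - \<phi>0"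
  proof -
    have "(LINT t:{0<..}|lborel. exp (- \<mu> * of_real t) * \<phi>' t - \<mu> * (exp (- \<mu> * of_real t) * \<phi> t)) = 0 - 1 * \<phi>0"
    proof (rule FTC_half_line)
      show "((\<lambda>t. exp (- \<mu> * of_real t) * \<phi> t) has_vector_derivative
          exp (- \<mu> * of_real t) * \<phi>' t - \<mu> * (exp (- \<mu> * of_real t) * \<phi> t)) (at t)" if "t > 0" for t
        using has_vector_derivative_mult[OF E der[OF that]] by (simp add: algebra_simps)
      show "continuous_on {0<..} (\<lambda>t. exp (- \<mu> * of_real t) * \<phi>' t - \<mu> * (exp (- \<mu> * of_real t) * \<phi> t))"
        by (intro continuous_intros cont cont')
      show "set_integrable lborel {0<..} (\<lambda>t. exp (- \<mu> * of_real t) * \<phi>' t - \<mu> * (exp (- \<mu> * of_real t) * \<phi> t))"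
        by (intro set_integral_diff i0' set_integrable_mult_right i0)
      show "((\<lambda>t. exp (- \<mu> * of_real t) * \<phi> t) \<longlongrightarrow> 1 * \<phi>0) (at_right 0)"
        using tendsto_mult[OF E0 lim] by simp
      show "((\<lambda>t. exp (- \<mu> * of_real t) * \<phi> t) \<longlongrightarrow> 0) at_top" using decay[of 0] by simp
    qed
    then show ?thesis
      unfolding set_integral_diff(2)[OF i0' set_integrable_mult_right[OF i0]] set_integral_mult_right
      by (simp add: laplace_def algebra_simps)
  qed
  show "laplace 1 \<mu> \<phi>' = \<mu> * laplace 1 \<mu> \<phi> - laplace 0 \<mu> \<phi>"
  proof -
    have "(LINT t:{0<..}|lborel. exp (- \<mu> * of_real t) * \<phi> t +
        (of_real t * exp (- \<mu> * of_real t) * \<phi>' t - \<mu> * (of_real t * exp (- \<mu> * of_real t) * \<phi> t))) = 0 - 0"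
    proof (rule FTC_half_line)
      show "((\<lambda>t. of_real t * exp (- \<mu> * of_real t) * \<phi> t) has_vector_derivative
          exp (- \<mu> * of_real t) * \<phi> t + (of_real t * exp (- \<mu> * of_real t) * \<phi>' t - \<mu> * (of_real t * exp (- \<mu> * of_real t) * \<phi> t))) (at t)"
        if "t > 0" for t
        using has_vector_derivative_mult[OF has_vector_derivative_mult[OF has_vector_derivative_of_real[OF DERIV_ident] E] der[OF that]]
        by (simp add: algebra_simps)
      show "continuous_on {0<..} (\<lambda>t. exp (- \<mu> * of_real t) * \<phi> t +
          (of_real t * exp (- \<mu> * of_real t) * \<phi>' t - \<mu> * (of_real t * exp (- \<mu> * of_real t) * \<phi> t)))"
        by (intro continuous_intros cont cont')
      show "set_integrable lborel {0<..} (\<lambda>t. exp (- \<mu> * of_real t) * \<phi> t +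
          (of_real t * exp (- \<mu> * of_real t) * \<phi>' t - \<mu> * (of_real t * exp (- \<mu> * of_real t) * \<phi> t)))"
        by (intro set_integral_add set_integral_diff i0 i1' set_integrable_mult_right i1)
      show "((\<lambda>t. of_real t * exp (- \<mu> * of_real t) * \<phi> t) \<longlongrightarrow> 0) (at_right 0)"
        using tendsto_mult[OF tendsto_mult[OF tendsto_of_real[OF tendsto_ident_at] E0] lim] by simp
      show "((\<lambda>t. of_real t * exp (- \<mu> * of_real t) * \<phi> t) \<longlongrightarrow> 0) at_top" using decay[of 1] by simp
    qed
    then show ?thesis
      unfolding set_integral_add(2)[OF i0 set_integral_diff(1)[OF i1' set_integrable_mult_right[OF i1]]]
        set_integral_diff(2)[OF i1' set_integrable_mult_right[OF i1]] set_integral_mult_right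
      by (simp add: laplace_def algebra_simps)
  qed
qed

text \<open>Riesz representation stands in for the integral of a vector-valued function.\<close>

lemma laplace_vector:
  fixes G :: "real \<Rightarrow> 'a::{real_inner,banach} \<times> 'a"
  assumes cont: "\<And>y. continuous_on {0<..} (\<lambda>t. cinner (G t) y)" and b: "\<And>t. t > 0 \<Longrightarrow> norm (G t) \<le> b"
    and \<mu>: "Re \<mu> > 0" and n: "n \<le> 1"
  shows "\<exists>X. \<forall>y. cinner X y = laplace n \<mu> (\<lambda>t. cinner (G t) y)"
proof -
  obtain K where K: "K \<ge> 0" "\<And>f b. continuous_on {0<..} f \<Longrightarrow> (\<And>t. t > 0 \<Longrightarrow> cmod (f t) \<le> b) \<Longrightarrow> cmod (laplace n \<mu> f) \<le> K * b"
    using laplace_bound[OF \<mu> n] by blast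
  have bd: "cmod (cinner (G t) y) \<le> b * norm y" if "t > 0" for t y
    using order_trans[OF cmod_cinner_le mult_right_mono[OF b[OF that] norm_ge_zero]] .
  obtain X where "\<And>y. cinner X y = laplace n \<mu> (\<lambda>t. cinner (G t) y)"
  proof (rule riesz_conjugate_linear[where \<phi> = "\<lambda>y. laplace n \<mu> (\<lambda>t. cinner (G t) y)" and C = "K * b"])
    show "laplace n \<mu> (\<lambda>t. cinner (G t) (x + y)) = laplace n \<mu> (\<lambda>t. cinner (G t) x) + laplace n \<mu> (\<lambda>t. cinner (G t) y)" for x y
      unfolding cinner_add_right by (rule laplace_add[OF cont bd cont bd \<mu> n])
    show "laplace n \<mu> (\<lambda>t. cinner (G t) (r *\<^sub>R y)) = of_real r * laplace n \<mu> (\<lambda>t. cinner (G t) y)" for r y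
      unfolding cinner_scaleR_right by (rule laplace_cmult)
    show "laplace n \<mu> (\<lambda>t. cinner (G t) (cJ y)) = - \<i> * laplace n \<mu> (\<lambda>t. cinner (G t) y)" for y
      unfolding cinner_cJ_right by (rule laplace_cmult)
    show "cmod (laplace n \<mu> (\<lambda>t. cinner (G t) y)) \<le> K * b * norm y" for y
      using K(2)[OF cont bd, of y] by (simp add: mult.assoc)
  qed blast
  then show ?thesis by blast
qed

text \<open>If \<open>p\<close> lies in a sector of half-angle \<open>arctan L\<close> and \<open>\<nu>\<close> in the right half-plane, then the directions of
\<open>\<nu> p\<close> and of \<open>- 1\<close> are separated by a positive angle, so that adding a nonnegative number cannot cancel
\<open>\<nu> p\<close>. After division by \<open>p\<close> this is a statement about \<open>\<nu>\<close> and the element \<open>s = r / p\<close> of the same kind of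
sector.\<close>

lemma sector_separation:
  fixes p \<nu> :: complex
  assumes p: "Re p > 0" "\<bar>Im p\<bar> \<le> L * Re p" and \<nu>: "Re \<nu> \<ge> 0" and r: "r \<ge> 0"
  shows "cmod \<nu> * cmod p \<le> (2 + L) * cmod (\<nu> * p + of_real r)"
proof -
  define s where "s = of_real r / p"
  have L: "L \<ge> 0" using order_trans[OF abs_ge_zero p(2)] p(1) by (simp add: zero_le_mult_iff)
  have pn: "p \<noteq> 0" using p by auto
  have pc: "(cmod p)\<^sup>2 > 0" using pn by simp
  have Re_s: "Re s = r * Re p / (cmod p)\<^sup>2" and Im_s: "Im s = - (r * Im p / (cmod p)\<^sup>2)"
    by (simp_all add: s_def Re_divide Im_divide cmod_power2)
  have s0: "Re s \<ge> 0" using p r by (simp add: Re_s)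
  have s1: "\<bar>Im s\<bar> \<le> L * Re s"
  proof -
    have "\<bar>Im s\<bar> = r * \<bar>Im p\<bar> / (cmod p)\<^sup>2" using r by (simp add: Im_s abs_mult)
    also have "\<dots> \<le> r * (L * Re p) / (cmod p)\<^sup>2" using p r by (intro divide_right_mono mult_left_mono) auto
    finally show ?thesis by (simp add: Re_s ac_simps)
  qed
  have a: "Re \<nu> \<le> cmod (\<nu> + s)" "Re s \<le> cmod (\<nu> + s)"
    using complex_Re_le_cmod[of "\<nu> + s"] s0 \<nu> by simp_all
  have "\<bar>Im \<nu>\<bar> \<le> \<bar>Im (\<nu> + s)\<bar> + \<bar>Im s\<bar>" by simp
  also have "\<dots> \<le> cmod (\<nu> + s) + L * cmod (\<nu> + s)"
    using s1 mult_left_mono[OF a(2) L] abs_Im_le_cmod[of "\<nu> + s"] by linarith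
  finally have "cmod \<nu> \<le> (2 + L) * cmod (\<nu> + s)"
    using a(1) \<nu> cmod_le[of \<nu>] by (simp add: algebra_simps)
  then have "cmod \<nu> * cmod p \<le> (2 + L) * (cmod (\<nu> + s) * cmod p)" by (simp add: mult_right_mono mult.assoc[symmetric])
  also have "cmod (\<nu> + s) * cmod p = cmod (\<nu> * p + of_real r)"
    using pn by (simp add: s_def norm_mult[symmetric] distrib_right)
  finally show ?thesis .
qed

context form_semigroup
begin

lemma B_bound: "\<exists>b\<ge>1. \<forall>h. norm (B h) \<le> b * norm h"
proof -
  obtain K where K: "\<And>h. norm (B h) \<le> norm h * K" using bounded_linear.bounded[OF bounded_linear_B] by blast
  have "norm (B h) \<le> max 1 K * norm h" for h
    using order_trans[OF K mult_left_mono[OF max.cobounded2 norm_ge_zero]] by (simp add: mult.commute)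
  then show ?thesis by (intro exI[where x = "max 1 K"]) auto
qed

text \<open>A bound for the operator norm of \<open>B\<close>; being at least \<open>1\<close>, it forces \<open>|\<omega>| \<le> 2\<close> when \<open>|\<omega> - 1| \<le> 1 / (4 \<beta>)\<close>.\<close>

definition \<beta> :: real where
  "\<beta> = (SOME b. b \<ge> 1 \<and> (\<forall>h. norm (B h) \<le> b * norm h))"

lemma \<beta>: "\<beta> \<ge> 1" "norm (B h) \<le> \<beta> * norm h"
proof -
  have "\<beta> \<ge> 1 \<and> (\<forall>h. norm (B h) \<le> \<beta> * norm h)" unfolding \<beta>_def by (rule someI_ex) (use B_bound in blast)
  then show "\<beta> \<ge> 1" "norm (B h) \<le> \<beta> * norm h" by blast+
qed

definition M :: real where "M = 8 * \<beta> * (2 + 8 * \<beta>)"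

text \<open>Here \<open>x\<close> plays the role of \<open>(\<mu> - \<omega> V\<^sup>* B V)\<^sup>-\<^sup>1 k\<close>, while \<open>u\<close> and \<open>v\<close> stand for \<open>V x\<close> and \<open>V k\<close>. The two
hypotheses are the weak form of the equation, tested with \<open>x\<close> and with \<open>k\<close>; with \<open>y = \<mu> x - k\<close> and
\<open>p = - \<omega> \<langle>B u, u\<rangle>\<close> they combine to \<open>cnj \<mu> p + |y|\<^sup>2 = - \<omega> \<langle>B u, v\<rangle>\<close>. Stating the lemma for arbitrary vectors
allows its repeated use with \<open>k\<close> outside \<open>D\<close>.\<close>

lemma resolvent_bound:
  assumes \<omega>: "cmod (\<omega> - 1) \<le> 1 / (4 * \<beta>)" and \<mu>: "Re \<mu> > 0"
    and f1: "\<omega> * cinner (B u) u = cinner (cscale \<mu> x - k) x"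
    and f2: "\<omega> * cinner (B u) v = cinner (cscale \<mu> x - k) k"
  shows "cmod \<mu> * norm u \<le> M * norm v"
proof (cases "u = 0")
  case True
  then show ?thesis using \<beta> by (simp add: M_def)
next
  case False
  define y where "y = cscale \<mu> x - k"
  define p where "p = - (\<omega> * cinner (B u) u)"
  have b0: "\<beta> > 0" using \<beta>(1) by simp
  have Bu: "cmod (cinner (B u) w) \<le> \<beta> * norm u * norm w" for w
    using order_trans[OF cmod_cinner_le mult_right_mono[OF \<beta>(2) norm_ge_zero]] .
  have "1 / (4 * \<beta>) \<le> 1" using \<beta>(1) by simp
  then have \<omega>2: "cmod \<omega> \<le> 2" using \<omega> norm_triangle_ineq[of "\<omega> - 1" 1] by simp
  have "Re ((\<omega> - 1) * cinner (B u) u) \<le> cmod ((\<omega> - 1) * cinner (B u) u)" by (rule complex_Re_le_cmod)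
  also have "\<dots> \<le> 1 / (4 * \<beta>) * (\<beta> * norm u * norm u)"
    unfolding norm_mult using \<omega> Bu b0 by (intro mult_mono) auto
  also have "\<dots> = (norm u)\<^sup>2 / 4" using b0 by (simp add: power2_eq_square)
  finally have Re_p: "Re p \<ge> (norm u)\<^sup>2 / 4"
    using dissipative[of u] by (simp add: p_def Re_cinner algebra_simps)
  have up: "(norm u)\<^sup>2 > 0" using False by simp
  have "\<bar>Im p\<bar> \<le> cmod p" by (rule abs_Im_le_cmod)
  also have "cmod p \<le> 2 * (\<beta> * norm u * norm u)"
    unfolding p_def norm_minus_cancel norm_mult using \<omega>2 Bu by (intro mult_mono) auto
  also have "\<dots> \<le> 8 * \<beta> * Re p" using mult_left_mono[OF Re_p, of "8 * \<beta>"] b0 by (simp add: power2_eq_square)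
  finally have Im_p: "\<bar>Im p\<bar> \<le> 8 * \<beta> * Re p" .
  have "cnj \<mu> * cinner y x = cinner y y + cinner y k"
    unfolding cinner_cscale_right[symmetric] cinner_add_right[symmetric] by (simp add: y_def)
  then have eq: "cnj \<mu> * p + of_real ((norm y)\<^sup>2) = - (\<omega> * cinner (B u) v)"
    by (simp add: p_def f1 f2 y_def[symmetric] cinner_self algebra_simps)
  have "cmod (cnj \<mu>) * cmod p \<le> (2 + 8 * \<beta>) * cmod (cnj \<mu> * p + of_real ((norm y)\<^sup>2))"
    by (rule sector_separation) (use order.strict_trans2[OF _ Re_p] up Im_p \<mu> in auto)
  also have "cmod (cnj \<mu> * p + of_real ((norm y)\<^sup>2)) \<le> 2 * (\<beta> * norm u * norm v)"
    unfolding eq norm_minus_cancel norm_mult using \<omega>2 Bu by (intro mult_mono) auto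
  finally have "cmod \<mu> * cmod p \<le> (2 + 8 * \<beta>) * (2 * (\<beta> * norm u * norm v))" using b0 by (simp add: mult_left_mono)
  moreover have "cmod \<mu> * ((norm u)\<^sup>2 / 4) \<le> cmod \<mu> * cmod p"
    using Re_p complex_Re_le_cmod[of p] by (intro mult_left_mono) auto
  ultimately have "cmod \<mu> * ((norm u)\<^sup>2 / 4) \<le> (2 + 8 * \<beta>) * (2 * (\<beta> * norm u * norm v))" by linarith
  then have "norm u * (cmod \<mu> * norm u) \<le> norm u * (M * norm v)"
    by (simp add: M_def power2_eq_square algebra_simps)
  then show ?thesis using False by simp
qed

lemma ray_continuous:
  assumes "f holomorphic_on slope_cone m" "\<omega> \<in> slope_cone m"
  shows "continuous_on {0<..} (\<lambda>t. f (of_real t * \<omega>))"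
  by (rule continuous_on_compose2[OF holomorphic_on_imp_continuous_on[OF assms(1)]])
    (use assms(2) in \<open>auto intro!: continuous_intros simp: cone_scale\<close>)

text \<open>The Laplace transforms \<open>X0\<close> and \<open>X1\<close> of \<open>T(t \<omega>) x\<close> with weights \<open>1\<close> and \<open>t\<close> are the first and second
power of the resolvent applied to \<open>x\<close>, and \<open>U0\<close> and \<open>U1\<close> are the corresponding transforms of
\<open>V T(t \<omega>) x\<close>. The resolvent bound is used once to pass from \<open>V x\<close> to \<open>U0\<close> and once to pass from \<open>U0\<close> to
\<open>U1\<close>.\<close>

lemma VT_ray_bound:
  assumes \<omega>: "\<omega> \<in> slope_cone m" "cmod (\<omega> - 1) \<le> 1 / (4 * \<beta>)" and x: "x \<in> D" and \<mu>: "Re \<mu> > 0"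
  shows "(cmod \<mu>)\<^sup>2 * cmod (laplace 1 \<mu> (\<lambda>t. cinner (VT (of_real t * \<omega>) x) h)) \<le> M\<^sup>2 * norm (V x) * norm h"
proof -
  have ray: "of_real t * \<omega> \<in> slope_cone m" if "t > 0" for t using \<omega> that by (simp add: cone_scale)
  have \<omega>0: "\<omega> \<noteq> 0" using \<omega>(1) by (auto simp: slope_cone_def)
  obtain c where c: "\<And>z. z \<in> slope_cone m \<Longrightarrow> norm (VT z x) \<le> c" using VT_bounded_on_D[OF x] by blast
  obtain c' where c': "\<And>z y. z \<in> slope_cone m \<Longrightarrow> cmod (dT z x y) \<le> c' * norm y" using dT_bounded_on_D[OF x] by blast
  have "\<exists>X. \<forall>y. cinner X y = laplace n \<mu> (\<lambda>t. cinner (T (of_real t * \<omega>) x) y)" if "n \<le> 1" for n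
    by (rule laplace_vector[OF ray_continuous[OF T_holomorphic \<omega>(1)] _ \<mu> that, where b = "norm x"])
      (use T_contraction ray in auto)
  then obtain X0 X1 where X0: "\<And>y. cinner X0 y = laplace 0 \<mu> (\<lambda>t. cinner (T (of_real t * \<omega>) x) y)"
    and X1: "\<And>y. cinner X1 y = laplace 1 \<mu> (\<lambda>t. cinner (T (of_real t * \<omega>) x) y)" by (meson order_refl zero_le_one)
  have "\<exists>X. \<forall>y. cinner X y = laplace n \<mu> (\<lambda>t. cinner (VT (of_real t * \<omega>) x) y)" if "n \<le> 1" for n
    by (rule laplace_vector[OF ray_continuous[OF VT_holomorphic \<omega>(1)] _ \<mu> that, where b = c]) (use c ray in auto)
  then obtain U0 U1 where U0: "\<And>y. cinner U0 y = laplace 0 \<mu> (\<lambda>t. cinner (VT (of_real t * \<omega>) x) y)"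
    and U1: "\<And>y. cinner U1 y = laplace 1 \<mu> (\<lambda>t. cinner (VT (of_real t * \<omega>) x) y)" by (meson order_refl zero_le_one)
  have der: "((\<lambda>t. cinner (T (of_real t * \<omega>) x) y) has_vector_derivative \<omega> * dT (of_real t * \<omega>) x y) (at t)"
    if t: "t > 0" for t y
  proof -
    have "((\<lambda>z. cinner (T (z * \<omega>) x) y) has_field_derivative dT (of_real t * \<omega>) x y * \<omega>) (at (of_real t))"
      by (rule DERIV_chain2[where f = "\<lambda>z. cinner (T z x) y" and g = "\<lambda>z. z * \<omega>", OF dT_derivative[OF ray[OF t]]])
        (auto intro!: derivative_eq_intros)
    from has_vector_derivative_real_field[OF this] show ?thesis by (simp add: mult.commute)
  qed
  have dT_hol: "(\<lambda>z. dT z x y) holomorphic_on slope_cone m" for y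
    unfolding dT_def by (rule holomorphic_deriv[OF T_holomorphic open_cone])
  have cont': "continuous_on {0<..} (\<lambda>t. \<omega> * dT (of_real t * \<omega>) x y)" for y
    by (intro continuous_intros ray_continuous[OF dT_hol \<omega>(1)])
  have b: "cmod (cinner (T (of_real t * \<omega>) x) y) \<le> norm x * norm y" if "t > 0" for t y
    by (rule cmod_cinner_T_le[OF ray[OF that]])
  have b': "cmod (\<omega> * dT (of_real t * \<omega>) x y) \<le> cmod \<omega> * (c' * norm y)" if "t > 0" for t y
    unfolding norm_mult by (intro mult_left_mono c' ray that) auto
  have "filterlim (\<lambda>t. of_real t * \<omega>) (at 0 within slope_cone m) (at_right 0)"
    unfolding filterlim_at
  proof
    show "((\<lambda>t. of_real t * \<omega>) \<longlongrightarrow> 0) (at_right 0)"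
      by (rule tendsto_eq_intros refl tendsto_of_real tendsto_ident_at)+ simp
  qed (use \<omega>0 ray in \<open>auto simp: eventually_at_filter\<close>)
  then have lim: "((\<lambda>t. cinner (T (of_real t * \<omega>) x) y) \<longlongrightarrow> cinner x y) (at_right 0)" for y
    by (rule filterlim_compose[OF T_at_0])
  have L0: "\<omega> * laplace 0 \<mu> (\<lambda>t. dT (of_real t * \<omega>) x y) = cinner (cscale \<mu> X0 - x) y" for y
    using laplace_derivative(1)[OF der cont' b b' lim \<mu>, of y]
    by (simp add: laplace_cmult X0[symmetric] cinner_diff_left cinner_cscale_left)
  have L1: "\<omega> * laplace 1 \<mu> (\<lambda>t. dT (of_real t * \<omega>) x y) = cinner (cscale \<mu> X1 - X0) y" for y
    using laplace_derivative(2)[OF der cont' b b' lim \<mu>, of y]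
    by (simp add: laplace_cmult X0[symmetric] X1[symmetric] cinner_diff_left cinner_cscale_left del: One_nat_def)
  have BU: "cinner (B U) w = laplace n \<mu> (\<lambda>t. cinner (B (VT (of_real t * \<omega>) x)) w)"
    if "\<And>y. cinner U y = laplace n \<mu> (\<lambda>t. cinner (VT (of_real t * \<omega>) x) y)" for U n w
    by (simp add: cinner_adjoint[OF B_linear] that)
  have A0: "\<omega> * cinner (B U0) (VT (of_real s * \<omega>) x) = cinner (cscale \<mu> X0 - x) (T (of_real s * \<omega>) x)"
    and A1: "\<omega> * cinner (B U1) (VT (of_real s * \<omega>) x) = cinner (cscale \<mu> X1 - X0) (T (of_real s * \<omega>) x)"
    if s: "s > 0" for s
    unfolding L0[symmetric] L1[symmetric] BU[OF U0] BU[OF U1]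
    by (rule arg_cong2[where f = times, OF refl laplace_cong[OF form_VT_VT[OF ray ray[OF s]]]], assumption)+
  \<comment> \<open>The weak equation for \<open>U\<close>, known against \<open>V T(s \<omega>) x\<close> for each single \<open>s\<close>, is integrated over \<open>s\<close>. The
    transforms sit in the second, conjugate-linear argument, hence the conjugations.\<close>
  have pairing: "\<omega> * cinner (B U) W = cinner Y Z"
    if U: "\<And>s. s > 0 \<Longrightarrow> \<omega> * cinner (B U) (VT (of_real s * \<omega>) x) = cinner Y (T (of_real s * \<omega>) x)"
      and W: "\<And>y. cinner W y = laplace n \<mu> (\<lambda>t. cinner (VT (of_real t * \<omega>) x) y)"
      and Z: "\<And>y. cinner Z y = laplace n \<mu> (\<lambda>t. cinner (T (of_real t * \<omega>) x) y)" for U Y W Z n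
  proof -
    have "cinner W (B U) = laplace n \<mu> (\<lambda>t. cnj (1 / \<omega>) * cinner (T (of_real t * \<omega>) x) Y)"
      unfolding W
    proof (rule laplace_cong)
      fix t :: real assume t: "t > 0"
      have "cinner (B U) (VT (of_real t * \<omega>) x) = 1 / \<omega> * cinner Y (T (of_real t * \<omega>) x)"
        using U[OF t] \<omega>0 by (simp add: field_simps)
      then show "cinner (VT (of_real t * \<omega>) x) (B U) = cnj (1 / \<omega>) * cinner (T (of_real t * \<omega>) x) Y"
        by (metis cinner_commute complex_cnj_mult)
    qed
    also have "\<dots> = cnj (1 / \<omega>) * cinner Z Y" by (simp only: laplace_cmult Z)
    finally have "cinner (B U) W = 1 / \<omega> * cinner Y Z" by (metis cinner_commute complex_cnj_cnj complex_cnj_mult)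
    then show ?thesis using \<omega>0 by simp
  qed
  have "cmod \<mu> * norm U0 \<le> M * norm (V x)"
  proof (rule resolvent_bound[OF \<omega>(2) \<mu>])
    show "\<omega> * cinner (B U0) U0 = cinner (cscale \<mu> X0 - x) X0" by (rule pairing[OF A0 U0 X0])
    show "\<omega> * cinner (B U0) (V x) = cinner (cscale \<mu> X0 - x) x"
      unfolding L0[symmetric] BU[OF U0]
      by (rule arg_cong2[where f = times, OF refl laplace_cong[OF form_VT_V[OF ray x]]])
  qed
  moreover have "cmod \<mu> * norm U1 \<le> M * norm U0"
    by (rule resolvent_bound[OF \<omega>(2) \<mu> pairing[OF A1 U1 X1] pairing[OF A1 U0 X0]])
  moreover have M0: "M \<ge> 0" using \<beta>(1) by (simp add: M_def)
  ultimately have "cmod \<mu> * (cmod \<mu> * norm U1) \<le> M * (M * norm (V x))"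
    using mult_left_mono[of "cmod \<mu> * norm U1" "M * norm U0" "cmod \<mu>"] mult_left_mono[of "cmod \<mu> * norm U0" "M * norm (V x)" M]
    by (simp add: ac_simps)
  then have "(cmod \<mu>)\<^sup>2 * norm U1 \<le> M\<^sup>2 * norm (V x)" by (simp add: power2_eq_square mult.assoc)
  then have "(cmod \<mu>)\<^sup>2 * norm U1 * norm h \<le> M\<^sup>2 * norm (V x) * norm h" by (rule mult_right_mono) simp
  moreover have "(cmod \<mu>)\<^sup>2 * cmod (cinner U1 h) \<le> (cmod \<mu>)\<^sup>2 * (norm U1 * norm h)"
    by (intro mult_left_mono cmod_cinner_le) simp
  ultimately show ?thesis unfolding U1[symmetric] by (simp add: mult.assoc)
qed

text \<open>The factor \<open>exp 1 / 2\<close> comes from \<open>laplace_controls_value\<close>.\<close>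

definition C :: real where "C = exp 1 / 2 * M\<^sup>2"

text \<open>Rotation by an angle of tangent at most \<open>1 / (4 \<beta>)\<close> costs at most half of the coercivity of \<open>- B\<close>.\<close>

definition m' :: real where "m' = min m (1 / (4 * \<beta>))"

lemma m': "m' > 0" "slope_cone m' \<subseteq> slope_cone m"
  using m \<beta>(1) cone_mono[of m' m] by (auto simp: m'_def)

text \<open>The central estimate: the semigroup is bounded in the form norm \<open>|V x|\<close>.\<close>

lemma VT_bounded_by_V:
  assumes z: "z \<in> slope_cone m'" and x: "x \<in> D"
  shows "norm (VT z x) \<le> C * norm (V x)"
proof -
  define \<tau> where "\<tau> = Re z"
  define \<omega> where "\<omega> = z / of_real \<tau>"
  have \<tau>: "\<tau> > 0" using cone_Re_pos[OF m'(1) z] by (simp add: \<tau>_def)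
  have z_eq: "z = of_real \<tau> * \<omega>" using \<tau> by (simp add: \<omega>_def)
  have zm: "z \<in> slope_cone m" using z m'(2) by auto
  have \<omega>m: "\<omega> \<in> slope_cone m" using zm cone_scale[OF \<tau>, of \<omega> m] by (simp add: z_eq)
  have "\<omega> - 1 = \<i> * of_real (Im z / \<tau>)" using \<tau> by (simp add: complex_eq_iff \<omega>_def \<tau>_def)
  then have "cmod (\<omega> - 1) = \<bar>Im z\<bar> / \<tau>" using \<tau> by (simp add: norm_mult norm_divide)
  also have "\<dots> \<le> m'" using z \<tau> by (simp add: slope_cone_def \<tau>_def pos_divide_le_eq)
  finally have \<omega>1: "cmod (\<omega> - 1) \<le> 1 / (4 * \<beta>)" by (simp add: m'_def)
  obtain c where c: "\<And>z. z \<in> slope_cone m \<Longrightarrow> norm (VT z x) \<le> c" using VT_bounded_on_D[OF x] by blast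
  have C0: "C \<ge> 0" by (simp add: C_def)
  have "cmod (cinner (VT z x) h) \<le> C * norm (V x) * norm h" for h
  proof -
    have "cmod (cinner (VT (of_real \<tau> * \<omega>) x) h) \<le> exp 1 / 2 * (M\<^sup>2 * norm (V x) * norm h)"
    proof (rule laplace_controls_value[where b = "c * norm h"])
      show "continuous_on {0<..} (\<lambda>t. cinner (VT (of_real t * \<omega>) x) h)" by (rule ray_continuous[OF VT_holomorphic \<omega>m])
      show "cmod (cinner (VT (of_real t * \<omega>) x) h) \<le> c * norm h" if "t > 0" for t
        by (rule order_trans[OF cmod_cinner_le]) (use c cone_scale[OF that] \<omega>m in \<open>auto intro!: mult_right_mono\<close>)
      show "(cmod \<mu>)\<^sup>2 * cmod (LINT t:{0<..}|lborel. of_real t * exp (- \<mu> * of_real t) * cinner (VT (of_real t * \<omega>) x) h)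
          \<le> M\<^sup>2 * norm (V x) * norm h" if "Re \<mu> > 0" for \<mu>
        using VT_ray_bound[OF \<omega>m \<omega>1 x that, of h] by (simp add: laplace_def)
    qed (rule \<tau>)
    then show ?thesis by (simp add: z_eq C_def mult.assoc)
  qed
  from this[of "VT z x"] have "VT z x \<bullet> VT z x \<le> C * norm (V x) * norm (VT z x)"
    using abs_Re_le_cmod[of "cinner (VT z x) (VT z x)"] by (simp add: Re_cinner)
  then show ?thesis by (rule norm_le_if_inner_le) (use C0 in simp)
qed

end

section \<open>The induced semigroup on the second space\<close>

context form_semigroup
begin

lemma m'_cone: "z \<in> slope_cone m' \<Longrightarrow> z \<in> slope_cone m"
  using m'(2) by auto

lemma C_nonneg: "C \<ge> 0"
  by (simp add: C_def)

lemma dual_vector_exists: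
  assumes z: "z \<in> slope_cone m'"
  shows "\<exists>u. \<forall>x\<in>D. cinner u (V x) = cinner h (VT (cnj z) x)"
proof -
  have cz: "cnj z \<in> slope_cone m'" using z by simp
  note lin = complex_linearD[OF VT_linear[OF m'_cone[OF cz]]]
  obtain u where "\<And>x. x \<in> D \<Longrightarrow> cinner u (V x) = cinner h (VT (cnj z) x)"
  proof (rule complex_riesz_on_dense[OF D_subspace V_add V_scaleR D_cJ V_cJ, where \<phi> = "\<lambda>x. cinner h (VT (cnj z) x)" and C = "norm h * C"])
    show "cmod (cinner h (VT (cnj z) x)) \<le> norm h * C * norm (V x)" if "x \<in> D" for x
      using order_trans[OF cmod_cinner_le mult_left_mono[OF VT_bounded_by_V[OF cz that] norm_ge_zero]] by (simp add: mult.assoc)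
  qed (auto simp: lin cinner_add_right cinner_scaleR_right cinner_cJ_right)
  then show ?thesis by blast
qed

text \<open>The adjoint of the operator \<open>V x \<mapsto> V T(cnj z) x\<close>, which \<open>VT_bounded_by_V\<close> makes well-defined and
bounded. Working with the adjoint has the advantage that the semigroup intertwined with \<open>S\<close> appears
directly.\<close>

definition Hsg :: "complex \<Rightarrow> 'h \<times> 'h \<Rightarrow> 'h \<times> 'h" where
  "Hsg z h = (SOME u. \<forall>x\<in>D. cinner u (V x) = cinner h (VT (cnj z) x))"

lemma Hsg_V: "z \<in> slope_cone m' \<Longrightarrow> x \<in> D \<Longrightarrow> cinner (Hsg z h) (V x) = cinner h (VT (cnj z) x)"
  unfolding Hsg_def using someI_ex[OF dual_vector_exists[of z h]] by blast

lemma Hsg_unique: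
  assumes "z \<in> slope_cone m'" "\<And>x. x \<in> D \<Longrightarrow> cinner u (V x) = cinner h (VT (cnj z) x)"
  shows "Hsg z h = u"
proof (rule cinner_eq_on_dense[OF V_dense])
  fix d assume "d \<in> V ` D"
  then obtain x where "x \<in> D" "d = V x" by blast
  then show "cinner (Hsg z h) d = cinner u d" using Hsg_V[OF assms(1)] assms(2) by simp
qed

lemma Hsg_bound:
  assumes z: "z \<in> slope_cone m'"
  shows "norm (Hsg z h) \<le> C * norm h"
proof (rule norm_le_on_dense[OF V_dense])
  have cz: "cnj z \<in> slope_cone m'" using z by simp
  fix d assume "d \<in> V ` D"
  then obtain x where x: "x \<in> D" "d = V x" by blast
  have "Hsg z h \<bullet> d \<le> cmod (cinner (Hsg z h) d)"
    using complex_Re_le_cmod[of "cinner (Hsg z h) d"] by (simp add: Re_cinner)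
  also have "\<dots> \<le> norm h * norm (VT (cnj z) x)" by (simp add: x Hsg_V[OF z] cmod_cinner_le)
  also have "\<dots> \<le> norm h * (C * norm (V x))" by (intro mult_left_mono VT_bounded_by_V[OF cz x(1)]) simp
  finally show "Hsg z h \<bullet> d \<le> C * norm h * norm d" by (simp add: x ac_simps)
qed (simp add: C_nonneg)

lemma Hsg_linear:
  assumes z: "z \<in> slope_cone m'"
  shows "complex_linear (Hsg z)"
proof -
  have "Hsg z (g + h) = Hsg z g + Hsg z h" for g h
    by (rule Hsg_unique[OF z]) (simp add: Hsg_V[OF z] cinner_add_left)
  moreover have "Hsg z (r *\<^sub>R h) = r *\<^sub>R Hsg z h" for r h
    by (rule Hsg_unique[OF z]) (simp add: Hsg_V[OF z] cinner_scaleR_left)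
  ultimately have "bounded_linear (Hsg z)"
    by (intro bounded_linear_intro[where K = C]) (use Hsg_bound[OF z] in \<open>simp_all add: mult.commute\<close>)
  moreover have "Hsg z (cJ h) = cJ (Hsg z h)" for h
    by (rule Hsg_unique[OF z]) (simp add: Hsg_V[OF z] cinner_cJ_left)
  ultimately show ?thesis unfolding complex_linear_def by blast
qed

text \<open>The defining relation of \<open>Hsg\<close> holds with \<open>V\<close> applied to regularized vectors outside \<open>D\<close>; this is what
the semigroup law needs.\<close>

lemma Hsg_VT:
  assumes z: "z \<in> slope_cone m'" and w: "w \<in> slope_cone m"
  shows "cinner (Hsg z h) (VT w x) = cinner h (VT (cnj z) (T w x))"
proof -
  have cz: "cnj z \<in> slope_cone m" using z m'_cone by simp
  obtain s where s: "s > 0" "w - of_real s \<in> slope_cone m" using cone_minus_real[OF w] by blast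
  have "cinner (Hsg z h) (VT0 s y) = cinner h (VT (cnj z) (T (of_real s) y))" for y
  proof (rule bounded_linear_eq_on_dense[OF _ _ D_dense, where f = "\<lambda>y. cinner (Hsg z h) (VT0 s y)"])
    show "bounded_linear (\<lambda>y. cinner (Hsg z h) (VT0 s y))"
      by (intro bounded_linear_compose[OF bounded_linear_cinner_right] complex_linearD(1) VT0_linear s)
    show "bounded_linear (\<lambda>y. cinner h (VT (cnj z) (T (of_real s) y)))"
      by (intro bounded_linear_compose[OF bounded_linear_cinner_right]
          complex_linearD(1)[OF complex_linear_compose[OF VT_linear[OF cz] T_linear[OF cone_real[OF s(1)]]]])
    show "cinner (Hsg z h) (VT0 s y) = cinner h (VT (cnj z) (T (of_real s) y))" if "y \<in> D" for y
      using Hsg_V[OF z T_D[OF s(1) that]] by (simp add: VT0_D[OF s(1) that])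
  qed
  then have "cinner (Hsg z h) (VT w x) = cinner h (VT (cnj z) (T (of_real s) (T (w - of_real s) x)))" by (simp add: VT_eq[OF s])
  also have "T (of_real s) (T (w - of_real s) x) = T (of_real s + (w - of_real s)) x"
    by (rule T_add[OF cone_real[OF s(1)] s(2), symmetric])
  finally show ?thesis by simp
qed

lemma Hsg_add:
  assumes z: "z \<in> slope_cone m'" and w: "w \<in> slope_cone m'"
  shows "Hsg (z + w) h = Hsg z (Hsg w h)"
proof (rule Hsg_unique[OF cone_add[OF z w]])
  fix x assume x: "x \<in> D"
  have cz: "cnj z \<in> slope_cone m" and cw: "cnj w \<in> slope_cone m" using z w m'_cone by simp_all
  have "cinner (Hsg z (Hsg w h)) (V x) = cinner (Hsg w h) (VT (cnj z) x)" by (rule Hsg_V[OF z x])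
  also have "\<dots> = cinner h (VT (cnj w) (T (cnj z) x))" by (rule Hsg_VT[OF w cz])
  also have "\<dots> = cinner h (VT (cnj w + cnj z) x)" by (simp add: VT_add[OF cw cz])
  finally show "cinner (Hsg z (Hsg w h)) (V x) = cinner h (VT (cnj (z + w)) x)" by (simp add: add.commute)
qed

lemma V_approximates: "\<exists>X. (\<forall>n::nat. X n \<in> D) \<and> (\<lambda>n. V (X n)) \<longlonglongrightarrow> y"
proof -
  have "y \<in> closure (V ` D)" using V_dense by simp
  then obtain Y where "\<And>n::nat. Y n \<in> V ` D" "Y \<longlonglongrightarrow> y" unfolding closure_sequential by blast
  then have "\<forall>n. \<exists>x. x \<in> D \<and> Y n = V x" by blast
  then obtain X where "\<And>n. X n \<in> D \<and> Y n = V (X n)" by metis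
  then have "\<forall>n. X n \<in> D" "Y = (\<lambda>n. V (X n))" by (blast, metis)
  with \<open>Y \<longlonglongrightarrow> y\<close> show ?thesis by blast
qed

lemma Hsg_weakly_holomorphic: "(\<lambda>z. cinner (Hsg z h) y) holomorphic_on slope_cone m'"
proof -
  obtain X where X: "\<And>n::nat. X n \<in> D" "(\<lambda>n. V (X n)) \<longlonglongrightarrow> y" using V_approximates by blast
  have hol: "(\<lambda>z. cinner (Hsg z h) (V x)) holomorphic_on slope_cone m'" if x: "x \<in> D" for x
  proof -
    have "cnj \<circ> (\<lambda>z. cinner (VT z x) h) \<circ> cnj holomorphic_on slope_cone m'"
      by (rule holomorphic_on_compose_cnj_cnj[OF holomorphic_on_subset[OF VT_holomorphic] open_cone])
        (use m'_cone in auto)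
    then show ?thesis
      by (rule holomorphic_transform) (auto simp: Hsg_V[OF _ x] cinner_commute[of _ h])
  qed
  show ?thesis
  proof (rule holomorphic_uniform_sequence[OF open_cone hol[OF X(1)]])
    fix z assume "z \<in> slope_cone m'"
    then obtain d where d: "d > 0" "cball z d \<subseteq> slope_cone m'" using open_cone open_contains_cball by blast
    have "uniform_limit (cball z d) (\<lambda>n w. cinner (Hsg w h) (V (X n))) (\<lambda>w. cinner (Hsg w h) y) sequentially"
    proof (rule uniform_limitI)
      fix e :: real assume e: "e > 0"
      have "(\<lambda>n. C * norm h * norm (V (X n) - y)) \<longlonglongrightarrow> C * norm h * norm (y - y)" by (intro tendsto_intros X)
      then have "\<forall>\<^sub>F n in sequentially. C * norm h * norm (V (X n) - y) < e" by (rule order_tendstoD) (use e in simp)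
      then show "\<forall>\<^sub>F n in sequentially. \<forall>w\<in>cball z d. dist (cinner (Hsg w h) (V (X n))) (cinner (Hsg w h) y) < e"
      proof eventually_elim
        case (elim n)
        show ?case
        proof
          fix w assume "w \<in> cball z d"
          then have w: "w \<in> slope_cone m'" using d by auto
          have "dist (cinner (Hsg w h) (V (X n))) (cinner (Hsg w h) y) = cmod (cinner (Hsg w h) (V (X n) - y))"
            by (simp add: dist_norm cinner_diff_right)
          also have "\<dots> \<le> norm (Hsg w h) * norm (V (X n) - y)" by (rule cmod_cinner_le)
          also have "\<dots> \<le> C * norm h * norm (V (X n) - y)" by (intro mult_right_mono Hsg_bound[OF w]) simp
          finally show "dist (cinner (Hsg w h) (V (X n))) (cinner (Hsg w h) y) < e" using elim by simp
        qed
      qed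
    qed
    with d show "\<exists>d>0. cball z d \<subseteq> slope_cone m' \<and>
        uniform_limit (cball z d) (\<lambda>n w. cinner (Hsg w h) (V (X n))) (\<lambda>w. cinner (Hsg w h) y) sequentially" by blast
  qed
qed

lemma Hsg_holomorphic: "holomorphic_into complexify (\<lambda>z. Hsg z h) (slope_cone m')"
  by (rule weakly_holomorphic_imp_holomorphic_into[OF open_cone Hsg_weakly_holomorphic Hsg_bound])

lemma Hsg_real: "t > 0 \<Longrightarrow> x \<in> D \<Longrightarrow> cinner (Hsg (of_real t) h) (V x) = cinner h (V (T (of_real t) x))"
  using Hsg_V[of "of_real t" x h] cone_of_real[OF m'(1)] by (simp add: VT_real)

lemma Hsg_weakly_continuous: "((\<lambda>t. Hsg (of_real t) h \<bullet> y) \<longlongrightarrow> h \<bullet> y) (at_right 0)"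
proof (rule tendstoI)
  fix e :: real assume e: "e > 0"
  define c where "c = (C + 1) * norm h + 1"
  have c: "c > 0" using C_nonneg by (simp add: c_def add_nonneg_pos)
  obtain X where X: "\<And>n::nat. X n \<in> D" "(\<lambda>n. V (X n)) \<longlonglongrightarrow> y" using V_approximates by blast
  obtain n where n: "dist (V (X n)) y < e / (2 * c)"
    using tendstoD[OF X(2), of "e / (2 * c)"] e c by (auto simp: eventually_sequentially)
  define x where "x = X n"
  have x: "x \<in> D" "norm (y - V x) < e / (2 * c)"
    using X n by (auto simp: x_def dist_norm norm_minus_commute)
  have "((\<lambda>t. h \<bullet> V (T (of_real t) x)) \<longlongrightarrow> h \<bullet> V x) (at_right 0)"
    by (intro tendsto_intros V_at_0 x)
  then have "\<forall>\<^sub>F t in at_right 0. dist (h \<bullet> V (T (of_real t) x)) (h \<bullet> V x) < e / 2"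
    by (rule tendstoD) (use e in simp)
  then show "\<forall>\<^sub>F t in at_right 0. dist (Hsg (of_real t) h \<bullet> y) (h \<bullet> y) < e"
    using eventually_at_right_less[of 0]
  proof eventually_elim
    case (elim t)
    have t: "complex_of_real t \<in> slope_cone m'" using cone_of_real[OF m'(1)] elim by simp
    have "Hsg (of_real t) h \<bullet> V x = h \<bullet> V (T (of_real t) x)"
      using Hsg_real[OF elim(2) x(1), of h] by (metis Re_cinner)
    then have "Hsg (of_real t) h \<bullet> y - h \<bullet> y = (Hsg (of_real t) h - h) \<bullet> (y - V x) + (h \<bullet> V (T (of_real t) x) - h \<bullet> V x)"
      by (simp add: inner_diff)
    moreover have "\<bar>(Hsg (of_real t) h - h) \<bullet> (y - V x)\<bar> \<le> e / 2"
    proof -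
      have "\<bar>(Hsg (of_real t) h - h) \<bullet> (y - V x)\<bar> \<le> norm (Hsg (of_real t) h - h) * norm (y - V x)"
        by (rule Cauchy_Schwarz_ineq2)
      also have "norm (Hsg (of_real t) h - h) \<le> c"
        using norm_triangle_ineq4[of "Hsg (of_real t) h" h] Hsg_bound[OF t, of h] by (simp add: c_def algebra_simps)
      then have "norm (Hsg (of_real t) h - h) * norm (y - V x) \<le> c * (e / (2 * c))"
        using x c by (intro mult_mono) auto
      also have "c * (e / (2 * c)) = e / 2" using c by simp
      finally show ?thesis .
    qed
    ultimately show ?case using elim(1) unfolding dist_real_def by linarith
  qed
qed

text \<open>Adjoint semigroups are a priori only weakly continuous. The set \<open>L\<close> of vectors at which strong
continuity holds is a closed subspace; it contains all \<open>Hsg s g\<close> with \<open>s > 0\<close>, because \<open>Hsg\<close> is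
norm-differentiable inside the cone, and these vectors are dense by weak continuity.\<close>

lemma Hsg_strongly_continuous: "((\<lambda>z. Hsg z h) \<longlongrightarrow> h) (at 0 within slope_cone m')"
proof -
  define L where "L = {h. ((\<lambda>z. Hsg z h) \<longlongrightarrow> h) (at 0 within slope_cone m')}"
  have ev: "\<forall>\<^sub>F z in at 0 within slope_cone m'. z \<in> slope_cone m'" by (simp add: eventually_at_filter)
  have sub: "subspace L"
  proof (rule subspaceI)
    show "0 \<in> L"
    proof -
      have "\<forall>\<^sub>F z in at 0 within slope_cone m'. 0 = Hsg z 0"
        using ev by eventually_elim (simp add: linear_0[OF bounded_linear.linear[OF complex_linearD(1)[OF Hsg_linear]]])
      then show ?thesis unfolding L_def by (auto intro: Lim_transform_eventually[OF tendsto_const])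
    qed
    show "g + h \<in> L" if "g \<in> L" "h \<in> L" for g h
    proof -
      have "((\<lambda>z. Hsg z g + Hsg z h) \<longlongrightarrow> g + h) (at 0 within slope_cone m')" using that unfolding L_def by (auto intro: tendsto_intros)
      moreover have "\<forall>\<^sub>F z in at 0 within slope_cone m'. Hsg z g + Hsg z h = Hsg z (g + h)"
        using ev by eventually_elim (simp add: complex_linearD[OF Hsg_linear])
      ultimately show ?thesis unfolding L_def by (auto intro: Lim_transform_eventually)
    qed
    show "r *\<^sub>R h \<in> L" if "h \<in> L" for r h
    proof -
      have "((\<lambda>z. r *\<^sub>R Hsg z h) \<longlongrightarrow> r *\<^sub>R h) (at 0 within slope_cone m')" using that unfolding L_def by (auto intro: tendsto_intros)
      moreover have "\<forall>\<^sub>F z in at 0 within slope_cone m'. r *\<^sub>R Hsg z h = Hsg z (r *\<^sub>R h)"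
        using ev by eventually_elim (simp add: complex_linearD[OF Hsg_linear])
      ultimately show ?thesis unfolding L_def by (auto intro: Lim_transform_eventually)
    qed
  qed
  have range: "Hsg (of_real s) g \<in> L" if s: "s > 0" for s g
  proof -
    have sc: "complex_of_real s \<in> slope_cone m'" using cone_of_real[OF m'(1)] s by simp
    have "isCont (\<lambda>w. Hsg w g) (of_real s)" by (rule holomorphic_into_imp_isCont[OF Hsg_holomorphic sc])
    then have "((\<lambda>z. Hsg (z + of_real s) g) \<longlongrightarrow> Hsg (of_real s) g) (at 0 within slope_cone m')"
      by (rule isCont_tendsto_compose) (rule tendsto_eq_intros refl tendsto_ident_at | simp)+
    moreover have "\<forall>\<^sub>F z in at 0 within slope_cone m'. Hsg (z + of_real s) g = Hsg z (Hsg (of_real s) g)"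
      using ev by eventually_elim (rule Hsg_add[OF _ sc])
    ultimately show ?thesis unfolding L_def by (auto intro: Lim_transform_eventually)
  qed
  have "closure L = UNIV"
  proof (rule dense_if_orthogonal_trivial[OF sub])
    fix k assume k: "\<And>d. d \<in> L \<Longrightarrow> k \<bullet> d = 0"
    have "g \<bullet> k = 0" for g
    proof -
      have "\<forall>\<^sub>F t in at_right 0. Hsg (of_real t) g \<bullet> k = 0"
        using eventually_at_right_less[of 0] by eventually_elim (use k range in \<open>simp add: inner_commute[of _ k]\<close>)
      then have "((\<lambda>t. Hsg (of_real t) g \<bullet> k) \<longlongrightarrow> 0) (at_right 0)" by (rule tendsto_eventually)
      then show ?thesis using tendsto_unique[OF _ Hsg_weakly_continuous] by simp
    qed
    from this[of k] show "k = 0" by simp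
  qed
  moreover have "closed L"
    unfolding closed_sequential_limits
  proof (intro allI impI, elim conjE)
    fix X l assume X: "\<forall>n. X n \<in> L" "X \<longlonglongrightarrow> l"
    have "((\<lambda>z. Hsg z l) \<longlongrightarrow> l) (at 0 within slope_cone m')"
    proof (rule tendstoI)
      fix e :: real assume e: "e > 0"
      define c where "c = C + 1"
      have c: "c > 0" using C_nonneg by (simp add: c_def)
      obtain n where n: "dist (X n) l < e / (2 * c)"
        using tendstoD[OF X(2), of "e / (2 * c)"] e c by (auto simp: eventually_sequentially)
      have "((\<lambda>z. Hsg z (X n)) \<longlongrightarrow> X n) (at 0 within slope_cone m')" using X unfolding L_def by blast
      then have "\<forall>\<^sub>F z in at 0 within slope_cone m'. dist (Hsg z (X n)) (X n) < e / 2" by (rule tendstoD) (use e in simp)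
      with ev show "\<forall>\<^sub>F z in at 0 within slope_cone m'. dist (Hsg z l) l < e"
      proof eventually_elim
        case (elim z)
        have eq: "Hsg z l - l = Hsg z (l - X n) + (Hsg z (X n) - X n) - (l - X n)"
          by (simp add: complex_linearD[OF Hsg_linear[OF elim(1)]])
        have "norm (Hsg z l - l) \<le> norm (Hsg z (l - X n)) + norm (Hsg z (X n) - X n) + norm (l - X n)"
          unfolding eq using norm_triangle_ineq4[of "Hsg z (l - X n) + (Hsg z (X n) - X n)" "l - X n"]
            norm_triangle_ineq[of "Hsg z (l - X n)" "Hsg z (X n) - X n"] by linarith
        also have "norm (Hsg z (l - X n)) \<le> C * norm (l - X n)" by (rule Hsg_bound[OF elim(1)])
        finally have "norm (Hsg z l - l) \<le> c * norm (l - X n) + norm (Hsg z (X n) - X n)"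
          by (simp add: c_def algebra_simps)
        also have "c * norm (l - X n) \<le> c * (e / (2 * c))"
          using n c by (intro mult_left_mono) (auto simp: dist_norm norm_minus_commute)
        also have "c * (e / (2 * c)) = e / 2" using c by simp
        finally show ?case using elim(2) by (simp add: dist_norm)
      qed
    qed
    then show "l \<in> L" unfolding L_def by blast
  qed
  ultimately have "L = UNIV" by (simp add: closure_closed)
  then show ?thesis unfolding L_def by blast
qed

end

section \<open>An energy identity for the representing function\<close>

lemma hadj_works:
  fixes i :: "'h::{real_inner,banach} \<Rightarrow>\<^sub>L 'e::banach"
  shows "blinfun_apply xs (i h) = h \<bullet> hadj i xs"
proof -
  have "bounded_linear (\<lambda>h. blinfun_apply xs (i h))"
    by (intro bounded_linear_compose[OF blinfun.bounded_linear_right] blinfun.bounded_linear_right)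
  then obtain u where u: "\<And>h. blinfun_apply xs (i h) = u \<bullet> h" using riesz_representation by blast
  have "\<forall>h. blinfun_apply xs (i h) = h \<bullet> hadj i xs" unfolding hadj_def
  proof (rule theI[of _ u])
    show "\<forall>h. blinfun_apply xs (i h) = h \<bullet> u" by (simp add: u inner_commute)
    show "v = u" if "\<forall>h. blinfun_apply xs (i h) = h \<bullet> v" for v
      by (rule inner_eq_on_dense[where D = UNIV]) (simp, metis that u inner_commute)
  qed
  then show ?thesis by blast
qed

lemma hadj_unique:
  fixes i :: "'h::{real_inner,banach} \<Rightarrow>\<^sub>L 'e::banach"
  assumes "\<And>h. blinfun_apply xs (i h) = h \<bullet> u"
  shows "hadj i xs = u"
  by (rule inner_eq_on_dense[where D = UNIV]) (simp, metis assms hadj_works inner_commute)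

lemma hadj_add: "hadj i (xs + ys) = hadj i xs + hadj i ys"
  and hadj_scaleR: "hadj i (r *\<^sub>R xs) = r *\<^sub>R hadj i xs"
  and hadj_diff: "hadj i (xs - ys) = hadj i xs - hadj i ys"
  by (rule hadj_unique, simp add: blinfun.add_left blinfun.scaleR_left blinfun.diff_left inner_add_right inner_diff_right hadj_works[symmetric])+

lemma subspace_dual_domain: "subspace {xs. \<exists>ys. (xs, ys) \<in> dual_graph A}"
proof (rule subspaceI)
  have "(0, 0) \<in> dual_graph A" by (auto simp: dual_graph_def)
  then show "0 \<in> {xs. \<exists>ys. (xs, ys) \<in> dual_graph A}" by blast
next
  fix x y assume "x \<in> {xs. \<exists>ys. (xs, ys) \<in> dual_graph A}" "y \<in> {xs. \<exists>ys. (xs, ys) \<in> dual_graph A}"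
  then obtain x' y' where "(x, x') \<in> dual_graph A" "(y, y') \<in> dual_graph A" by blast
  then have "(x + y, x' + y') \<in> dual_graph A" by (fastforce simp: dual_graph_def blinfun.add_left)
  then show "x + y \<in> {xs. \<exists>ys. (xs, ys) \<in> dual_graph A}" by blast
next
  fix c :: real and x assume "x \<in> {xs. \<exists>ys. (xs, ys) \<in> dual_graph A}"
  then obtain x' where "(x, x') \<in> dual_graph A" by blast
  then have "(c *\<^sub>R x, c *\<^sub>R x') \<in> dual_graph A" by (fastforce simp: dual_graph_def blinfun.scaleR_left)
  then show "c *\<^sub>R x \<in> {xs. \<exists>ys. (xs, ys) \<in> dual_graph A}" by blast
qed

lemma truncation_in_L2:
  fixes w :: "real \<Rightarrow> 'h::{real_inner,banach}"
  assumes w: "continuous_on {0..} w"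
  shows "integrable (lebesgue_on {0..}) (\<lambda>t. indicator {0..a} t * (norm (w t))\<^sup>2)"
    and "(LINT t|lebesgue_on {0..}. indicator {0..a} t * (norm (w t))\<^sup>2) = integral {0..a} (\<lambda>t. (norm (w t))\<^sup>2)"
    and "(\<lambda>t. indicator {0..a} t *\<^sub>R w t) \<in> borel_measurable (lebesgue_on {0..})"
proof -
  have c: "continuous_on {0..a} (\<lambda>t. (norm (w t))\<^sup>2)"
    by (intro continuous_intros continuous_on_subset[OF w]) auto
  have i: "integrable (lebesgue_on {0..a}) (\<lambda>t. (norm (w t))\<^sup>2)"
    by (rule continuous_imp_integrable_real[OF c])
  have eq: "(\<lambda>t. indicator {0..} t * (indicator {0..a} t * (norm (w t))\<^sup>2)) = (\<lambda>t. indicator {0..a} t * (norm (w t))\<^sup>2)"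
    by (auto simp: indicator_def fun_eq_iff)
  show "integrable (lebesgue_on {0..}) (\<lambda>t. indicator {0..a} t * (norm (w t))\<^sup>2)"
    using i by (simp add: integrable_restrict_space eq)
  have "(LINT t|lebesgue_on {0..}. indicator {0..a} t * (norm (w t))\<^sup>2) = (LINT t|lebesgue_on {0..a}. (norm (w t))\<^sup>2)"
    by (simp add: integral_restrict_space eq)
  also have "\<dots> = integral {0..a} (\<lambda>t. (norm (w t))\<^sup>2)" by (rule lebesgue_integral_eq_integral[OF i]) simp
  finally show "(LINT t|lebesgue_on {0..}. indicator {0..a} t * (norm (w t))\<^sup>2) = integral {0..a} (\<lambda>t. (norm (w t))\<^sup>2)" .
  have "w \<in> borel_measurable (lebesgue_on {0..})" by (rule continuous_imp_measurable_on_sets_lebesgue[OF w]) simp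
  then have "(\<lambda>t. if t \<in> {0..a} then w t else 0) \<in> borel_measurable (lebesgue_on {0..})"
    by (rule measurable_If_set) (auto simp: sets_restrict_space)
  then show "(\<lambda>t. indicator {0..a} t *\<^sub>R w t) \<in> borel_measurable (lebesgue_on {0..})"
    by (rule measurable_cong[THEN iffD1, rotated]) auto
qed

text \<open>The images of the rational times are dense in the range.\<close>

lemma continuous_range_separable:
  fixes w :: "real \<Rightarrow> 'h::metric_space"
  assumes w: "continuous_on {0..} w"
  shows "\<exists>E. countable E \<and> (\<forall>t\<ge>0. w t \<in> closure E)"
proof -
  define E where "E = w ` (\<rat> \<inter> {0..})"
  have "countable E" unfolding E_def using countable_rat by blast
  moreover have "w t \<in> closure E" if t: "t \<ge> 0" for t
    unfolding closure_approachable
  proof (intro allI impI)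
    fix e :: real assume "e > 0"
    then obtain d where d: "d > 0" "\<And>s. s \<ge> 0 \<Longrightarrow> dist s t < d \<Longrightarrow> dist (w s) (w t) < e"
      using w t unfolding continuous_on_iff by (metis atLeast_iff)
    obtain q where q: "q \<in> \<rat>" "t < q" "q < t + d" using Rats_dense_in_real[of t "t + d"] d by auto
    then have "dist (w q) (w t) < e" using t by (intro d) (auto simp: dist_real_def)
    then show "\<exists>y\<in>E. dist y (w t) < e" using q t by (auto simp: E_def intro!: bexI[of _ "w q"])
  qed
  ultimately show ?thesis by blast
qed

text \<open>In the application \<open>w t = i\<^sup>* S(t)\<^sup>* x\<^sup>*\<close> and \<open>u = I\<^sub>\<infinity>\<^sup>* x\<^sup>*\<close>, which are expected to agree almost everywhere.
Only equality of the norms is required, and it is obtained without comparing the functions pointwise: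
the hypothesis \<open>pairing\<close> is applied to truncations of \<open>w\<close>, which shows that \<open>w\<close> is square
integrable, then to \<open>w\<close>, and then to \<open>u\<close>.\<close>

lemma L2_energy_identity:
  fixes w u :: "real \<Rightarrow> 'h::{real_inner,banach}"
  assumes w: "continuous_on {0..} w" and u: "u \<in> L2 {0..}"
    and pairing: "\<And>g. g \<in> L2 {0..} \<Longrightarrow> ((\<lambda>t. g t \<bullet> w t) has_integral (LINT t|lebesgue_on {0..}. g t \<bullet> u t)) {0..}"
  shows "(\<lambda>n. integral {0..real n} (\<lambda>t. (norm (w t))\<^sup>2)) \<longlonglongrightarrow> (LINT t|lebesgue_on {0..}. u t \<bullet> u t)"
proof -
  let ?L = "lebesgue_on {0..}"
  define F where "F n = integral {0..real n} (\<lambda>t. (norm (w t))\<^sup>2)" for n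
  define U where "U = (LINT t|?L. u t \<bullet> u t)"
  have uint: "integrable ?L (\<lambda>t. (norm (u t))\<^sup>2)" using u by (simp add: L2_def)
  obtain E where E: "countable E" "\<And>t. t \<ge> 0 \<Longrightarrow> w t \<in> closure E" using continuous_range_separable[OF w] by blast
  have U: "U = (LINT t|?L. (norm (u t))\<^sup>2)" by (simp add: U_def power2_norm_eq_inner)
  have wint: "(\<lambda>t. (norm (w t))\<^sup>2) integrable_on {0..a}" for a
    by (intro integrable_continuous_real continuous_intros continuous_on_subset[OF w]) auto
  have gL2: "(\<lambda>t. indicator {0..real n} t *\<^sub>R w t) \<in> L2 {0..}" for n
    unfolding L2_def
  proof (intro CollectI conjI)
    show "(\<lambda>t. indicator {0..real n} t *\<^sub>R w t) \<in> borel_measurable ?L" by (rule truncation_in_L2[OF w])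
    show "\<exists>D. countable D \<and> (AE t in ?L. indicator {0..real n} t *\<^sub>R w t \<in> closure D)"
    proof (intro exI conjI)
      show "countable (insert 0 E)" using E by simp
      show "AE t in ?L. indicator {0..real n} t *\<^sub>R w t \<in> closure (insert 0 E)"
      proof (rule AE_I2)
        fix t :: real assume "t \<in> space ?L"
        then have "t \<ge> 0" by (simp add: space_restrict_space)
        then have "w t \<in> closure (insert 0 E)" using E(2) closure_mono[of E "insert 0 E"] by blast
        moreover have "0 \<in> closure (insert 0 E)" by (meson closure_subset insertI1 subsetD)
        ultimately show "indicator {0..real n} t *\<^sub>R w t \<in> closure (insert 0 E)" by (auto simp: indicator_def)
      qed
    qed
    show "integrable ?L (\<lambda>t. (norm (indicator {0..real n} t *\<^sub>R w t))\<^sup>2)"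
      using truncation_in_L2(1)[OF w, of "real n"]
      by (rule Bochner_Integration.integrable_cong[THEN iffD1, rotated 2]) (auto simp: indicator_def)
  qed
  have gu: "(LINT t|?L. (indicator {0..real n} t *\<^sub>R w t) \<bullet> u t) = F n" for n
  proof -
    have "((\<lambda>t. indicator {0..real n} t * (norm (w t))\<^sup>2) has_integral F n) {0..}"
      unfolding F_def truncation_in_L2(2)[OF w, symmetric]
      by (rule has_integral_integral_lebesgue_on[OF truncation_in_L2(1)[OF w]]) simp
    moreover have "(\<lambda>t. (indicator {0..real n} t *\<^sub>R w t) \<bullet> w t) = (\<lambda>t. indicator {0..real n} t * (norm (w t))\<^sup>2)"
      by (simp add: power2_norm_eq_inner)
    ultimately show ?thesis using pairing[OF gL2, of n] by (metis has_integral_unique)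
  qed
  \<comment> \<open>A nonzero integral certifies that the integrand \<open>\<langle>g, u\<rangle>\<close> is integrable, so that measurability of the
    inner product of two functions into a non-separable space need not be discussed.\<close>
  have FU: "F n \<le> U" for n
  proof (cases "F n = 0")
    case True
    have "U \<ge> 0" unfolding U by (rule integral_nonneg_AE) simp
    then show ?thesis using True by simp
  next
    case False
    then have i1: "integrable ?L (\<lambda>t. (indicator {0..real n} t *\<^sub>R w t) \<bullet> u t)"
      using gu[of n] not_integrable_integral_eq by fastforce
    have "F n \<le> (LINT t|?L. (indicator {0..real n} t * (norm (w t))\<^sup>2 + (norm (u t))\<^sup>2) / 2)"
      unfolding gu[symmetric]
    proof (rule integral_mono[OF i1])
      show "integrable ?L (\<lambda>t. (indicator {0..real n} t * (norm (w t))\<^sup>2 + (norm (u t))\<^sup>2) / 2)"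
        by (intro integrable_divide Bochner_Integration.integrable_add truncation_in_L2(1)[OF w] uint)
      fix t :: real
      have "(indicator {0..real n} t *\<^sub>R w t) \<bullet> u t \<le> norm (indicator {0..real n} t *\<^sub>R w t) * norm (u t)"
        by (rule norm_cauchy_schwarz)
      also have "\<dots> \<le> ((norm (indicator {0..real n} t *\<^sub>R w t))\<^sup>2 + (norm (u t))\<^sup>2) / 2"
        using sum_squares_bound[of "norm (indicator {0..real n} t *\<^sub>R w t)" "norm (u t)"] by simp
      finally show "(indicator {0..real n} t *\<^sub>R w t) \<bullet> u t \<le> (indicator {0..real n} t * (norm (w t))\<^sup>2 + (norm (u t))\<^sup>2) / 2"
        by (auto simp: indicator_def split: if_splits)
    qed
    also have "\<dots> = (F n + U) / 2"
      using truncation_in_L2[OF w, of "real n"] uint by (simp add: U F_def)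
    finally show ?thesis by simp
  qed
  have Fmono: "F n \<le> F k" if "n \<le> k" for n k
    unfolding F_def by (rule integral_subset_le) (use that wint in auto)
  have "convergent F"
    by (rule Bseq_monoseq_convergent[OF _ monoI1[of F]])
      (use FU Fmono in \<open>auto intro!: BseqI'[where K = U] simp: F_def integral_nonneg[OF wint]\<close>)
  then obtain W where W: "F \<longlonglongrightarrow> W" by (auto simp: convergent_def)
  have FW: "F n \<le> W" for n
    by (rule LIMSEQ_le_const[OF W]) (use Fmono in auto)
  have F0: "F n \<ge> 0" for n unfolding F_def by (rule integral_nonneg[OF wint]) simp
  have w_meas: "w \<in> borel_measurable ?L" by (rule continuous_imp_measurable_on_sets_lebesgue[OF w]) simp
  have limit: "AE t in ?L. (\<lambda>n. indicat_real {0..real n} t * (norm (w t))\<^sup>2) \<longlonglongrightarrow> (norm (w t))\<^sup>2"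
  proof (rule AE_I2)
    fix t :: real assume "t \<in> space ?L"
    then have t: "t \<ge> 0" by (simp add: space_restrict_space)
    have "\<forall>\<^sub>F n in sequentially. indicat_real {0..real n} t * (norm (w t))\<^sup>2 = (norm (w t))\<^sup>2"
      using eventually_ge_at_top[of "nat \<lceil>t\<rceil>"]
      by eventually_elim (use t in \<open>auto simp: nat_le_iff ceiling_le_iff\<close>)
    then show "(\<lambda>n. indicat_real {0..real n} t * (norm (w t))\<^sup>2) \<longlonglongrightarrow> (norm (w t))\<^sup>2" by (rule tendsto_eventually)
  qed
  have mono: "AE t in ?L. mono (\<lambda>n. indicat_real {0..real n} t * (norm (w t))\<^sup>2)"
    by (auto simp: mono_def indicator_def intro!: AE_I2)
  have nonneg: "AE t in ?L. 0 \<le> indicat_real {0..real n} t * (norm (w t))\<^sup>2" for n by simp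
  have integrals: "(\<lambda>n. LINT t|?L. indicat_real {0..real n} t * (norm (w t))\<^sup>2) \<longlonglongrightarrow> W"
    using W unfolding truncation_in_L2(2)[OF w] F_def .
  have meas: "(\<lambda>t. (norm (w t))\<^sup>2) \<in> borel_measurable ?L" by (rule continuous_imp_measurable_on_sets_lebesgue) (auto intro!: continuous_intros w)
  note lim = integral_monotone_convergence_nonneg[OF truncation_in_L2(1)[OF w] mono nonneg limit integrals meas]
  have wL2: "w \<in> L2 {0..}"
    unfolding L2_def
  proof (intro CollectI conjI w_meas exI)
    show "countable E" by (rule E)
    show "AE t in ?L. w t \<in> closure E" using E(2) by (intro AE_I2) (simp add: space_restrict_space)
    show "integrable ?L (\<lambda>t. (norm (w t))\<^sup>2)" by (rule lim)
  qed
  have uw: "((\<lambda>t. u t \<bullet> w t) has_integral U) {0..}" using pairing[OF u] by (simp add: U_def)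
  have wu: "(LINT t|?L. w t \<bullet> u t) = W"
  proof -
    have "((\<lambda>t. (norm (w t))\<^sup>2) has_integral W) {0..}"
      using lim has_integral_integral_lebesgue_on[of "{0..}" "\<lambda>t. (norm (w t))\<^sup>2"] by simp
    then show ?thesis using pairing[OF wL2] unfolding power2_norm_eq_inner by (metis has_integral_unique)
  qed
  have "U = W"
  proof (cases "W = 0")
    case True
    have w0: "w t = 0" if t: "t \<ge> 0" for t
    proof -
      obtain n :: nat where n: "t < real n" using reals_Archimedean2 by blast
      have "integral {0..real n} (\<lambda>t. (norm (w t))\<^sup>2) = 0" using FW[of n] F0[of n] True by (simp add: F_def)
      then have "\<forall>t\<in>{0..real n}. (norm (w t))\<^sup>2 = 0"
        by (subst (asm) integral_eq_0_iff) (use n t in \<open>auto intro!: continuous_intros continuous_on_subset[OF w]\<close>)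
      then show ?thesis using n t by simp
    qed
    have "((\<lambda>t. u t \<bullet> w t) has_integral 0) {0..}" by (rule has_integral_is_0) (simp add: w0)
    then show ?thesis using uw True by (metis has_integral_unique)
  next
    case False
    then have "integrable ?L (\<lambda>t. w t \<bullet> u t)" using wu not_integrable_integral_eq by fastforce
    from has_integral_integral_lebesgue_on[OF this] have "((\<lambda>t. w t \<bullet> u t) has_integral W) {0..}" by (simp add: wu)
    moreover have "(\<lambda>t. w t \<bullet> u t) = (\<lambda>t. u t \<bullet> w t)" by (simp add: inner_commute fun_eq_iff)
    ultimately have "((\<lambda>t. u t \<bullet> w t) has_integral W) {0..}" by simp
    then show ?thesis using uw by (metis has_integral_unique)
  qed
  then show ?thesis using W by (simp add: F_def[abs_def] U_def)
qed

section \<open>The form of the Ornstein--Uhlenbeck semigroup\<close>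

text \<open>The part of the argument that takes place at real times; the holomorphic extension of \<open>Sinf\<close> is added
in a second locale. Here \<open>j\<close> is the inclusion of the reproducing kernel space.\<close>

locale ou_form_setting =
  fixes S :: "real \<Rightarrow> 'e::banach \<Rightarrow>\<^sub>L 'e" and i :: "'h::{real_inner,banach} \<Rightarrow>\<^sub>L 'e"
    and Q :: "('e \<Rightarrow>\<^sub>L real) \<Rightarrow> 'e" and j :: "'k::{real_inner,banach} \<Rightarrow>\<^sub>L 'e"
    and Sinf :: "real \<Rightarrow> 'k \<Rightarrow>\<^sub>L 'k" and B :: "'h \<Rightarrow>\<^sub>L 'h"
  assumes S: "c0_semigroup S" and inj_i: "inj (blinfun_apply i)"
    and conv_bounded: "conv_op_bounded S i {0..}" and cov: "conv_cov S i {0..} Q"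
    and inj_j: "inj (blinfun_apply j)" and Q_eq: "\<And>xs. Q xs = j (hadj j xs)"
    and intertwine: "\<And>t k. t \<ge> 0 \<Longrightarrow> S t (j k) = j (Sinf t k)"
    and contraction: "\<And>t k. t > 0 \<Longrightarrow> norm (Sinf t k) \<le> norm k"
    and B: "\<And>xs ys. (xs, ys) \<in> dual_graph (generator S) \<Longrightarrow> i (B (hadj i xs)) = Q ys"
begin

abbreviation "Adual \<equiv> dual_graph (generator S)"

definition Dom :: "('e \<Rightarrow>\<^sub>L real) set" where
  "Dom = {xs. \<exists>ys. (xs, ys) \<in> Adual}"

definition w :: "('e \<Rightarrow>\<^sub>L real) \<Rightarrow> real \<Rightarrow> 'h" where
  "w xs t = hadj i (xs o\<^sub>L S t)"

lemma S_0: "S 0 = id_blinfun" and S_add: "s \<ge> 0 \<Longrightarrow> t \<ge> 0 \<Longrightarrow> S (s + t) = S s o\<^sub>L S t"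
  using S by (auto simp: c0_semigroup_def)

lemma Dom_invariant: "xs \<in> Dom \<Longrightarrow> t \<ge> 0 \<Longrightarrow> xs o\<^sub>L S t \<in> Dom"
  unfolding Dom_def using dual_generator_invariant[OF S] by blast

lemma orbit_continuous: "continuous_on {0..} (\<lambda>t. blinfun_apply ys (S t e))"
  by (intro bounded_linear.continuous_on[OF blinfun.bounded_linear_right] c0_semigroup_continuous[OF S])

lemma orbit_difference: "s \<ge> 0 \<Longrightarrow> (xs, ys) \<in> Adual \<Longrightarrow>
    blinfun_apply xs (S s e) = blinfun_apply xs e + integral {0..s} (\<lambda>r. blinfun_apply ys (S r e))"
  using dual_generator_FTC[OF S, of xs ys s e] by simp

lemma orbit_derivative_within:
  assumes d: "(xs, ys) \<in> Adual" and t: "0 \<le> t" "t < a"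
  shows "((\<lambda>t. blinfun_apply xs (S t e)) has_real_derivative blinfun_apply ys (S t e)) (at t within {0..a})"
proof -
  have "((\<lambda>t. integral {0..t} (\<lambda>r. blinfun_apply ys (S r e))) has_real_derivative blinfun_apply ys (S t e)) (at t within {0..a})"
    by (rule integral_has_real_derivative[OF continuous_on_subset[OF orbit_continuous]]) (use t in auto)
  then have "((\<lambda>t. blinfun_apply xs e + integral {0..t} (\<lambda>r. blinfun_apply ys (S r e))) has_real_derivative blinfun_apply ys (S t e)) (at t within {0..a})"
    by (auto intro!: derivative_eq_intros)
  then show ?thesis
    by (rule has_field_derivative_transform_within[where d = 1]) (use t orbit_difference[OF _ d] in auto)
qed

lemma orbit_derivative:
  assumes d: "(xs, ys) \<in> Adual" and t: "t > 0"
  shows "((\<lambda>t. blinfun_apply xs (S t e)) has_real_derivative blinfun_apply ys (S t e)) (at t)"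
  using orbit_derivative_within[OF d, of t "t + 1" e] t by (simp add: at_within_Icc_at)

lemma orbit_derivative_0:
  assumes d: "(xs, ys) \<in> Adual"
  shows "((\<lambda>t. (blinfun_apply xs (S t e) - blinfun_apply xs e) / t) \<longlongrightarrow> blinfun_apply ys e) (at_right 0)"
  using orbit_derivative_within[OF d, of 0 1 e] by (simp add: has_field_derivative_iff at_within_Icc_at_right S_0)

lemma orbit_Lipschitz:
  assumes d: "(xs, ys) \<in> Adual"
  shows "\<exists>K\<ge>0. \<forall>s t e. 0 \<le> s \<longrightarrow> s \<le> t \<longrightarrow> t \<le> a \<longrightarrow> \<bar>blinfun_apply xs (S t e) - blinfun_apply xs (S s e)\<bar> \<le> K * norm e * (t - s)"
proof -
  obtain C where C: "\<And>t. t \<in> {0..a} \<Longrightarrow> norm (S t) \<le> C" using c0_semigroup_locally_bounded[OF S] by blast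
  have "\<bar>blinfun_apply xs (S t e) - blinfun_apply xs (S s e)\<bar> \<le> (norm ys * \<bar>C\<bar>) * norm e * (t - s)"
    if st: "0 \<le> s" "s \<le> t" "t \<le> a" for s t e
  proof -
    have "blinfun_apply xs (S t e) = blinfun_apply (xs o\<^sub>L S s) (S (t - s) e)" using S_add[of s "t - s"] st by simp
    also have "\<dots> = blinfun_apply (xs o\<^sub>L S s) e + integral {0..t - s} (\<lambda>r. blinfun_apply (ys o\<^sub>L S s) (S r e))"
      by (rule orbit_difference) (use st dual_generator_invariant[OF S d] in auto)
    finally have "\<bar>blinfun_apply xs (S t e) - blinfun_apply xs (S s e)\<bar> = norm (integral {0..t - s} (\<lambda>r. blinfun_apply (ys o\<^sub>L S s) (S r e)))"
      by simp
    also have "\<dots> \<le> (norm ys * \<bar>C\<bar> * norm e) * (t - s - 0)"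
    proof (rule integral_bound)
      show "continuous_on {0..t - s} (\<lambda>r. blinfun_apply (ys o\<^sub>L S s) (S r e))"
        by (rule continuous_on_subset[OF orbit_continuous]) auto
      fix r assume r: "r \<in> {0..t - s}"
      have "blinfun_apply (ys o\<^sub>L S s) (S r e) = blinfun_apply ys (S (s + r) e)" using S_add[of s r] st r by simp
      also have "norm \<dots> \<le> norm ys * norm (S (s + r) e)" by (rule norm_blinfun)
      also have "norm (S (s + r) e) \<le> norm (S (s + r)) * norm e" by (rule norm_blinfun)
      also have "norm (S (s + r)) \<le> \<bar>C\<bar>" using C[of "s + r"] st r by auto
      finally show "norm (blinfun_apply (ys o\<^sub>L S s) (S r e)) \<le> norm ys * \<bar>C\<bar> * norm e"
        by (simp add: mult_left_mono mult_right_mono mult.assoc)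
    qed (use st in auto)
    finally show ?thesis by simp
  qed
  then show ?thesis by (intro exI[where x = "norm ys * \<bar>C\<bar>"]) auto
qed

lemma w_inner: "h \<bullet> w xs t = blinfun_apply xs (S t (i h))"
  by (simp add: w_def hadj_works[symmetric])

text \<open>For general \<open>x\<^sup>*\<close> the function \<open>t \<mapsto> i\<^sup>* S(t)\<^sup>* x\<^sup>*\<close> is only weakly continuous; for \<open>x\<^sup>*\<close> in the domain of \<open>A\<^sup>*\<close> the scalar
orbits are Lipschitz, uniformly over bounded sets of initial values.\<close>

lemma w_continuous:
  assumes xs: "xs \<in> Dom"
  shows "continuous_on {0..} (w xs)"
proof -
  obtain ys where d: "(xs, ys) \<in> Adual" using xs by (auto simp: Dom_def)
  have "continuous_on {0..a} (w xs)" for a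
  proof -
    obtain K where K: "K \<ge> 0" "\<And>s t e. 0 \<le> s \<Longrightarrow> s \<le> t \<Longrightarrow> t \<le> a \<Longrightarrow>
        \<bar>blinfun_apply xs (S t e) - blinfun_apply xs (S s e)\<bar> \<le> K * norm e * (t - s)" using orbit_Lipschitz[OF d] by blast
    have le: "norm (w xs t - w xs s) \<le> K * norm i * (t - s)" if st: "0 \<le> s" "s \<le> t" "t \<le> a" for s t
    proof (rule norm_le_if_inner_le)
      let ?u = "w xs t - w xs s"
      have "?u \<bullet> ?u = blinfun_apply xs (S t (i ?u)) - blinfun_apply xs (S s (i ?u))" by (simp only: inner_diff_right[of ?u] w_inner)
      also have "\<dots> \<le> K * norm (i ?u) * (t - s)" using K(2)[OF st, of "i ?u"] by simp
      also have "\<dots> \<le> K * (norm i * norm ?u) * (t - s)"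
        using K(1) st by (intro mult_right_mono mult_left_mono norm_blinfun) auto
      finally show "?u \<bullet> ?u \<le> K * norm i * (t - s) * norm ?u" by (simp add: ac_simps)
    qed (use K st in auto)
    have "(K * norm i)-lipschitz_on {0..a} (w xs)"
    proof (rule lipschitz_onI)
      fix s t assume "s \<in> {0..a}" "t \<in> {0..a}"
      then show "dist (w xs s) (w xs t) \<le> K * norm i * dist s t"
        using le[of s t] le[of t s] by (cases "s \<le> t") (auto simp: dist_norm norm_minus_commute)
    qed (use K in auto)
    then show ?thesis by (rule lipschitz_on_continuous_on)
  qed
  then show ?thesis
    unfolding continuous_on_eq_continuous_within
  proof (intro ballI)
    fix t :: real assume *: "\<And>a. \<forall>x\<in>{0..a}. continuous (at x within {0..a}) (w xs)" and t: "t \<in> {0..}"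
    have "continuous (at t within {0..t + 1}) (w xs)" using * t by auto
    moreover have "at t within {0..t + 1} = at t within {0..}"
      by (rule at_within_nhd[where S = "{t - 1<..<t + 1}"]) (use t in auto)
    ultimately show "continuous (at t within {0..}) (w xs)" by simp
  qed
qed

lemma w_shift: "t \<ge> 0 \<Longrightarrow> s \<ge> 0 \<Longrightarrow> w (xs o\<^sub>L S t) s = w xs (t + s)"
  unfolding w_def by (rule hadj_unique) (simp add: hadj_works[symmetric] S_add)

lemma Q_form: "blinfun_apply ys (Q xs) = hadj j xs \<bullet> hadj j ys"
  by (simp add: Q_eq hadj_works)

lemma energy:
  assumes xs: "xs \<in> Dom"
  shows "(\<lambda>n. integral {0..real n} (\<lambda>t. (norm (w xs t))\<^sup>2)) \<longlonglongrightarrow> (norm (hadj j xs))\<^sup>2"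
proof -
  obtain u where u: "u \<in> L2 {0..}" "\<And>g. g \<in> L2 {0..} \<Longrightarrow> blinfun_apply xs (conv_op S i {0..} g) = (LINT t|lebesgue_on {0..}. g t \<bullet> u t)"
    "Q xs = conv_op S i {0..} u" using cov unfolding conv_cov_def by blast
  have "(\<lambda>n. integral {0..real n} (\<lambda>t. (norm (w xs t))\<^sup>2)) \<longlonglongrightarrow> (LINT t|lebesgue_on {0..}. u t \<bullet> u t)"
  proof (rule L2_energy_identity[OF w_continuous[OF xs] u(1)])
    fix g :: "real \<Rightarrow> 'h" assume g: "g \<in> L2 {0..}"
    have "(\<lambda>t. S t (i (g t))) integrable_on {0..}" using conv_bounded g unfolding conv_op_bounded_def by blast
    then have "((\<lambda>t. S t (i (g t))) has_integral conv_op S i {0..} g) {0..}" unfolding conv_op_def by (rule integrable_integral)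
    from has_integral_linear[OF this blinfun.bounded_linear_right[of xs]]
    show "((\<lambda>t. g t \<bullet> w xs t) has_integral (LINT t|lebesgue_on {0..}. g t \<bullet> u t)) {0..}"
      by (simp add: o_def w_inner u(2)[OF g])
  qed
  also have "(LINT t|lebesgue_on {0..}. u t \<bullet> u t) = (norm (hadj j xs))\<^sup>2"
    using u(2)[OF u(1)] by (simp add: u(3)[symmetric] Q_form power2_norm_eq_inner)
  finally show ?thesis .
qed

text \<open>Replacing \<open>x\<^sup>*\<close> by \<open>S(t)\<^sup>* x\<^sup>*\<close> shifts the function \<open>w\<close> by \<open>t\<close>.\<close>

lemma energy_decay:
  assumes xs: "xs \<in> Dom" and t: "t \<ge> 0"
  shows "(norm (hadj j (xs o\<^sub>L S t)))\<^sup>2 = (norm (hadj j xs))\<^sup>2 - integral {0..t} (\<lambda>s. (norm (w xs s))\<^sup>2)"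
proof -
  define f where "f s = (norm (w xs s))\<^sup>2" for s
  have cont: "continuous_on {0..} f" unfolding f_def by (intro continuous_intros w_continuous xs)
  have int: "f integrable_on {a..b}" if "a \<ge> 0" for a b
    by (intro integrable_continuous_real continuous_on_subset[OF cont]) (use that in auto)
  define F where "F a = integral {0..a} f" for a
  have mono: "F a \<le> F b" if "a \<le> b" for a b
    unfolding F_def by (rule integral_subset_le) (use that int in \<open>auto simp: f_def\<close>)
  have lim: "(\<lambda>n. F (real n)) \<longlonglongrightarrow> (norm (hadj j xs))\<^sup>2" using energy[OF xs] by (simp add: F_def f_def[abs_def])
  obtain k :: nat where k: "t \<le> real k" using real_arch_simple by blast
  have lim': "(\<lambda>n. F (real n + t)) \<longlonglongrightarrow> (norm (hadj j xs))\<^sup>2"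
  proof (rule tendsto_sandwich[OF _ _ lim LIMSEQ_ignore_initial_segment[OF lim, of k]])
    show "\<forall>\<^sub>F n in sequentially. F (real n) \<le> F (real n + t)" using t by (auto intro!: always_eventually mono)
    show "\<forall>\<^sub>F n in sequentially. F (real n + t) \<le> F (real (n + k))" using k by (auto intro!: always_eventually mono)
  qed
  have "integral {0..real n} (\<lambda>s. (norm (w (xs o\<^sub>L S t) s))\<^sup>2) = F (real n + t) - F t" for n
  proof -
    have "integral {0..real n} (\<lambda>s. (norm (w (xs o\<^sub>L S t) s))\<^sup>2) = integral {0..real n} (f \<circ> ((+) t))"
      by (rule integral_cong) (use t in \<open>auto simp: w_shift f_def\<close>)
    also have "\<dots> = integral {t..real n + t} f" using integral_shift_Icc_real[of 0 "real n" f t] by simp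
    also have "\<dots> = F (real n + t) - F t"
      using Henstock_Kurzweil_Integration.integral_combine[of 0 t "real n + t" f] t int[of 0] by (simp add: F_def)
    finally show ?thesis .
  qed
  then have "(\<lambda>n. F (real n + t) - F t) \<longlonglongrightarrow> (norm (hadj j (xs o\<^sub>L S t)))\<^sup>2"
    using energy[OF Dom_invariant[OF xs t]] by simp
  moreover have "(\<lambda>n. F (real n + t) - F t) \<longlonglongrightarrow> (norm (hadj j xs))\<^sup>2 - F t" by (intro tendsto_intros lim')
  ultimately show ?thesis unfolding F_def f_def by (rule LIMSEQ_unique)
qed

lemma norm_Sinf_le: "t \<ge> 0 \<Longrightarrow> norm (Sinf t k) \<le> norm k"
proof (cases "t = 0")
  case True
  have "j (Sinf 0 k) = j k" using intertwine[of 0 k] by (simp add: S_0)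
  then show ?thesis using inj_j True by (simp add: inj_eq)
qed (use contraction in auto)

lemma hadj_j_shift: "t \<ge> 0 \<Longrightarrow> hadj j (xs o\<^sub>L S t) = adjoint (Sinf t) (hadj j xs)"
proof (rule hadj_unique)
  fix h assume "t \<ge> 0"
  then show "blinfun_apply (xs o\<^sub>L S t) (j h) = h \<bullet> adjoint (Sinf t) (hadj j xs)"
    using hadj_works[of xs j "Sinf t h"]
    by (simp add: intertwine adjoint_hilbert[OF blinfun.bounded_linear_right, symmetric])
qed

lemma hadj_j_Lipschitz:
  assumes d: "(xs, ys) \<in> Adual" and t: "t \<ge> 0"
  shows "norm (hadj j (xs o\<^sub>L S t) - hadj j xs) \<le> norm ys * norm j * t"
proof (rule norm_le_if_inner_le)
  let ?u = "hadj j (xs o\<^sub>L S t) - hadj j xs"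
  have "?u \<bullet> ?u = blinfun_apply xs (S t (j ?u)) - blinfun_apply xs (j ?u)"
    by (simp only: inner_diff_right[of ?u] hadj_works[symmetric] blinfun_apply_blinfun_compose)
  also have "\<dots> = integral {0..t} (\<lambda>r. blinfun_apply ys (S r (j ?u)))" using orbit_difference[OF t d] by simp
  also have "\<dots> \<le> norm (integral {0..t} (\<lambda>r. blinfun_apply ys (S r (j ?u))))" by simp
  also have "\<dots> \<le> (norm ys * (norm j * norm ?u)) * (t - 0)"
  proof (rule integral_bound[OF t])
    show "continuous_on {0..t} (\<lambda>r. blinfun_apply ys (S r (j ?u)))" by (rule continuous_on_subset[OF orbit_continuous]) auto
    fix r assume r: "r \<in> {0..t}"
    have "norm (blinfun_apply ys (S r (j ?u))) \<le> norm ys * norm (j (Sinf r ?u))" using r by (simp add: intertwine norm_blinfun del: real_norm_def)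
    also have "norm (j (Sinf r ?u)) \<le> norm j * norm (Sinf r ?u)" by (rule norm_blinfun)
    also have "norm (Sinf r ?u) \<le> norm ?u" using r by (intro norm_Sinf_le) auto
    finally show "norm (blinfun_apply ys (S r (j ?u))) \<le> norm ys * (norm j * norm ?u)" by (simp add: mult_left_mono)
  qed
  finally show "?u \<bullet> ?u \<le> norm ys * norm j * t * norm ?u" by (simp add: ac_simps)
qed (use t in auto)

lemma form_identity:
  assumes d: "(xs, ys) \<in> Adual"
  shows "blinfun_apply ys (Q xs') = B (hadj i xs) \<bullet> hadj i xs'"
proof -
  have "blinfun_apply ys (Q xs') = blinfun_apply xs' (Q ys)" by (simp add: Q_form inner_commute)
  also have "\<dots> = B (hadj i xs) \<bullet> hadj i xs'" using B[OF d] by (metis hadj_works)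
  finally show ?thesis .
qed

text \<open>The derivative at \<open>0\<close> of \<open>t \<mapsto> |j\<^sup>* S(t)\<^sup>* x\<^sup>*|\<^sup>2\<close> is computed twice: from \<open>energy_decay\<close> it is \<open>- |i\<^sup>* x\<^sup>*|\<^sup>2\<close>,
and from the relation between \<open>B\<close> and \<open>Q A\<^sup>*\<close> it is \<open>2 \<langle>B i\<^sup>* x\<^sup>*, i\<^sup>* x\<^sup>*\<rangle>\<close>.\<close>

lemma Lyapunov:
  assumes d: "(xs, ys) \<in> Adual"
  shows "B (hadj i xs) \<bullet> hadj i xs = - (norm (hadj i xs))\<^sup>2 / 2"
proof -
  define k where "k t = hadj j (xs o\<^sub>L S t)" for t
  define k0 where "k0 = hadj j xs"
  have xs: "xs \<in> Dom" using d by (auto simp: Dom_def)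
  have ev: "\<forall>\<^sub>F t in at_right (0::real). t > 0" by (rule eventually_at_right_less)
  have "((\<lambda>t. ((norm (k t))\<^sup>2 - (norm k0)\<^sup>2) / t) \<longlongrightarrow> - (norm (hadj i xs))\<^sup>2) (at_right 0)"
  proof -
    have "((\<lambda>t. integral {0..t} (\<lambda>s. (norm (w xs s))\<^sup>2)) has_real_derivative (norm (w xs 0))\<^sup>2) (at 0 within {0..1})"
      by (rule integral_has_real_derivative) (auto intro!: continuous_intros continuous_on_subset[OF w_continuous[OF xs]])
    then have "((\<lambda>t. integral {0..t} (\<lambda>s. (norm (w xs s))\<^sup>2) / t) \<longlongrightarrow> (norm (w xs 0))\<^sup>2) (at_right 0)"
      by (simp add: has_field_derivative_iff at_within_Icc_at_right)
    moreover have "w xs 0 = hadj i xs" by (rule hadj_unique[symmetric]) (simp add: w_inner S_0)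
    ultimately have "((\<lambda>t. - (integral {0..t} (\<lambda>s. (norm (w xs s))\<^sup>2) / t)) \<longlongrightarrow> - (norm (hadj i xs))\<^sup>2) (at_right 0)"
      by (intro tendsto_minus) simp
    then show ?thesis
      by (rule Lim_transform_eventually) (use ev in \<open>eventually_elim, simp add: k_def k0_def energy_decay[OF xs]\<close>)
  qed
  moreover have "((\<lambda>t. ((norm (k t))\<^sup>2 - (norm k0)\<^sup>2) / t) \<longlongrightarrow> 2 * (B (hadj i xs) \<bullet> hadj i xs) + 0) (at_right 0)"
  proof -
    have "((\<lambda>t. 2 * ((blinfun_apply xs (S t (Q xs)) - blinfun_apply xs (Q xs)) / t)) \<longlongrightarrow> 2 * (B (hadj i xs) \<bullet> hadj i xs)) (at_right 0)"
      unfolding form_identity[OF d, symmetric] by (intro tendsto_mult tendsto_const orbit_derivative_0[OF d])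
    moreover have "((\<lambda>t. (norm (k t - k0))\<^sup>2 / t) \<longlongrightarrow> 0) (at_right 0)"
    proof (rule tendsto_sandwich[OF _ _ tendsto_const])
      show "\<forall>\<^sub>F t in at_right 0. 0 \<le> (norm (k t - k0))\<^sup>2 / t" using ev by eventually_elim simp
      show "\<forall>\<^sub>F t in at_right 0. (norm (k t - k0))\<^sup>2 / t \<le> (norm ys * norm j)\<^sup>2 * t"
        using ev
      proof eventually_elim
        case (elim t)
        have "norm (k t - k0) \<le> norm ys * norm j * t" unfolding k_def k0_def using elim by (intro hadj_j_Lipschitz d) simp
        then have "(norm (k t - k0))\<^sup>2 \<le> (norm ys * norm j * t)\<^sup>2" by (rule power_mono) simp
        then show ?case using elim by (simp add: power_mult_distrib power2_eq_square[of t] pos_divide_le_eq mult.assoc)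
      qed
      have "((\<lambda>t. (norm ys * norm j)\<^sup>2 * t) \<longlongrightarrow> (norm ys * norm j)\<^sup>2 * 0) (at_right 0)" by (intro tendsto_intros)
      then show "((\<lambda>t. (norm ys * norm j)\<^sup>2 * t) \<longlongrightarrow> 0) (at_right 0)" by simp
    qed
    ultimately have "((\<lambda>t. 2 * ((blinfun_apply xs (S t (Q xs)) - blinfun_apply xs (Q xs)) / t) + (norm (k t - k0))\<^sup>2 / t)
        \<longlongrightarrow> 2 * (B (hadj i xs) \<bullet> hadj i xs) + 0) (at_right 0)" by (rule tendsto_add)
    moreover have "2 * ((blinfun_apply xs (S t (Q xs)) - blinfun_apply xs (Q xs)) / t) + (norm (k t - k0))\<^sup>2 / t
        = ((norm (k t))\<^sup>2 - (norm k0)\<^sup>2) / t" for t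
    proof -
      have "blinfun_apply xs (S t (Q xs)) - blinfun_apply xs (Q xs) = k0 \<bullet> k t - k0 \<bullet> k0"
        by (simp add: k_def k0_def hadj_works[symmetric] Q_eq)
      moreover have "2 * (k0 \<bullet> k t - k0 \<bullet> k0) + (norm (k t - k0))\<^sup>2 = (norm (k t))\<^sup>2 - (norm k0)\<^sup>2"
        by (simp add: power2_norm_eq_inner inner_diff inner_commute)
      ultimately show ?thesis by (metis (no_types) add_divide_distrib times_divide_eq_right)
    qed
    ultimately show ?thesis by simp
  qed
  ultimately have "- (norm (hadj i xs))\<^sup>2 = 2 * (B (hadj i xs) \<bullet> hadj i xs) + 0"
    by (rule tendsto_unique[rotated]) simp
  then show ?thesis by simp
qed

definition D0 :: "'k set" where "D0 = hadj j ` Dom"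

text \<open>The operator \<open>j\<^sup>* x\<^sup>* \<mapsto> i\<^sup>* x\<^sup>*\<close>. It does not depend on the choice of \<open>x\<^sup>*\<close> by \<open>V_hadj\<close>: if \<open>j\<^sup>* x\<^sup>* = 0\<close>, then
\<open>\<langle>Q A\<^sup>* x\<^sup>*, x\<^sup>*\<rangle> = 0\<close>, and the Lyapunov identity yields \<open>i\<^sup>* x\<^sup>* = 0\<close>.\<close>

definition V :: "'k \<Rightarrow> 'h" where
  "V k = hadj i (SOME xs. xs \<in> Dom \<and> hadj j xs = k)"

lemma subspace_Dom: "subspace Dom"
  unfolding Dom_def by (rule subspace_dual_domain)

lemma V_hadj:
  assumes xs: "xs \<in> Dom"
  shows "V (hadj j xs) = hadj i xs"
proof -
  define xs' where "xs' = (SOME xs'. xs' \<in> Dom \<and> hadj j xs' = hadj j xs)"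
  have xs': "xs' \<in> Dom \<and> hadj j xs' = hadj j xs" unfolding xs'_def by (rule someI[of _ xs]) (simp add: xs)
  then have "xs' - xs \<in> Dom" using subspace_diff[OF subspace_Dom] xs by blast
  then obtain ys where d: "(xs' - xs, ys) \<in> Adual" by (auto simp: Dom_def)
  have "hadj j (xs' - xs) = 0" using xs' by (simp add: hadj_diff)
  then have "blinfun_apply ys (Q (xs' - xs)) = 0" by (simp add: Q_form)
  then have "norm (hadj i (xs' - xs)) = 0" using Lyapunov[OF d] form_identity[OF d] by simp
  then have "hadj i xs' = hadj i xs" by (simp add: hadj_diff)
  then show ?thesis by (simp add: V_def xs'_def)
qed

lemma D0_subspace: "subspace D0"
  unfolding D0_def
  by (rule linear_subspace_image[OF _ subspace_Dom]) (rule linearI, simp_all add: hadj_add hadj_scaleR)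

lemma hadj_dense:
  fixes f :: "'x::{real_inner,banach} \<Rightarrow>\<^sub>L 'e"
  assumes "inj (blinfun_apply f)"
  shows "closure (hadj f ` Dom) = UNIV"
proof (rule dense_if_orthogonal_trivial)
  show "subspace (hadj f ` Dom)"
    by (rule linear_subspace_image[OF _ subspace_Dom]) (rule linearI, simp_all add: hadj_add hadj_scaleR)
  fix h assume h: "\<And>d. d \<in> hadj f ` Dom \<Longrightarrow> h \<bullet> d = 0"
  have "f h = 0"
  proof (rule ccontr)
    assume "f h \<noteq> 0"
    then obtain xs ys where "(xs, ys) \<in> Adual" "blinfun_apply xs (f h) \<noteq> 0"
      using dual_generator_separates_points[OF S] by blast
    moreover then have "blinfun_apply xs (f h) = 0" using h[of "hadj f xs"] by (auto simp: hadj_works Dom_def)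
    ultimately show False by simp
  qed
  then show "h = 0" using assms by (metis blinfun.zero_right injD)
qed

lemma D0_dense: "closure D0 = UNIV"
  unfolding D0_def by (rule hadj_dense[OF inj_j])

lemma V_image: "V ` D0 = hadj i ` Dom"
  unfolding D0_def image_image by (rule image_cong) (simp_all add: V_hadj)

lemma V_dense: "closure (V ` D0) = UNIV"
  unfolding V_image by (rule hadj_dense[OF inj_i])

lemma V_linear:
  assumes "x \<in> D0"
  shows V_add: "y \<in> D0 \<Longrightarrow> V (x + y) = V x + V y" and V_scaleR: "V (r *\<^sub>R x) = r *\<^sub>R V x"
proof -
  obtain xs where xs: "xs \<in> Dom" "x = hadj j xs" using assms by (auto simp: D0_def)
  show "V (r *\<^sub>R x) = r *\<^sub>R V x"
    using V_hadj[OF subspace_scale[OF subspace_Dom xs(1)], of r] by (simp add: xs V_hadj hadj_scaleR)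
  assume "y \<in> D0"
  then obtain ys where ys: "ys \<in> Dom" "y = hadj j ys" by (auto simp: D0_def)
  show "V (x + y) = V x + V y"
    using V_hadj[OF subspace_add[OF subspace_Dom xs(1) ys(1)]] by (simp add: xs ys V_hadj hadj_add)
qed

lemma dissipative: "B h \<bullet> h = - (norm h)\<^sup>2 / 2"
proof -
  have "closed {h. B h \<bullet> h = - (norm h)\<^sup>2 / 2}" by (intro closed_Collect_eq continuous_intros) auto
  moreover have "hadj i ` Dom \<subseteq> {h. B h \<bullet> h = - (norm h)\<^sup>2 / 2}" using Lyapunov by (auto simp: Dom_def)
  ultimately have "closure (hadj i ` Dom) \<subseteq> {h. B h \<bullet> h = - (norm h)\<^sup>2 / 2}" by (rule closure_minimal[rotated])
  then show ?thesis using hadj_dense[OF inj_i] by auto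
qed

abbreviation "Tr t \<equiv> adjoint (blinfun_apply (Sinf t))"

lemma Tr_D0: "t \<ge> 0 \<Longrightarrow> x \<in> D0 \<Longrightarrow> Tr t x \<in> D0"
  unfolding D0_def by (auto simp: hadj_j_shift[symmetric] Dom_invariant)

lemma V_Tr: "t \<ge> 0 \<Longrightarrow> xs \<in> Dom \<Longrightarrow> V (Tr t (hadj j xs)) = w xs t"
  by (simp add: hadj_j_shift[symmetric] V_hadj Dom_invariant w_def)

lemma V_Tr_at_0:
  assumes "x \<in> D0"
  shows "((\<lambda>t. V (Tr t x)) \<longlongrightarrow> V x) (at_right 0)"
proof -
  obtain xs where xs: "xs \<in> Dom" "x = hadj j xs" using assms by (auto simp: D0_def)
  have "continuous_on {0..1} (w xs)" by (rule continuous_on_subset[OF w_continuous[OF xs(1)]]) auto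
  then have "(w xs \<longlongrightarrow> w xs 0) (at_right 0)" by (simp add: continuous_on_Icc_at_rightD)
  moreover have "w xs 0 = V x" by (simp add: xs V_hadj) (rule hadj_unique[symmetric], simp add: w_inner S_0)
  ultimately have "(w xs \<longlongrightarrow> V x) (at_right 0)" by simp
  then show ?thesis
    by (rule Lim_transform_eventually) (use eventually_at_right_less[of 0] in \<open>eventually_elim, simp add: xs V_Tr\<close>)
qed

lemma Tr_Lipschitz:
  assumes "x \<in> D0"
  shows "\<exists>c. \<forall>t>0. norm (Tr t x - x) \<le> c * t"
proof -
  obtain xs ys where xs: "(xs, ys) \<in> Adual" "x = hadj j xs" using assms by (auto simp: D0_def Dom_def)
  have "norm (Tr t x - x) \<le> norm ys * norm j * t" if "t > 0" for t
    using hadj_j_Lipschitz[OF xs(1), of t] that by (simp add: xs hadj_j_shift)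
  then show ?thesis by blast
qed

lemma Tr_derivative:
  assumes "x \<in> D0" "y \<in> D0" "t > 0"
  shows "((\<lambda>t. Tr t x \<bullet> y) has_real_derivative B (V (Tr t x)) \<bullet> V y) (at t)"
proof -
  obtain xs zs where xs: "(xs, zs) \<in> Adual" "x = hadj j xs" using assms by (auto simp: D0_def Dom_def)
  obtain ys where ys: "ys \<in> Dom" "y = hadj j ys" using assms by (auto simp: D0_def)
  have xD: "xs \<in> Dom" using xs by (auto simp: Dom_def)
  have eq: "blinfun_apply xs (S t (Q ys)) = Tr t x \<bullet> y" if "t > 0" for t
    using that hadj_works[of "xs o\<^sub>L S t" j y] by (simp add: xs ys hadj_j_shift[symmetric] Q_eq inner_commute)
  have "((\<lambda>t. blinfun_apply xs (S t (Q ys))) has_real_derivative blinfun_apply zs (S t (Q ys))) (at t)"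
    by (rule orbit_derivative[OF xs(1) assms(3)])
  then have "((\<lambda>t. Tr t x \<bullet> y) has_real_derivative blinfun_apply zs (S t (Q ys))) (at t)"
    by (rule has_field_derivative_transform_within_open[where S = "{0<..}"]) (use assms(3) eq in auto)
  moreover have "blinfun_apply zs (S t (Q ys)) = B (V (Tr t x)) \<bullet> V y"
  proof -
    have "blinfun_apply zs (S t (Q ys)) = blinfun_apply (zs o\<^sub>L S t) (Q ys)" by simp
    also have "\<dots> = B (hadj i (xs o\<^sub>L S t)) \<bullet> hadj i ys"
      using assms(3) by (intro form_identity dual_generator_invariant[OF S xs(1)]) simp
    finally show ?thesis using assms(3) xs ys xD by (simp add: V_Tr V_hadj w_def)
  qed
  ultimately show ?thesis by simp
qed

end

section \<open>The restricted semigroup\<close>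

lemma complex_linear_map_prod:
  assumes "bounded_linear f"
  shows "complex_linear (map_prod f f)"
proof -
  interpret bounded_linear f by fact
  obtain K where K: "\<And>x. norm (f x) \<le> norm x * K" "K > 0" using pos_bounded by blast
  have "bounded_linear (map_prod f f)"
  proof (rule bounded_linear_intro)
    show "map_prod f f (x + y) = map_prod f f x + map_prod f f y" for x y by (simp add: prod_eq_iff add)
    show "map_prod f f (r *\<^sub>R x) = r *\<^sub>R map_prod f f x" for r x by (simp add: prod_eq_iff scale)
    show "norm (map_prod f f x) \<le> norm x * (K + K)" for x
    proof -
      have "norm (map_prod f f x) \<le> norm (f (fst x)) + norm (f (snd x))"
        using norm_Pair_le[of "f (fst x)" "f (snd x)"] by (simp add: map_prod_def split_beta)
      also have "\<dots> \<le> norm x * K + norm x * K"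
        using K(2) norm_fst_le[of "fst x" "snd x"] norm_snd_le[of "snd x" "fst x"]
        by (intro add_mono order_trans[OF K(1)] mult_right_mono) auto
      finally show ?thesis by (simp only: distrib_left)
    qed
  qed
  then show ?thesis unfolding complex_linear_def by (simp add: cJ_def neg)
qed

lemma bounded_op_by_complexify:
  assumes "complex_linear f" "\<And>x. norm (f x) \<le> C * norm x"
  shows "bounded_op_by complexify C f"
  unfolding bounded_op_by_def complexify_simps using assms(2) by (simp add: complex_linearD[OF assms(1)])

lemma complex_linear_if_bounded_op_by:
  fixes f :: "'a::{real_inner,banach} \<times> 'a \<Rightarrow> 'a \<times> 'a"
  assumes "bounded_op_by complexify C f"
  shows "complex_linear f" "norm (f x) \<le> C * norm x"
proof -
  have "\<forall>x\<in>UNIV. \<forall>y\<in>UNIV. norm (f (x + y) - (f x + f y)) = 0"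
    and "\<forall>c. \<forall>x\<in>UNIV. norm (f (cscale c x) - cscale c (f x)) = 0" and "\<forall>x\<in>UNIV. norm (f x) \<le> C * norm x"
    using assms unfolding bounded_op_by_def complexify_simps by blast+
  note * = this
  have add: "f (x + y) = f x + f y" and scale: "f (cscale c x) = cscale c (f x)" and b: "norm (f x) \<le> C * norm x" for x y c
    using *(1)[rule_format, of x y] *(2)[rule_format, of x c] *(3)[rule_format, of x] by simp_all
  have "bounded_linear f"
  proof (rule bounded_linear_intro)
    show "f (x + y) = f x + f y" for x y by (rule add)
    show "f (r *\<^sub>R x) = r *\<^sub>R f x" for r x using scale[of "of_real r" x] by (simp add: cscale_def)
    show "norm (f x) \<le> norm x * C" for x using b by (simp add: mult.commute)
  qed
  moreover have "f (cJ x) = cJ (f x)" for x using scale[of \<i> x] by (simp add: cscale_def)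
  ultimately show "complex_linear f" unfolding complex_linear_def by blast
  show "norm (f x) \<le> C * norm x" by (rule b)
qed

lemma holomorphic_into_cong:
  assumes hol: "holomorphic_into complexify F U" and U: "open U" and eq: "\<And>z. z \<in> U \<Longrightarrow> F z = F' z"
  shows "holomorphic_into complexify F' U"
  unfolding holomorphic_into_def complexify_simps
proof
  fix z assume z: "z \<in> U"
  obtain d where "((\<lambda>w. norm (cscale (1 / (w - z)) (F w - F z) - d)) \<longlongrightarrow> 0) (at z)"
    using hol z unfolding holomorphic_into_def complexify_simps by blast
  moreover have "\<forall>\<^sub>F w in at z. w \<in> U" using U z by (rule eventually_at_in_open')
  then have "\<forall>\<^sub>F w in at z. norm (cscale (1 / (w - z)) (F w - F z) - d) = norm (cscale (1 / (w - z)) (F' w - F' z) - d)"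
    by eventually_elim (simp add: eq z)
  ultimately have "((\<lambda>w. norm (cscale (1 / (w - z)) (F' w - F' z) - d)) \<longlongrightarrow> 0) (at z)"
    by (rule Lim_transform_eventually)
  then show "\<exists>d\<in>UNIV. ((\<lambda>w. norm (cscale (1 / (w - z)) (F' w - F' z) - d)) \<longlongrightarrow> 0) (at z)" by blast
qed

text \<open>The holomorphic extension \<open>G\<close> of \<open>Sinf\<close> to a cone is added. The semigroup to which \<open>form_semigroup\<close>
applies is its adjoint; the conjugation of the argument keeps it holomorphic.\<close>

locale ou_complex_setting = ou_form_setting S i Q j Sinf B
  for S :: "real \<Rightarrow> 'e::banach \<Rightarrow>\<^sub>L 'e" and i :: "'h::{real_inner,banach} \<Rightarrow>\<^sub>L 'e"
    and Q and j :: "'k::{real_inner,banach} \<Rightarrow>\<^sub>L 'e" and Sinf B +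
  fixes G :: "complex \<Rightarrow> 'k \<times> 'k \<Rightarrow> 'k \<times> 'k" and m :: real
  assumes m: "m > 0"
    and G_linear: "\<And>z. z \<in> slope_cone m \<Longrightarrow> complex_linear (G z)"
    and G_contraction: "\<And>z x. z \<in> slope_cone m \<Longrightarrow> norm (G z x) \<le> norm x"
    and G_add: "\<And>z w x. z \<in> slope_cone m \<Longrightarrow> w \<in> slope_cone m \<Longrightarrow> G (z + w) x = G z (G w x)"
    and G_holomorphic: "\<And>x y. (\<lambda>z. cinner (G z x) y) holomorphic_on slope_cone m"
    and G_at_0: "\<And>x. ((\<lambda>z. G z x) \<longlongrightarrow> x) (at 0 within slope_cone m)"
    and G_real: "\<And>t x. t > 0 \<Longrightarrow> G (of_real t) x = map_prod (Sinf t) (Sinf t) x"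
begin

definition T :: "complex \<Rightarrow> 'k \<times> 'k \<Rightarrow> 'k \<times> 'k" where
  "T z = adjoint (G (cnj z))"

lemma cinner_T: "z \<in> slope_cone m \<Longrightarrow> cinner (T z x) y = cinner x (G (cnj z) y)"
  using cinner_adjoint[OF G_linear[of "cnj z"], of y x] unfolding T_def by (metis cinner_commute cone_cnj)

lemma T_real:
  assumes t: "t > 0"
  shows "T (of_real t) x = map_prod (Tr t) (Tr t) x"
proof (rule inner_eq_on_dense[where D = UNIV])
  fix y
  have "T (of_real t) x \<bullet> y = x \<bullet> G (of_real t) y"
    using cinner_T[of "of_real t" x y] cone_of_real[OF m] t by (metis Re_cinner complex_cnj_complex_of_real)
  also have "\<dots> = map_prod (Tr t) (Tr t) x \<bullet> y"
    using adjoint_hilbert[OF blinfun.bounded_linear_right[of "Sinf t"]]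
    by (simp add: G_real[OF t] inner_prod_def inner_commute)
  finally show "T (of_real t) x \<bullet> y = map_prod (Tr t) (Tr t) x \<bullet> y" .
qed simp

sublocale cx: form_semigroup T m "D0 \<times> D0" "map_prod V V" "map_prod B B"
proof (unfold_locales)
  show "m > 0" by (rule m)
  show "complex_linear (T z)" if "z \<in> slope_cone m" for z
    unfolding T_def by (rule complex_linear_adjoint[OF G_linear]) (use that in simp)
  show "norm (T z x) \<le> norm x" if "z \<in> slope_cone m" for z x
    using norm_adjoint_le[OF complex_linearD(1)[OF G_linear], of "cnj z" 1 x] G_contraction[of "cnj z"] that
    by (simp add: T_def)
  show "T (z + w) x = T z (T w x)" if "z \<in> slope_cone m" "w \<in> slope_cone m" for z w x
  proof (rule cinner_eq_on_dense[where D = UNIV])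
    fix y
    have "cinner (T (z + w) x) y = cinner x (G (cnj w + cnj z) y)" using that cone_add by (simp add: cinner_T add.commute)
    also have "\<dots> = cinner (T z (T w x)) y" using that by (simp add: G_add cinner_T)
    finally show "cinner (T (z + w) x) y = cinner (T z (T w x)) y" .
  qed simp
  show "(\<lambda>z. cinner (T z x) y) holomorphic_on slope_cone m" for x y
  proof -
    have "cnj \<circ> (\<lambda>z. cinner (G z y) x) \<circ> cnj holomorphic_on slope_cone m"
      by (rule holomorphic_on_compose_cnj_cnj[OF holomorphic_on_subset[OF G_holomorphic] open_cone]) auto
    then show ?thesis
      by (rule holomorphic_transform) (simp add: cinner_T cinner_commute[of x])
  qed
  show "((\<lambda>z. cinner (T z x) y) \<longlongrightarrow> cinner x y) (at 0 within slope_cone m)" for x y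
  proof -
    have "filterlim cnj (at 0 within slope_cone m) (at 0 within slope_cone m)"
      unfolding filterlim_at
    proof
      show "(cnj \<longlongrightarrow> 0) (at 0 within slope_cone m)"
        using tendsto_cnj[OF tendsto_ident_at, of 0 "slope_cone m"] by simp
    qed (simp add: eventually_at_filter)
    then have "((\<lambda>z. cinner x (G (cnj z) y)) \<longlongrightarrow> cinner x y) (at 0 within slope_cone m)"
      by (intro tendsto_cinner_right filterlim_compose[OF G_at_0])
    then show ?thesis
      by (rule Lim_transform_eventually) (simp add: eventually_at_filter cinner_T)
  qed
  show "subspace (D0 \<times> D0)" by (rule subspace_Times[OF D0_subspace D0_subspace])
  show "closure (D0 \<times> D0) = UNIV" by (simp add: closure_Times D0_dense)
  show "cJ x \<in> D0 \<times> D0" if "x \<in> D0 \<times> D0" for x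
    using that subspace_neg[OF D0_subspace] by (auto simp: cJ_def)
  show "map_prod V V (x + y) = map_prod V V x + map_prod V V y" if "x \<in> D0 \<times> D0" "y \<in> D0 \<times> D0" for x y
    using that by (auto simp: V_add)
  show "map_prod V V (c *\<^sub>R x) = c *\<^sub>R map_prod V V x" if "x \<in> D0 \<times> D0" for c x
    using that by (auto simp: V_scaleR)
  show "map_prod V V (cJ x) = cJ (map_prod V V x)" if "x \<in> D0 \<times> D0" for x
    using that V_scaleR[of "snd x" "-1"] by (auto simp: cJ_def)
  show "closure (map_prod V V ` (D0 \<times> D0)) = UNIV"
    by (simp add: map_prod_surj_on[OF refl refl] closure_Times V_dense)
  show "T (of_real t) x \<in> D0 \<times> D0" if "t > 0" "x \<in> D0 \<times> D0" for t x
    using that Tr_D0[of t] by (auto simp: T_real)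
  show "((\<lambda>t. map_prod V V (T (of_real t) x)) \<longlongrightarrow> map_prod V V x) (at_right 0)" if "x \<in> D0 \<times> D0" for x
  proof -
    have "((\<lambda>t. (V (Tr t (fst x)), V (Tr t (snd x)))) \<longlongrightarrow> (V (fst x), V (snd x))) (at_right 0)"
      using that by (intro tendsto_Pair V_Tr_at_0) auto
    then have "((\<lambda>t. (V (Tr t (fst x)), V (Tr t (snd x)))) \<longlongrightarrow> map_prod V V x) (at_right 0)"
      by (simp add: map_prod_def split_beta)
    then show ?thesis
      by (rule Lim_transform_eventually)
        (use eventually_at_right_less[of 0] in \<open>eventually_elim, simp add: T_real map_prod_def split_beta\<close>)
  qed
  show "\<exists>c. \<forall>t>0. norm (T (of_real t) x - x) \<le> c * t" if "x \<in> D0 \<times> D0" for x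
  proof -
    have D: "fst x \<in> D0" "snd x \<in> D0" using that by (simp_all add: mem_Times_iff)
    obtain c1 where c1: "\<forall>t>0. norm (Tr t (fst x) - fst x) \<le> c1 * t" using Tr_Lipschitz[OF D(1)] by blast
    obtain c2 where c2: "\<forall>t>0. norm (Tr t (snd x) - snd x) \<le> c2 * t" using Tr_Lipschitz[OF D(2)] by blast
    note c = c1 c2
    have "norm (T (of_real t) x - x) \<le> (c1 + c2) * t" if "t > 0" for t
    proof -
      have "T (of_real t) x - x = (Tr t (fst x) - fst x, Tr t (snd x) - snd x)"
        by (simp add: T_real[OF that] prod_eq_iff)
      then have "norm (T (of_real t) x - x) \<le> norm (Tr t (fst x) - fst x) + norm (Tr t (snd x) - snd x)"
        by (simp add: norm_Pair_le)
      also have "\<dots> \<le> (c1 + c2) * t" using c that by (auto simp: distrib_right intro: add_mono)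
      finally show ?thesis .
    qed
    then show ?thesis by blast
  qed
  show "complex_linear (map_prod (blinfun_apply B) (blinfun_apply B))"
    by (rule complex_linear_map_prod[OF blinfun.bounded_linear_right])
  show "((\<lambda>t. cinner (T (of_real t) x) y) has_vector_derivative
      cinner (map_prod B B (map_prod V V (T (of_real t) x))) (map_prod V V y)) (at t)"
    if xy: "x \<in> D0 \<times> D0" "y \<in> D0 \<times> D0" and t: "t > 0" for x y t
  proof -
    obtain x1 x2 y1 y2 where eq: "x = (x1, x2)" "y = (y1, y2)" and D: "x1 \<in> D0" "x2 \<in> D0" "y1 \<in> D0" "y2 \<in> D0"
      using xy by auto
    define f where "f t = Complex (Tr t x1 \<bullet> y1 + Tr t x2 \<bullet> y2) (Tr t x2 \<bullet> y1 - Tr t x1 \<bullet> y2)" for t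
    have f: "cinner (T (of_real t) x) y = f t" if "t > 0" for t
      by (simp add: eq T_real[OF that] f_def cinner_def cJ_def)
    have "(f has_vector_derivative
        Complex (B (V (Tr t x1)) \<bullet> V y1 + B (V (Tr t x2)) \<bullet> V y2) (B (V (Tr t x2)) \<bullet> V y1 - B (V (Tr t x1)) \<bullet> V y2)) (at t)"
      unfolding has_vector_derivative_complex_iff f_def complex.sel
      by (intro conjI DERIV_add DERIV_diff Tr_derivative D t)
    moreover have "Complex (B (V (Tr t x1)) \<bullet> V y1 + B (V (Tr t x2)) \<bullet> V y2) (B (V (Tr t x2)) \<bullet> V y1 - B (V (Tr t x1)) \<bullet> V y2)
        = cinner (map_prod B B (map_prod V V (T (of_real t) x))) (map_prod V V y)"
      by (simp add: eq T_real[OF t] cinner_def cJ_def)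
    ultimately have "(f has_vector_derivative cinner (map_prod B B (map_prod V V (T (of_real t) x))) (map_prod V V y)) (at t)" by simp
    then show ?thesis
      by (rule has_vector_derivative_transform_within_open[where S = "{0<..}"]) (use t f in auto)
  qed
  show "map_prod B B h \<bullet> h = - (norm h)\<^sup>2 / 2" for h
    by (simp add: split_beta map_prod_def inner_prod_def norm_prod_def dissipative field_simps)
qed

text \<open>The semigroup \<open>Hsg\<close> lives on the open cone, so its value at time \<open>0\<close> is added by hand.\<close>

definition SH :: "real \<Rightarrow> 'h \<Rightarrow> 'h" where
  "SH t h = (if t = 0 then h else fst (cx.Hsg (of_real t) (h, 0)))"

lemma real_cone: "t > 0 \<Longrightarrow> complex_of_real t \<in> slope_cone cx.m'"
  using cone_of_real[OF cx.m'(1)] by simp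

text \<open>On the real axis the construction respects the real structure, so that it descends to \<open>H\<close>.\<close>

lemma SH_form:
  assumes t: "t > 0" and x: "x \<in> D0"
  shows "SH t h \<bullet> V x = h \<bullet> V (Tr t x)"
proof -
  have "cinner (cx.Hsg (of_real t) (h, 0)) (map_prod V V (x, 0)) = cinner (h, 0) (map_prod V V (T (of_real t) (x, 0)))"
    by (rule cx.Hsg_real[OF t]) (use x subspace_0[OF D0_subspace] in simp)
  moreover have "V 0 = 0" using V_scaleR[of x 0] x by simp
  moreover have "Tr t 0 = 0" by (rule linear_0[OF bounded_linear.linear[OF bounded_linear_adjoint[OF blinfun.bounded_linear_right]]])
  ultimately show ?thesis using t by (simp add: SH_def T_real cinner_def inner_prod_def)
qed

lemma Hsg_eq_SH:
  assumes t: "t > 0"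
  shows "cx.Hsg (of_real t) h = map_prod (SH t) (SH t) h"
proof (rule cx.Hsg_unique[OF real_cone[OF t]])
  fix x assume x: "x \<in> D0 \<times> D0"
  then obtain x1 x2 where eq: "x = (x1, x2)" "x1 \<in> D0" "x2 \<in> D0" by blast
  have "cinner (map_prod (SH t) (SH t) h) (map_prod V V x) = cinner h (map_prod V V (T (of_real t) x))"
    using t by (cases h) (simp add: eq T_real cinner_def cJ_def SH_form)
  then show "cinner (map_prod (SH t) (SH t) h) (map_prod V V x) = cinner h (cx.VT (cnj (of_real t)) x)"
    by (simp add: cx.VT_real[OF t x])
qed

lemma SH_bounded_linear: "t \<ge> 0 \<Longrightarrow> bounded_linear (SH t)"
proof (cases "t = 0")
  case False
  assume "t \<ge> 0"
  with False have t: "t > 0" by simp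
  have "bounded_linear (\<lambda>h. fst (cx.Hsg (of_real t) (h, 0)))"
    by (intro bounded_linear_compose[OF bounded_linear_fst] bounded_linear_compose[OF complex_linearD(1)[OF cx.Hsg_linear[OF real_cone[OF t]]]]
        bounded_linear_Pair bounded_linear_ident bounded_linear_zero)
  moreover have "SH t = (\<lambda>h. fst (cx.Hsg (of_real t) (h, 0)))" using False by (simp add: SH_def fun_eq_iff)
  ultimately show ?thesis by simp
next
  case True
  then have "SH t = (\<lambda>h. h)" by (simp add: SH_def fun_eq_iff)
  then show ?thesis by (simp add: bounded_linear_ident)
qed

text \<open>Both sides agree under every functional in the domain of \<open>A\<^sup>*\<close>, by the relation that defines the
semigroup on \<open>H\<close>, and these functionals separate the points of \<open>E\<close>.\<close>

lemma i_SH: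
  assumes t: "t \<ge> 0"
  shows "i (SH t h) = S t (i h)"
proof (cases "t = 0")
  case True
  then show ?thesis by (simp add: SH_def S_0)
next
  case False
  then have t: "t > 0" using t by simp
  show ?thesis
  proof (rule ccontr)
    assume "i (SH t h) \<noteq> S t (i h)"
    then obtain xs ys where d: "(xs, ys) \<in> Adual" "blinfun_apply xs (i (SH t h) - S t (i h)) \<noteq> 0"
      using dual_generator_separates_points[OF S, of "i (SH t h) - S t (i h)"] by auto
    have xs: "xs \<in> Dom" using d by (auto simp: Dom_def)
    then have "SH t h \<bullet> V (hadj j xs) = h \<bullet> V (Tr t (hadj j xs))" using t by (intro SH_form) (auto simp: D0_def)
    then have "SH t h \<bullet> hadj i xs = h \<bullet> w xs t" using t xs by (simp add: V_hadj V_Tr)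
    then have "blinfun_apply xs (i (SH t h)) = blinfun_apply xs (S t (i h))" by (simp add: hadj_works w_inner)
    then show False using d by (simp add: blinfun.diff_right)
  qed
qed

definition S_H :: "real \<Rightarrow> 'h \<Rightarrow>\<^sub>L 'h" where
  "S_H t = Blinfun (SH t)"

lemma S_H_apply: "t \<ge> 0 \<Longrightarrow> blinfun_apply (S_H t) h = SH t h"
  by (simp add: S_H_def bounded_linear_Blinfun_apply SH_bounded_linear)

lemma complexify_S_H: "t > 0 \<Longrightarrow> complexify_semigroup S_H t h = cx.Hsg (of_real t) h"
  by (cases h) (simp add: complexify_semigroup_def Hsg_eq_SH S_H_apply)

lemma complexify_S_H_0: "complexify_semigroup S_H 0 h = h"
  by (simp add: complexify_semigroup_def S_H_apply SH_def map_prod_def split_beta)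

lemma S_H_intertwine: "t \<ge> 0 \<Longrightarrow> S t o\<^sub>L i = i o\<^sub>L S_H t"
  by (rule blinfun_eqI) (simp add: S_H_apply i_SH)

lemma S_H_add:
  assumes "s \<ge> 0" "t \<ge> 0"
  shows "S_H (s + t) = S_H s o\<^sub>L S_H t"
proof (rule blinfun_eqI)
  fix h
  have "i (S_H (s + t) h) = i ((S_H s o\<^sub>L S_H t) h)" using assms by (simp add: S_H_apply i_SH S_add)
  then show "S_H (s + t) h = (S_H s o\<^sub>L S_H t) h" using inj_i by (simp add: inj_eq)
qed

lemma Hsg_at_right_0: "((\<lambda>t. cx.Hsg (of_real t) h) \<longlongrightarrow> h) (at_right 0)"
proof (rule filterlim_compose[OF cx.Hsg_strongly_continuous])
  show "filterlim complex_of_real (at 0 within slope_cone cx.m') (at_right 0)"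
    unfolding filterlim_at
  proof
    show "(complex_of_real \<longlongrightarrow> 0) (at_right 0)" using tendsto_of_real[OF tendsto_ident_at, of 0 "{0<..}"] by simp
  qed (use real_cone in \<open>auto simp: eventually_at_filter\<close>)
qed

lemma S_H_c0_semigroup: "c0_semigroup S_H"
  unfolding c0_semigroup_def
proof (intro conjI allI impI)
  show "S_H 0 = id_blinfun" by (rule blinfun_eqI) (simp add: S_H_apply SH_def)
  show "S_H (s + t) = S_H s o\<^sub>L S_H t" if "s \<ge> 0" "t \<ge> 0" for s t by (rule S_H_add[OF that])
  fix h
  have "((\<lambda>t. fst (cx.Hsg (of_real t) (h, 0))) \<longlongrightarrow> fst (h, 0 :: 'h)) (at_right 0)" by (rule tendsto_fst[OF Hsg_at_right_0])
  then have "((\<lambda>t. fst (cx.Hsg (of_real t) (h, 0))) \<longlongrightarrow> h) (at_right 0)" by simp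
  then show "((\<lambda>t. S_H t h) \<longlongrightarrow> h) (at_right 0)"
    by (rule Lim_transform_eventually)
      (use eventually_at_right_less[of 0] in \<open>eventually_elim, simp add: S_H_apply SH_def\<close>)
qed

lemma complexify_S_H_at_0: "((\<lambda>t. complexify_semigroup S_H t h) \<longlongrightarrow> h) (at_right 0)"
  by (rule Lim_transform_eventually[OF Hsg_at_right_0])
    (use eventually_at_right_less[of 0] in \<open>eventually_elim, simp add: complexify_S_H\<close>)

lemma complexify_S_H_linear: "complex_linear (complexify_semigroup S_H t)"
proof -
  have "complexify_semigroup S_H t = map_prod (S_H t) (S_H t)" by (simp add: complexify_semigroup_def fun_eq_iff)
  then show ?thesis using complex_linear_map_prod[OF blinfun.bounded_linear_right] by simp
qed

lemma bounded_op_if_complex_linear: "complex_linear f \<Longrightarrow> bounded_op complexify f"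
  unfolding bounded_op_def
proof -
  assume f: "complex_linear f"
  obtain K where "\<And>x. norm (f x) \<le> norm x * K" using bounded_linear.bounded[OF complex_linearD(1)[OF f]] by blast
  then have "bounded_op_by complexify K f" by (intro bounded_op_by_complexify[OF f]) (simp add: mult.commute)
  then show "\<exists>C. bounded_op_by complexify C f" by blast
qed

lemma S_H_bounded_analytic: "bounded_analytic_semigroup complexify (complexify_semigroup S_H)"
proof -
  define \<delta> where "\<delta> = arctan cx.m'"
  have \<delta>: "0 < \<delta>" "\<delta> < pi / 2" using cx.m'(1) by (simp_all only: \<delta>_def zero_less_arctan_iff arctan_ubound)
  have sector: "sector \<delta> = slope_cone cx.m'" using sector_eq_cone[OF \<delta>] by (simp add: \<delta>_def tan_arctan)
  have nz: "z \<noteq> 0" if "z \<in> slope_cone cx.m'" for z using that by (auto simp: slope_cone_def)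
  define E where "E z = (if z = 0 then (\<lambda>h. h) else cx.Hsg z)" for z
  have E_Hsg: "E z = cx.Hsg z" if "z \<in> slope_cone cx.m'" for z using nz[OF that] by (simp add: E_def)
  have E_linear: "complex_linear (E z)" if "z \<in> insert 0 (slope_cone cx.m')" for z
    using that cx.Hsg_linear[of z] nz[of z] by (auto simp: E_def complex_linear_def bounded_linear_ident)
  have "c0_semigroup_on complexify (complexify_semigroup S_H)"
    unfolding c0_semigroup_on_def complexify_simps
  proof (intro conjI allI ballI impI)
    show "bounded_op complexify (complexify_semigroup S_H t)" for t
      by (rule bounded_op_if_complex_linear[OF complexify_S_H_linear])
    show "norm (complexify_semigroup S_H 0 x - x) = 0" for x by (simp add: complexify_S_H_0)
    show "norm (complexify_semigroup S_H (s + t) x - complexify_semigroup S_H s (complexify_semigroup S_H t x)) = 0"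
      if "s \<ge> 0" "t \<ge> 0" for s t x
      using S_H_add[OF that] by (simp add: complexify_semigroup_def map_prod_def split_beta)
    show "((\<lambda>t. norm (complexify_semigroup S_H t x - x)) \<longlongrightarrow> 0) (at_right 0)" for x
      using tendsto_norm[OF LIM_zero[OF complexify_S_H_at_0]] by simp
  qed
  moreover have "analytic_extension complexify (complexify_semigroup S_H) \<delta> E"
    unfolding analytic_extension_def complexify_simps sector
  proof (intro conjI allI ballI impI)
    show "0 < \<delta>" "\<delta> \<le> pi / 2" using \<delta> by simp_all
    show "norm (E (of_real t) x - complexify_semigroup S_H t x) = 0" if "t \<ge> 0" for t x
      using that by (cases "t = 0") (simp_all add: E_def complexify_S_H_0 complexify_S_H)
    show "bounded_op complexify (E z)" if "z \<in> insert 0 (slope_cone cx.m')" for z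
      by (rule bounded_op_if_complex_linear[OF E_linear[OF that]])
    show "norm (E (z + w) x - E z (E w x)) = 0"
      if "z \<in> insert 0 (slope_cone cx.m')" "w \<in> insert 0 (slope_cone cx.m')" for z w x
      using that cone_add[of z cx.m' w] cx.Hsg_add[of z w x] by (auto simp: E_Hsg) (simp_all add: E_def)
    show "holomorphic_into complexify (\<lambda>z. E z x) (slope_cone cx.m')" for x
      by (rule holomorphic_into_cong[OF cx.Hsg_holomorphic open_cone]) (simp add: E_Hsg)
    show "((\<lambda>z. norm (E z x - x)) \<longlongrightarrow> 0) (at 0 within slope_cone cx.m')" for x
    proof -
      have "((\<lambda>z. norm (cx.Hsg z x - x)) \<longlongrightarrow> 0) (at 0 within slope_cone cx.m')"
        using tendsto_norm[OF LIM_zero[OF cx.Hsg_strongly_continuous]] by simp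
      then show ?thesis
        by (rule Lim_transform_eventually) (simp add: eventually_at_filter E_Hsg)
    qed
  qed
  moreover have "\<forall>z\<in>sector \<delta>. bounded_op_by complexify cx.C (E z)"
    unfolding sector by (auto simp: E_Hsg intro!: bounded_op_by_complexify cx.Hsg_linear cx.Hsg_bound)
  ultimately show ?thesis unfolding bounded_analytic_semigroup_def by blast
qed

end

theorem theorem3p3:
  fixes S :: "real \<Rightarrow> 'e::banach \<Rightarrow>\<^sub>L 'e"
    and A :: "('e \<times> 'e) set"
    and i :: "'h::{real_inner,banach} \<Rightarrow>\<^sub>L 'e"
    and Qinf :: "('e \<Rightarrow>\<^sub>L real) \<Rightarrow> 'e"
    and mu_inf :: "'e measure"
    and i_inf :: "'k::{real_inner,banach} \<Rightarrow>\<^sub>L 'e"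
  assumes "c0_semigroup S"
    and "A = generator S"
    and "inj (blinfun_apply i)"
    and "ou_law S i {0..} Qinf mu_inf"
    and "rkhs_inclusion Qinf i_inf"
    and "ou_analytic S A i Qinf mu_inf i_inf"
  shows "\<exists>S_H :: real \<Rightarrow> 'h \<Rightarrow>\<^sub>L 'h.
           c0_semigroup S_H \<and>
           bounded_analytic_semigroup complexify (complexify_semigroup S_H) \<and>
           (\<forall>t\<ge>0. S t o\<^sub>L i = i o\<^sub>L S_H t)"
proof -
  obtain Sinf where Sinf: "\<forall>t\<ge>0. S t o\<^sub>L i_inf = i_inf o\<^sub>L Sinf t"
    "analytic_contraction_semigroup complexify (complexify_semigroup Sinf)"
    using assms(6) unfolding ou_analytic_def by blast
  obtain B :: "'h \<Rightarrow>\<^sub>L 'h" where B: "\<forall>(xs, ys)\<in>dual_graph A. i (B (hadj i xs)) = Qinf ys"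
    using assms(6) unfolding ou_analytic_def by blast
  obtain \<delta> G where ext: "analytic_extension complexify (complexify_semigroup Sinf) \<delta> G"
    and contr: "\<forall>z\<in>sector \<delta>. bounded_op_by complexify 1 (G z)"
    using Sinf(2) unfolding analytic_contraction_semigroup_def by blast
  have \<delta>: "0 < \<delta>" "\<delta> \<le> pi / 2"
    and G_real: "\<And>t x. t \<ge> 0 \<Longrightarrow> G (of_real t) x = complexify_semigroup Sinf t x"
    and G_add: "\<And>z w x. z \<in> sector \<delta> \<Longrightarrow> w \<in> sector \<delta> \<Longrightarrow> G (z + w) x = G z (G w x)"
    and G_hol: "\<And>x. holomorphic_into complexify (\<lambda>z. G z x) (sector \<delta>)"
    and G_0: "\<And>x. ((\<lambda>z. norm (G z x - x)) \<longlongrightarrow> 0) (at 0 within sector \<delta>)"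
    using ext unfolding analytic_extension_def complexify_simps by auto
  \<comment> \<open>Halving the angle keeps the tangent finite in the case \<open>\<delta> = pi / 2\<close>.\<close>
  define m where "m = tan (\<delta> / 2)"
  have \<delta>2: "0 < \<delta> / 2" "\<delta> / 2 < pi / 2" using \<delta> by simp_all
  have m: "m > 0" unfolding m_def by (rule tan_gt_zero[OF \<delta>2])
  have sub: "slope_cone m \<subseteq> sector \<delta>"
    unfolding m_def sector_eq_cone[OF \<delta>2, symmetric] using \<delta> by (auto simp: sector_def)
  have contr': "complex_linear (G z)" "norm (G z x) \<le> 1 * norm x" if "z \<in> slope_cone m" for z x
    using complex_linear_if_bounded_op_by[of 1 "G z"] contr that sub by blast+
  have real: "complex_of_real t \<in> slope_cone m" if "t > 0" for t using cone_of_real[OF m] that by simp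
  interpret ou_complex_setting S i Qinf i_inf Sinf B G m
  proof unfold_locales
    show "c0_semigroup S" "inj (blinfun_apply i)" by (rule assms)+
    show "conv_op_bounded S i {0..}" "conv_cov S i {0..} Qinf" using assms(4) by (auto simp: ou_law_def)
    show "inj (blinfun_apply i_inf)" "\<And>xs. Qinf xs = i_inf (hadj i_inf xs)" using assms(5) by (auto simp: rkhs_inclusion_def)
    show "S t (i_inf k) = i_inf (Sinf t k)" if "t \<ge> 0" for t k
      using Sinf(1) that by (metis blinfun_apply_blinfun_compose)
    show "norm (Sinf t k) \<le> norm k" if "t > 0" for t k
    proof -
      have "norm (G (of_real t) (k, 0)) \<le> norm (k, 0 :: 'k)" using contr'(2)[OF real[OF that], of "(k, 0)"] by simp
      then show ?thesis using that by (simp add: G_real complexify_semigroup_def)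
    qed
    show "i (B (hadj i xs)) = Qinf ys" if "(xs, ys) \<in> dual_graph (generator S)" for xs ys
      using B that assms(2) by blast
    show "m > 0" by (rule m)
    show "complex_linear (G z)" "norm (G z x) \<le> norm x" if "z \<in> slope_cone m" for z x
      using contr'[OF that] by simp_all
    show "G (z + w) x = G z (G w x)" if "z \<in> slope_cone m" "w \<in> slope_cone m" for z w x
      using G_add that sub by blast
    show "(\<lambda>z. cinner (G z x) y) holomorphic_on slope_cone m" for x y
    proof (rule holomorphic_into_imp_weakly[OF _ open_cone])
      show "holomorphic_into complexify (\<lambda>z. G z x) (slope_cone m)"
        using G_hol[of x] sub unfolding holomorphic_into_def by blast
    qed
    show "((\<lambda>z. G z x) \<longlongrightarrow> x) (at 0 within slope_cone m)" for x
      using tendsto_within_subset[OF G_0[of x] sub] by (simp add: tendsto_norm_zero_iff LIM_zero_iff)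
    show "G (of_real t) x = map_prod (Sinf t) (Sinf t) x" if "t > 0" for t x
      using that by (simp add: G_real complexify_semigroup_def)
  qed
  show ?thesis using S_H_c0_semigroup S_H_bounded_analytic S_H_intertwine by blast
qed

end
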